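(* Let $V$ be an $n$-dimensional vector space over a field $F$ of characteristic not equal to $2$, let $n\ge 3$ and $1\le k\le n-1$. Then the following two statements hold. (1) If $n\ne 2k$, then every transformation of $\mathfrak{I}_{k\,n-k}(V)$ preserving the commutativity and the adjacency is defined by a collineation of $V$ or by a correlation of $V$. (2) If $n=2k$, then for every transformation $f$ of $\mathfrak{I}_{k\,k}(V)$ preserving the commutativity and the adjacency, one of the transformations $f$ or $-f$ is defined by a collineation of $V$ or by a correlation of $V$, where $-f$ denotes $\sigma\mapsto -f(\sigma)$.
   Context: For an involution $\sigma\in GL(V)$ ($\sigma^2=\mathrm{Id}$), let $U_+(\sigma)=\{x:\sigma(x)=x\}$ and $U_-(\sigma)=\{x:\sigma(x)=-x\}$, so that $V=U_+(\sigma)\oplus U_-(\sigma)$. $\sigma$ is a $(k,n-k)$-involution if $\dim U_+(\sigma)=k$ and $\dim U_-(\sigma)=n-k$. $\mathfrak{I}_{k\,n-k}(V)$ is the set of all $(k,n-k)$-involutions of $V$. A transformation of a set is a bijection of the set onto itself. Two $m$-dimensional subspaces are adjacent if their intersection has dimension $m-1$. Two involutions $\sigma,\sigma'\in\mathfrak{I}_{k\,n-k}(V)$ are adjacent if either $U_+(\sigma)=U_+(\sigma')$ and $U_-(\sigma),U_-(\sigma')$ are adjacent, or $U_-(\sigma)=U_-(\sigma')$ and $U_+(\sigma),U_+(\sigma')$ are adjacent. A transformation $f$ of $\mathfrak{I}_{k\,n-k}(V)$ preserves the commutativity (respectively, the adjacency) if $f$ maps any two commuting (respectively, adjacent) elements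 to commuting (respectively, adjacent) elements. A collineation is a semilinear bijection $g:V\to V$ (with respect to some automorphism of $F$); the transformation of $\mathfrak{I}_{k\,n-k}(V)$ defined by $g$ is $\sigma\mapsto g\sigma g^{-1}$. A correlation is a semilinear bijection $h:V\to V^*$ onto the dual space; the transformation of $\mathfrak{I}_{k\,n-k}(V)$ defined by $h$ is $\sigma\mapsto h^{-1}\check\sigma h$, where $\check\sigma=(\sigma^* )^{-1}:V^*\to V^*$ is the contragredient of $\sigma$. *)

theory Defs
  imports "HOL-Computational_Algebra.Computational_Algebra" "HOL-Library.Function_Algebras"
begin

text \<open>The vector space \<open>V\<close> is the whole type \<open>'v\<close>, with scalar multiplication \<open>scale\<close>;
  addition of
  functionals is the pointwise one of \<open>Function_Algebras\<close>. A condition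
  \<open>vector_space.dim scale UNIV = n\<close> with \<open>n > 0\<close> entails that \<open>V\<close> is finite-dimensional,
  since the library's dimension is \<open>0\<close> otherwise.\<close>

definition general_linear :: "('a::field \<Rightarrow> 'v::ab_group_add \<Rightarrow> 'v) \<Rightarrow> ('v \<Rightarrow> 'v) set" where
  "general_linear scale = {\<sigma>. Vector_Spaces.linear scale scale \<sigma> \<and> bij \<sigma>}"

definition U_plus :: "('v \<Rightarrow> 'v) \<Rightarrow> 'v set" where
  "U_plus \<sigma> = {x. \<sigma> x = x}"

definition U_minus :: "('v::ab_group_add \<Rightarrow> 'v) \<Rightarrow> 'v set" where
  "U_minus \<sigma> = {x. \<sigma> x = - x}"

definition involutions ::
  "('a::field \<Rightarrow> 'v::ab_group_add \<Rightarrow> 'v) \<Rightarrow> nat \<Rightarrow> nat \<Rightarrow> ('v \<Rightarrow> 'v) set" where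
  "involutions scale k l =
    {\<sigma> \<in> general_linear scale. \<sigma> \<circ> \<sigma> = id \<and>
      vector_space.dim scale (U_plus \<sigma>) = k \<and> vector_space.dim scale (U_minus \<sigma>) = l}"

definition adjacent_subspaces ::
  "('a::field \<Rightarrow> 'v::ab_group_add \<Rightarrow> 'v) \<Rightarrow> 'v set \<Rightarrow> 'v set \<Rightarrow> bool" where
  "adjacent_subspaces scale S T \<longleftrightarrow>
    module.subspace scale S \<and> module.subspace scale T \<and>
    vector_space.dim scale S = vector_space.dim scale T \<and>
    vector_space.dim scale (S \<inter> T) + 1 = vector_space.dim scale S"

definition adjacent_involutions ::
  "('a::field \<Rightarrow> 'v::ab_group_add \<Rightarrow> 'v) \<Rightarrow> ('v \<Rightarrow> 'v) \<Rightarrow> ('v \<Rightarrow> 'v) \<Rightarrow> bool" where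
  "adjacent_involutions scale \<sigma> \<sigma>' \<longleftrightarrow>
    (U_plus \<sigma> = U_plus \<sigma>' \<and> adjacent_subspaces scale (U_minus \<sigma>) (U_minus \<sigma>')) \<or>
    (U_minus \<sigma> = U_minus \<sigma>' \<and> adjacent_subspaces scale (U_plus \<sigma>) (U_plus \<sigma>'))"

definition preserves_commutativity ::
  "('v \<Rightarrow> 'v) set \<Rightarrow> (('v \<Rightarrow> 'v) \<Rightarrow> ('v \<Rightarrow> 'v)) \<Rightarrow> bool" where
  "preserves_commutativity I f \<longleftrightarrow>
    (\<forall>\<sigma>\<in>I. \<forall>\<sigma>'\<in>I. \<sigma> \<circ> \<sigma>' = \<sigma>' \<circ> \<sigma> \<longrightarrow> f \<sigma> \<circ> f \<sigma>' = f \<sigma>' \<circ> f \<sigma>)"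

definition preserves_adjacency ::
  "('a::field \<Rightarrow> 'v::ab_group_add \<Rightarrow> 'v) \<Rightarrow> ('v \<Rightarrow> 'v) set \<Rightarrow>
    (('v \<Rightarrow> 'v) \<Rightarrow> ('v \<Rightarrow> 'v)) \<Rightarrow> bool" where
  "preserves_adjacency scale I f \<longleftrightarrow>
    (\<forall>\<sigma>\<in>I. \<forall>\<sigma>'\<in>I. adjacent_involutions scale \<sigma> \<sigma>' \<longrightarrow> adjacent_involutions scale (f \<sigma>) (f \<sigma>'))"

definition field_automorphism :: "('a::field \<Rightarrow> 'a) \<Rightarrow> bool" where
  "field_automorphism \<tau> \<longleftrightarrow> bij \<tau> \<and> \<tau> 1 = 1 \<and>
    (\<forall>a b. \<tau> (a + b) = \<tau> a + \<tau> b) \<and> (\<forall>a b. \<tau> (a * b) = \<tau> a * \<tau> b)"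

definition semilinear ::
  "('a::field \<Rightarrow> 'v::ab_group_add \<Rightarrow> 'v) \<Rightarrow> ('a \<Rightarrow> 'w::ab_group_add \<Rightarrow> 'w) \<Rightarrow> ('v \<Rightarrow> 'w) \<Rightarrow> bool" where
  "semilinear scale scale' g \<longleftrightarrow> (\<exists>\<tau>. field_automorphism \<tau> \<and>
    (\<forall>x y. g (x + y) = g x + g y) \<and> (\<forall>c x. g (scale c x) = scale' (\<tau> c) (g x)))"

definition collineation ::
  "('a::field \<Rightarrow> 'v::ab_group_add \<Rightarrow> 'v) \<Rightarrow> ('v \<Rightarrow> 'v) \<Rightarrow> bool" where
  "collineation scale g \<longleftrightarrow> semilinear scale scale g \<and> bij g"

definition dual_space ::
  "('a::field \<Rightarrow> 'v::ab_group_add \<Rightarrow> 'v) \<Rightarrow> ('v \<Rightarrow> 'a) set" where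
  "dual_space scale = {\<phi>. Vector_Spaces.linear scale (*) \<phi>}"

definition correlation ::
  "('a::field \<Rightarrow> 'v::ab_group_add \<Rightarrow> 'v) \<Rightarrow> ('v \<Rightarrow> ('v \<Rightarrow> 'a)) \<Rightarrow> bool" where
  "correlation scale h \<longleftrightarrow>
    semilinear scale (\<lambda>c \<phi> x. c * \<phi> x) h \<and> bij_betw h UNIV (dual_space scale)"

definition adjoint_map :: "('v \<Rightarrow> 'v) \<Rightarrow> ('v \<Rightarrow> 'a) \<Rightarrow> ('v \<Rightarrow> 'a)" where
  "adjoint_map \<sigma> \<phi> = \<phi> \<circ> \<sigma>"

text \<open>Only the values on \<open>dual_space scale\<close> are meaningful.\<close>

definition contragredient ::
  "('a::field \<Rightarrow> 'v::ab_group_add \<Rightarrow> 'v) \<Rightarrow> ('v \<Rightarrow> 'v) \<Rightarrow> ('v \<Rightarrow> 'a) \<Rightarrow> ('v \<Rightarrow> 'a)" where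
  "contragredient scale \<sigma> = inv_into (dual_space scale) (adjoint_map \<sigma>)"

definition defined_by_collineation ::
  "('a::field \<Rightarrow> 'v::ab_group_add \<Rightarrow> 'v) \<Rightarrow> ('v \<Rightarrow> 'v) set \<Rightarrow>
    (('v \<Rightarrow> 'v) \<Rightarrow> ('v \<Rightarrow> 'v)) \<Rightarrow> bool" where
  "defined_by_collineation scale I f \<longleftrightarrow>
    (\<exists>g. collineation scale g \<and> (\<forall>\<sigma>\<in>I. f \<sigma> = g \<circ> \<sigma> \<circ> inv g))"

definition defined_by_correlation ::
  "('a::field \<Rightarrow> 'v::ab_group_add \<Rightarrow> 'v) \<Rightarrow> ('v \<Rightarrow> 'v) set \<Rightarrow>
    (('v \<Rightarrow> 'v) \<Rightarrow> ('v \<Rightarrow> 'v)) \<Rightarrow> bool" where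
  "defined_by_correlation scale I f \<longleftrightarrow>
    (\<exists>h. correlation scale h \<and> (\<forall>\<sigma>\<in>I. f \<sigma> = inv h \<circ> contragredient scale \<sigma> \<circ> h))"

end

theory Submission
  imports Defs
begin

text \<open>An involution is the pair \<open>(S, U)\<close> of its complementary eigenspaces. The involutions with a fixed
  \<open>S\<close> (or a fixed \<open>U\<close>) form a fibre, which is connected through triangles of adjacent involutions, and
  the three members of such a triangle share an eigenspace; hence \<open>f\<close> maps fibres into fibres.
  Commutativity forces the two fibres through \<open>(S, U)\<close> to go to fibres of different kinds. So, up to
  exchanging the eigenspaces, \<open>f (S, U) = (g S, h U)\<close>, where bijectivity of \<open>f\<close> makes \<open>g\<close> and \<open>h\<close>
  preserve complementarity in both directions. Adjacency of \<open>k\<close>-dimensional subspaces can be expressed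
  by complementarity, so cliques of the Grassmann graph, which are contained in stars or tops, lead down
  to a bijection of points that preserves lines, and the fundamental theorem of projective geometry
  gives a collineation. Orthogonal complements with respect to a symmetric nondegenerate form turn the
  remaining cases into this one and produce the correlations.\<close>

section \<open>Subspaces of fixed dimension\<close>

context finite_dimensional_vector_space
begin

text \<open>Neither commutativity nor adjacency is assumed to be reflected by \<open>f\<close>, so
  nothing is known directly about its inverse; only complementarity comes back through bijectivity,
  because complementary pairs are exactly the elements of the set on which \<open>f\<close> acts.
  Commutativity enters through a single fact: two commuting involutions that share an eigenspace
  coincide. The characteristic matters for the splitting of \<open>V\<close> and also for having
  four distinct points \<open>p\<close>, \<open>q\<close>, \<open>p + q\<close>,
  \<open>p - q\<close> on a projective line, which is all that the smallest admissible field offers.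
  If \<open>dimension < 2 * k\<close>, the roles of \<open>g\<close> and \<open>h\<close> are
  exchanged. If \<open>2 * k < dimension\<close>, tops cannot become stars; counting would fail over
  infinite fields, so this is shown with finitely many hyperplanes. If
  \<open>dimension = 2 * k\<close>, tops can become stars, and orthogonal complementation repairs
  this. In that case negation acts on the set of involutions as well and exchanges the two kinds of
  fibres, which is why the conclusion allows \<open>-f\<close>.\<close>

definition Gr :: "nat \<Rightarrow> 'b set set" where
  "Gr m = {S. subspace S \<and> dim S = m}"

lemma Gr_iff: "S \<in> Gr m \<longleftrightarrow> subspace S \<and> dim S = m"
  by (simp add: Gr_def)

lemma dim_UNIV_dimension: "dim UNIV = dimension"
  by (simp add: dimension_def)

lemma dim_le_dimension: "dim S \<le> dimension"
  using dim_subset_UNIV .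

lemma dim_Un_Int:
  assumes "subspace S" "subspace T"
  shows "dim (S \<union> T) + dim (S \<inter> T) = dim S + dim T"
proof -
  have "span (S \<union> T) = {x + y |x y. x \<in> S \<and> y \<in> T}"
    using assms by (simp add: span_Un span_eq_iff[THEN iffD2])
  then show ?thesis
    using dim_sums_Int[OF assms] dim_span[of "S \<union> T"] by simp
qed

lemma span_subspace_Un:
  assumes "subspace S" "subspace T"
  shows "span (S \<union> T) = {x + y |x y. x \<in> S \<and> y \<in> T}"
  using assms by (simp add: span_Un span_eq_iff[THEN iffD2])

lemma Gr_subset_eq: "S \<in> Gr m \<Longrightarrow> T \<in> Gr m \<Longrightarrow> S \<subseteq> T \<Longrightarrow> S = T"
  using subspace_dim_equal[of S T] by (simp add: Gr_iff)

lemma Gr_span_insert: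
  assumes "S \<in> Gr m" "x \<notin> S"
  shows "span (insert x S) \<in> Gr (Suc m)"
  using assms by (simp add: Gr_iff dim_insert span_eq_iff[THEN iffD2])

lemma mem_span_insert_subspace:
  assumes "subspace S"
  shows "y \<in> span (insert x S) \<longleftrightarrow> (\<exists>c. \<exists>s\<in>S. y = s + scale c x)"
proof -
  have "y \<in> span (insert x S) \<longleftrightarrow> (\<exists>k. y - scale k x \<in> S)"
    using assms by (simp add: span_breakdown_eq span_eq_iff[THEN iffD2])
  also have "\<dots> \<longleftrightarrow> (\<exists>c. \<exists>s\<in>S. y = s + scale c x)"
    by (metis add_diff_cancel_right' diff_add_cancel)
  finally show ?thesis .
qed

text \<open>If a common vector had a nonzero coefficient at \<open>v\<close>, dividing by it would
  put \<open>v\<close> into \<open>span (S \<union> X)\<close>.\<close>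

lemma disjoint_insert:
  assumes "subspace S" "subspace X" "S \<inter> X = {0}" "v \<notin> span (S \<union> X)"
  shows "S \<inter> span (insert v X) = {0}"
proof -
  have "y = 0" if y: "y \<in> S" "y \<in> span (insert v X)" for y
  proof -
    obtain c x where x: "x \<in> X" "y = x + scale c v"
      using y(2) assms(2) by (auto simp: mem_span_insert_subspace)
    have cv: "scale c v \<in> span (S \<union> X)"
    proof -
      have "y - x \<in> span (S \<union> X)" using y x by (intro span_diff span_base) auto
      then show ?thesis using x by simp
    qed
    have "c = 0"
    proof (rule ccontr)
      assume "c \<noteq> 0"
      then have "v = scale (inverse c) (scale c v)" by simp
      then show False using cv assms(4) by (metis span_scale)
    qed
    then show "y = 0" using x y assms(3) by auto
  qed
  then show ?thesis using assms by (auto simp: subspace_0 span_zero)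
qed

text \<open>As long as \<open>S\<close> and \<open>X\<close> together do not span everything, a
  vector outside their span can be added to \<open>X\<close>. This supplies complements of
  \<open>S\<close> that pass through prescribed vectors.\<close>

lemma extend_disjoint:
  assumes "subspace S" "subspace X" "S \<inter> X = {0}"
  obtains U where "U \<in> Gr (dimension - dim S)" "X \<subseteq> U" "S \<inter> U = {0}"
proof -
  have "\<exists>U. U \<in> Gr (dimension - dim S) \<and> X \<subseteq> U \<and> S \<inter> U = {0}"
    using assms(2,3)
  proof (induction "dimension - dim X" arbitrary: X rule: less_induct)
    case less
    have d: "dim (S \<union> X) = dim S + dim X"
      using dim_Un_Int[OF assms(1) less.prems(1)] less.prems(2) by simp
    show ?case
    proof (cases "span (S \<union> X) = UNIV")
      case True
      then have "dim S + dim X = dimension"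
        using d dim_span[of "S \<union> X"] dim_UNIV_dimension by simp
      then have "X \<in> Gr (dimension - dim S)" using less.prems by (simp add: Gr_iff)
      then show ?thesis using less.prems by blast
    next
      case False
      then obtain v where v: "v \<notin> span (S \<union> X)" by auto
      then have vX: "v \<notin> X" by (auto intro: span_base)
      then have dX: "dim (span (insert v X)) = Suc (dim X)"
        using Gr_span_insert[of X "dim X" v] less.prems(1) by (simp add: Gr_iff)
      have "dim (span (insert v X)) \<le> dimension" by (rule dim_le_dimension)
      then have "dimension - dim (span (insert v X)) < dimension - dim X" using dX by simp
      from less.hyps[OF this _ disjoint_insert[OF assms(1) less.prems v]]
      obtain U where "U \<in> Gr (dimension - dim S)" "span (insert v X) \<subseteq> U" "S \<inter> U = {0}" by auto
      then show ?thesis by (metis dual_order.trans insert_subset span_superset)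
    qed
  qed
  then show ?thesis using that by blast
qed

lemma complement_exists:
  assumes "subspace S"
  obtains U where "U \<in> Gr (dimension - dim S)" "S \<inter> U = {0}"
  using extend_disjoint[OF assms subspace_single_0] assms by (auto simp: subspace_0)

lemma complement_span:
  assumes "S \<in> Gr k" "U \<in> Gr (dimension - k)" "k \<le> dimension" "S \<inter> U = {0}"
  shows "span (S \<union> U) = UNIV"
proof -
  have "dim (S \<union> U) = dimension"
    using dim_Un_Int[of S U] assms by (simp add: Gr_iff)
  then show ?thesis by (simp add: dim_eq_full)
qed

lemma Gr_not_UNIV: "S \<in> Gr m \<Longrightarrow> m < dimension \<Longrightarrow> \<exists>x. x \<notin> S"
  using dim_UNIV_dimension by (metis Gr_iff UNIV_eq_I nat_neq_iff)

lemma two_subspaces_not_cover: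
  assumes "subspace S" "subspace T" "S \<noteq> UNIV" "T \<noteq> UNIV"
  shows "\<exists>x. x \<notin> S \<and> x \<notin> T"
proof (rule ccontr)
  assume "\<not> ?thesis"
  then have cov: "\<And>x. x \<in> S \<or> x \<in> T" by blast
  obtain x where x: "x \<notin> S" using assms by auto
  obtain y where y: "y \<notin> T" using assms by auto
  have "x \<in> T" "y \<in> S" using cov x y by blast+
  then have "x + y \<notin> S" "x + y \<notin> T"
    using x y assms by (metis add_diff_cancel_right' subspace_diff, metis add_diff_cancel_left' subspace_diff)
  then show False using cov by blast
qed

text \<open>Induction on the codimension: a vector \<open>v\<close> outside both spaces is adjoined
  to each of them, and a common complement of the enlarged spaces is then enlarged by
  \<open>v\<close> itself.\<close>

lemma common_complement:
  assumes "S \<in> Gr k" "T \<in> Gr k" "k \<le> dimension"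
  obtains U where "U \<in> Gr (dimension - k)" "S \<inter> U = {0}" "T \<inter> U = {0}"
proof -
  have "\<exists>U. U \<in> Gr (dimension - k) \<and> S \<inter> U = {0} \<and> T \<inter> U = {0}"
    using assms
  proof (induction "dimension - k" arbitrary: S T k)
    case 0
    then have "{0} \<in> Gr (dimension - k)" by (simp add: Gr_iff)
    moreover have "S \<inter> {0} = {0}" "T \<inter> {0} = {0}"
      using 0 by (auto simp: Gr_iff subspace_0)
    ultimately show ?case by blast
  next
    case (Suc d)
    then have k: "k < dimension" by simp
    have "S \<noteq> UNIV" "T \<noteq> UNIV" using Suc Gr_not_UNIV[OF _ k] by blast+
    then obtain v where v: "v \<notin> S" "v \<notin> T"
      using two_subspaces_not_cover Suc.prems by (metis Gr_iff)
    have "\<exists>U. U \<in> Gr (dimension - Suc k) \<and> span (insert v S) \<inter> U = {0} \<and> span (insert v T) \<inter> U = {0}"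
      by (rule Suc.hyps(1)) (use Suc k v in \<open>auto intro!: Gr_span_insert\<close>)
    then obtain U where U: "U \<in> Gr (dimension - Suc k)" "span (insert v S) \<inter> U = {0}"
      "span (insert v T) \<inter> U = {0}" by blast
    have sU: "subspace U" using U by (simp add: Gr_iff)
    have v0: "v \<noteq> 0" using v Suc.prems by (auto simp: Gr_iff subspace_0)
    have vU: "v \<notin> U" using U(2) v0 by (metis IntI insertI1 singletonD span_base)
    \<comment> \<open>If \<open>v = r + u\<close>, then \<open>u = v - r\<close> lies in
      \<open>U\<close> and in the enlarged space, so \<open>u = 0\<close> and
      \<open>v \<in> R\<close>, which was excluded.\<close>
    have *: "R \<inter> span (insert v U) = {0}"
      if R: "R \<in> Gr k" "v \<notin> R" "span (insert v R) \<inter> U = {0}" for R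
    proof -
      have sR: "subspace R" using R by (simp add: Gr_iff)
      have "v \<notin> span (R \<union> U)"
      proof
        assume "v \<in> span (R \<union> U)"
        then obtain r u where ru: "r \<in> R" "u \<in> U" "v = r + u"
          using span_subspace_Un[OF sR sU] by auto
        have "u \<in> span (insert v R)"
          using ru by (metis add_diff_cancel_left' insertCI span_base span_diff)
        then have "u = 0" using R(3) ru by auto
        then show False using ru R by simp
      qed
      moreover have "R \<inter> U = {0}"
        using R(3) sR sU by (auto simp: subspace_0 intro: span_base)
      ultimately show ?thesis using disjoint_insert[OF sR sU] by blast
    qed
    have "span (insert v U) \<in> Gr (dimension - k)"
      using Gr_span_insert[OF U(1) vU] k by (simp add: Suc_diff_Suc)
    then show ?case using * Suc.prems v U by blast
  qed
  then show ?thesis using that by blast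
qed

text \<open>The line of \<open>x\<close> has a complement in \<open>V\<close> that contains
  \<open>M\<close>; this hyperplane of \<open>V\<close> is then intersected with
  \<open>L\<close>.\<close>

lemma Gr_hyperplane_avoiding:
  assumes "L \<in> Gr (Suc m)" "M \<subseteq> L" "subspace M" "x \<in> L" "x \<notin> M"
  obtains T where "T \<in> Gr m" "M \<subseteq> T" "T \<subseteq> L" "x \<notin> T"
proof -
  have sL: "subspace L" using assms by (simp add: Gr_iff)
  have x0: "x \<noteq> 0" using assms by (auto simp: subspace_0)
  have "span {x} \<inter> M = {0}"
  proof -
    have "scale c x \<notin> M" if "c \<noteq> 0" for c
      using that assms by (metis scale_one scale_scale left_inverse subspace_scale)
    then have "c = 0" if "scale c x \<in> M" for c using that by blast
    then show ?thesis using assms by (auto simp: span_singleton subspace_0 image_iff intro: exI[of _ 0])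
  qed
  then obtain U where U: "U \<in> Gr (dimension - 1)" "M \<subseteq> U" "span {x} \<inter> U = {0}"
    using extend_disjoint[of "span {x}" M] x0 assms by auto
  have xU: "x \<notin> U" using U x0 by (metis IntI insertI1 singletonD span_base)
  have sU: "subspace U" using U by (simp add: Gr_iff)
  have dp: "dimension \<ge> Suc m" using assms dim_le_dimension by (metis Gr_iff)
  \<comment> \<open>\<open>U\<close> is a hyperplane of \<open>V\<close> that misses the vector
    \<open>x\<close> of \<open>L\<close>, so the two span everything.\<close>
  have "dim (L \<union> U) = dimension"
  proof -
    have "U \<subseteq> span (L \<union> U)" "x \<in> span (L \<union> U)" using assms by (auto intro: span_base)
    then have "U \<subset> span (L \<union> U)" using xU by blast
    then have "dim (span U) < dim (span (L \<union> U))"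
      using sU by (intro dim_psubset) (simp add: span_eq_iff[THEN iffD2])
    then have "dim U < dim (L \<union> U)" by simp
    then show ?thesis using U dim_le_dimension[of "L \<union> U"] by (simp add: Gr_iff)
  qed
  then have "dim (L \<inter> U) = m"
    using dim_Un_Int[OF sL sU] assms U dp by (simp add: Gr_iff)
  then have "L \<inter> U \<in> Gr m" using sL sU by (simp add: Gr_iff subspace_inter)
  then show ?thesis using that[of "L \<inter> U"] assms U xU by blast
qed

text \<open>Adjoining to \<open>M\<close> a vector outside \<open>span (insert x M)\<close> keeps
  \<open>x\<close> out, by the exchange property.\<close>

lemma Gr_superspace_avoiding:
  assumes "M \<in> Gr m" "x \<notin> M" "Suc m < dimension"
  obtains S where "S \<in> Gr (Suc m)" "M \<subseteq> S" "x \<notin> S"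
proof -
  have "span (insert x M) \<in> Gr (Suc m)" using Gr_span_insert assms by blast
  then obtain y where y: "y \<notin> span (insert x M)" using Gr_not_UNIV assms by blast
  have "y \<notin> M" using y by (meson insertCI span_base)
  then have "span (insert y M) \<in> Gr (Suc m)" using Gr_span_insert assms by blast
  moreover have "x \<notin> span (insert y M)"
    using y assms by (metis Gr_iff in_span_insert span_eq_iff)
  moreover have "M \<subseteq> span (insert y M)" by (auto intro: span_base)
  ultimately show ?thesis using that by blast
qed

end

section \<open>The fundamental theorem of projective geometry\<close>

context finite_dimensional_vector_space
begin

section \<open>Independence of pairs and triples of vectors, by coefficients\<close>

text \<open>Independence of the family and not of the set \<open>{x, y}\<close>: for
  \<open>x = y\<close> the set collapses to a singleton, which is independent as soon as
  \<open>x \<noteq> 0\<close>.\<close>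

definition indep2 :: "'b \<Rightarrow> 'b \<Rightarrow> bool" where
  "indep2 x y \<longleftrightarrow> (\<forall>a b. scale a x + scale b y = 0 \<longrightarrow> a = 0 \<and> b = 0)"

definition indep3 :: "'b \<Rightarrow> 'b \<Rightarrow> 'b \<Rightarrow> bool" where
  "indep3 x y z \<longleftrightarrow>
    (\<forall>a b c. scale a x + scale b y + scale c z = 0 \<longrightarrow> a = 0 \<and> b = 0 \<and> c = 0)"

lemma span_one: "z \<in> span {x} \<longleftrightarrow> (\<exists>a. z = scale a x)"
  by (auto simp: span_singleton)

lemma span_two: "z \<in> span {x, y} \<longleftrightarrow> (\<exists>a b. z = scale a x + scale b y)"
proof
  assume "z \<in> span {x, y}"
  then obtain k where "z - scale k x \<in> span {y}" by (auto simp: span_breakdown_eq)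
  then obtain b where "z - scale k x = scale b y" by (auto simp: span_one)
  then have "z = scale k x + scale b y" by (simp add: algebra_simps)
  then show "\<exists>a b. z = scale a x + scale b y" by blast
next
  assume "\<exists>a b. z = scale a x + scale b y"
  moreover have "x \<in> span {x, y}" "y \<in> span {x, y}" by (auto intro: span_base)
  ultimately show "z \<in> span {x, y}" using span_add span_scale by blast
qed

lemma indep2_eq:
  assumes "indep2 x y" "scale a x + scale b y = scale a' x + scale b' y"
  shows "a = a' \<and> b = b'"
proof -
  have "scale (a - a') x + scale (b - b') y = 0"
    using assms(2) by (simp add: scale_left_diff_distrib algebra_simps)
  then show ?thesis using assms(1) unfolding indep2_def by (metis eq_iff_diff_eq_0)
qed

lemma indep3_eq:
  assumes "indep3 x y z"
    "scale a x + scale b y + scale c z = scale a' x + scale b' y + scale c' z"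
  shows "a = a' \<and> b = b' \<and> c = c'"
proof -
  have "scale (a - a') x + scale (b - b') y + scale (c - c') z = 0"
    using assms(2) by (simp add: scale_left_diff_distrib algebra_simps)
  then show ?thesis using assms(1) unfolding indep3_def by (metis eq_iff_diff_eq_0)
qed

lemma indep2_iff: "indep2 x y \<longleftrightarrow> x \<noteq> 0 \<and> y \<notin> span {x}"
proof
  assume i: "indep2 x y"
  have "x \<noteq> 0"
  proof
    assume "x = 0"
    then have "scale 1 x + scale 0 y = 0" by simp
    then show False using i unfolding indep2_def by (metis one_neq_zero)
  qed
  moreover have "y \<notin> span {x}"
  proof
    assume "y \<in> span {x}"
    then obtain a where "y = scale a x" by (auto simp: span_one)
    then have "scale a x + scale (- 1) y = 0" by simp
    then show False using i unfolding indep2_def by (metis neg_equal_0_iff_equal one_neq_zero)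
  qed
  ultimately show "x \<noteq> 0 \<and> y \<notin> span {x}" by blast
next
  assume h: "x \<noteq> 0 \<and> y \<notin> span {x}"
  show "indep2 x y"
    unfolding indep2_def
  proof (intro allI impI)
    fix a b assume e: "scale a x + scale b y = 0"
    have "b = 0"
    proof (rule ccontr)
      assume b: "b \<noteq> 0"
      have "scale b y = scale (- a) x" using e by (simp add: eq_neg_iff_add_eq_0 add.commute)
      then have "scale (inverse b) (scale b y) = scale (inverse b) (scale (- a) x)" by simp
      then have "y = scale (inverse b * - a) x" using b by simp
      then show False using h unfolding span_one by blast
    qed
    then show "a = 0 \<and> b = 0" using e h by simp
  qed
qed

lemma indep3_iff: "indep3 x y z \<longleftrightarrow> indep2 x y \<and> z \<notin> span {x, y}"
proof
  assume i: "indep3 x y z"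
  have "indep2 x y"
    unfolding indep2_def
  proof (intro allI impI)
    fix a b assume "scale a x + scale b y = 0"
    then have "scale a x + scale b y + scale 0 z = 0" by simp
    then show "a = 0 \<and> b = 0" using i unfolding indep3_def by blast
  qed
  moreover have "z \<notin> span {x, y}"
  proof
    assume "z \<in> span {x, y}"
    then obtain a b where "z = scale a x + scale b y" by (auto simp: span_two)
    then have "scale a x + scale b y + scale (- 1) z = 0" by simp
    then show False using i unfolding indep3_def by (metis neg_equal_0_iff_equal one_neq_zero)
  qed
  ultimately show "indep2 x y \<and> z \<notin> span {x, y}" by blast
next
  assume h: "indep2 x y \<and> z \<notin> span {x, y}"
  show "indep3 x y z"
    unfolding indep3_def
  proof (intro allI impI)
    fix a b c assume e: "scale a x + scale b y + scale c z = 0"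
    have c: "c = 0"
    proof (rule ccontr)
      assume c: "c \<noteq> 0"
      have "scale c z = scale (- a) x + scale (- b) y" using e
        by (simp add: eq_neg_iff_add_eq_0 algebra_simps)
      then have "scale (inverse c) (scale c z)
          = scale (inverse c) (scale (- a) x + scale (- b) y)" by simp
      then have "z = scale (inverse c * - a) x + scale (inverse c * - b) y"
        using c by (simp add: scale_right_distrib scale_right_diff_distrib)
      then show False using h unfolding span_two by blast
    qed
    then have "scale a x + scale b y = 0" using e by simp
    then show "a = 0 \<and> b = 0 \<and> c = 0" using c h unfolding indep2_def by blast
  qed
qed

lemma indep2_commute: "indep2 x y \<longleftrightarrow> indep2 y x"
  unfolding indep2_def by (metis add.commute)

lemma indep3_swap12: "indep3 x y z \<longleftrightarrow> indep3 y x z"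
  unfolding indep3_def by (metis add.commute)

lemma indep3_swap23: "indep3 x y z \<longleftrightarrow> indep3 x z y"
proof -
  have "indep3 x z y" if i: "indep3 x y z" for x y z
    unfolding indep3_def
  proof (intro allI impI)
    fix a b c assume "scale a x + scale b z + scale c y = 0"
    then have "scale a x + scale c y + scale b z = 0" by (simp add: ac_simps)
    then show "a = 0 \<and> b = 0 \<and> c = 0" using i unfolding indep3_def by blast
  qed
  then show ?thesis by blast
qed

lemma indep3_add:
  assumes "indep3 x y z" "w \<in> span {x, y}"
  shows "indep3 x y (w + z)"
  using assms span_add_eq[of w "{x, y}" z] by (simp add: indep3_iff)

lemma indep2_add:
  assumes "indep2 x y" "w \<in> span {x}"
  shows "indep2 x (w + y)"
  using assms span_add_eq[of w "{x}" y] by (simp add: indep2_iff)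

lemma indep3_indep2: "indep3 x y z \<Longrightarrow> indep2 x y \<and> indep2 x z \<and> indep2 y z"
  using indep3_iff indep3_swap12 indep3_swap23 by blast

end

text \<open>\<open>\<rho>\<close> picks a representative vector of the image of each point of the projective space.\<close>

locale point_collineation = finite_dimensional_vector_space scale Basis
  for scale :: "'a::field \<Rightarrow> 'v::ab_group_add \<Rightarrow> 'v" and Basis :: "'v set" +
  fixes \<rho> :: "'v \<Rightarrow> 'v"
  assumes ex_off_line: "\<exists>z. z \<notin> span {x, y}"
    and rho_nz: "x \<noteq> 0 \<Longrightarrow> \<rho> x \<noteq> 0"
    and rho_line: "x \<noteq> 0 \<Longrightarrow> y \<noteq> 0 \<Longrightarrow> z \<noteq> 0 \<Longrightarrow> z \<in> span {x, y} \<longleftrightarrow> \<rho> z \<in> span {\<rho> x, \<rho> y}"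
    and rho_surj: "w \<noteq> 0 \<Longrightarrow> \<exists>x. x \<noteq> 0 \<and> w \<in> span {\<rho> x}"
begin

section \<open>Lifting a collinearity-preserving map of points to a semilinear bijection\<close>

lemma rho_point: "x \<noteq> 0 \<Longrightarrow> y \<noteq> 0 \<Longrightarrow> y \<in> span {x} \<longleftrightarrow> \<rho> y \<in> span {\<rho> x}"
  using rho_line[of x x y] by simp

lemma indep2_rho: "indep2 x y \<Longrightarrow> indep2 (\<rho> x) (\<rho> y)"
  using rho_nz rho_point span_zero by (metis indep2_iff)

lemma indep2_nz: "indep2 x y \<Longrightarrow> x \<noteq> 0 \<and> y \<noteq> 0"
  by (metis indep2_iff span_zero)

lemma indep3_rho: "indep3 x y z \<Longrightarrow> indep3 (\<rho> x) (\<rho> y) (\<rho> z)"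
  using rho_line[of x y z] indep2_rho[of x y] indep2_nz[of x y] span_zero[of "{x,y}"]
  unfolding indep3_iff by blast

text \<open>The classical rescaling: the vector of \<open>a\<close> is pinned to
  \<open>\<rho> a\<close>, and among the multiples of \<open>\<rho> x\<close> the one is taken that
  makes \<open>\<rho> a + p\<close> represent the image of the point \<open>a + x\<close>.\<close>

definition normalized :: "'v \<Rightarrow> 'v \<Rightarrow> 'v \<Rightarrow> bool" where
  "normalized a x p \<longleftrightarrow> (\<exists>c. c \<noteq> 0 \<and> p = scale c (\<rho> x)) \<and>
    (\<exists>d. d \<noteq> 0 \<and> \<rho> (a + x) = scale d (\<rho> a + p))"

definition lift0 :: "'v \<Rightarrow> 'v \<Rightarrow> 'v" where
  "lift0 a x = (SOME p. normalized a x p)"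

text \<open>By collinearity \<open>\<rho> (a + x) = d \<rho> a + e \<rho> x\<close>. Neither
  coefficient vanishes, since \<open>a + x\<close> is a point different from both \<open>a\<close>
  and \<open>x\<close>, so \<open>(e / d) \<rho> x\<close> is the required representative.\<close>

lemma normalized_lift0:
  assumes "indep2 a x"
  shows "normalized a x (lift0 a x)"
proof -
  have nz: "a \<noteq> 0" "x \<noteq> 0" using assms indep2_nz by auto
  have a1: "a + x \<notin> span {a}" using assms
    by (metis indep2_iff insertI1 span_add_eq span_base)
  have a2: "a + x \<notin> span {x}" using assms
    by (metis indep2_iff indep2_commute insertI1 span_add_eq2 span_base)
  have ax: "a + x \<noteq> 0" using a1 span_zero by metis
  have "a + x \<in> span {a, x}" by (intro span_add span_base) auto
  then obtain d e where de: "\<rho> (a + x) = scale d (\<rho> a) + scale e (\<rho> x)"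
    using rho_line[OF nz ax] by (auto simp: span_two)
  have d: "d \<noteq> 0"
  proof
    assume "d = 0"
    then have "\<rho> (a + x) \<in> span {\<rho> x}" using de by (auto simp: span_one)
    then show False using a2 rho_point nz ax by blast
  qed
  have e: "e \<noteq> 0"
  proof
    assume "e = 0"
    then have "\<rho> (a + x) \<in> span {\<rho> a}" using de by (auto simp: span_one)
    then show False using a1 rho_point nz ax by blast
  qed
  have "normalized a x (scale (e / d) (\<rho> x))"
    unfolding normalized_def
  proof
    show "\<exists>c. c \<noteq> 0 \<and> scale (e / d) (\<rho> x) = scale c (\<rho> x)" using d e by (intro exI[of _ "e/d"]) simp
    show "\<exists>da. da \<noteq> 0 \<and> \<rho> (a + x) = scale da (\<rho> a + scale (e / d) (\<rho> x))"
      using d de by (intro exI[of _ d]) (simp add: scale_right_distrib)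
  qed
  then show ?thesis unfolding lift0_def by (rule someI)
qed

text \<open>The point \<open>a + x + y\<close> lies on three lines, joining \<open>a\<close> to
  \<open>x + y\<close>, \<open>a + x\<close> to \<open>y\<close>, and \<open>a + y\<close> to
  \<open>x\<close>. Expanding its representative along each of them and comparing coefficients
  forces the three normalizations to fit together.\<close>

lemma lift0_add:
  assumes i: "indep3 a x y"
  shows "lift0 a (x + y) = lift0 a x + lift0 a y"
proof -
  have i2: "indep2 a x" "indep2 a y" "indep2 x y" using indep3_indep2[OF i] by auto
  have nz: "a \<noteq> 0" "x \<noteq> 0" "y \<noteq> 0" using indep2_nz i2 by blast+
  have i3: "indep3 a x (x + y)" using indep3_add[OF i] by (simp add: span_base)
  then have ixy: "indep2 a (x + y)" using indep3_indep2 by blast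
  then have nxy: "x + y \<noteq> 0" using indep2_nz by blast
  have iax: "indep3 y x (a + x)"
    using i by (metis indep3_add add.commute indep3_swap12 indep3_swap23 insertI1 insert_commute span_base)
  have iay: "indep3 x y (a + y)"
    using i by (metis indep3_add add.commute indep3_swap12 indep3_swap23 insertI1 insert_commute span_base)
  have nax: "a + x \<noteq> 0" "a + y \<noteq> 0" using iax iay indep3_indep2 indep2_nz by blast+
  have "indep3 x y (x + (a + y))"
    by (rule indep3_add[OF iay]) (simp add: span_base)
  then have naxy: "a + x + y \<noteq> 0"
    using indep3_indep2 indep2_nz by (metis add.assoc add.commute)
  obtain cx dx where cx: "lift0 a x = scale cx (\<rho> x)" "\<rho> (a + x) = scale dx (\<rho> a + lift0 a x)"
    using normalized_lift0[OF i2(1)] unfolding normalized_def by blast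
  obtain cy dy where cy: "lift0 a y = scale cy (\<rho> y)" "\<rho> (a + y) = scale dy (\<rho> a + lift0 a y)"
    using normalized_lift0[OF i2(2)] unfolding normalized_def by blast
  obtain c d where c: "lift0 a (x + y) = scale c (\<rho> (x + y))" "d \<noteq> 0"
    "\<rho> (a + (x + y)) = scale d (\<rho> a + lift0 a (x + y))"
    using normalized_lift0[OF ixy] unfolding normalized_def by blast
  have "x + y \<in> span {x, y}" by (intro span_add span_base) auto
  then obtain u v where uv: "\<rho> (x + y) = scale u (\<rho> x) + scale v (\<rho> y)"
    using rho_line[OF nz(2,3) nxy] by (auto simp: span_two)
  have "a + x + y \<in> span {a + x, y}" by (intro span_add[of "a + x"] span_base) auto
  then obtain s1 t1 where s1: "\<rho> (a + x + y) = scale s1 (\<rho> (a + x)) + scale t1 (\<rho> y)"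
    using rho_line[OF nax(1) nz(3) naxy] by (auto simp: span_two)
  have "(a + y) + x \<in> span {a + y, x}" by (intro span_add[of "a + y"] span_base) auto
  then have "a + x + y \<in> span {a + y, x}" by (simp add: ac_simps)
  then obtain s2 t2 where s2: "\<rho> (a + x + y) = scale s2 (\<rho> (a + y)) + scale t2 (\<rho> x)"
    using rho_line[OF nax(2) nz(2) naxy] by (auto simp: span_two)
  note R = indep3_rho[OF i]
  \<comment> \<open>In all three expansions the coefficient of \<open>\<rho> a\<close> is the same
    nonzero \<open>d\<close>, which can therefore be cancelled from the other two
    coefficients.\<close>
  have e3: "\<rho> (a + x + y) = scale d (\<rho> a) + scale (d * c * u) (\<rho> x) + scale (d * c * v) (\<rho> y)"
    using c uv by (simp add: scale_right_distrib ac_simps)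
  have e1: "\<rho> (a + x + y) = scale (s1 * dx) (\<rho> a) + scale (s1 * dx * cx) (\<rho> x) + scale t1 (\<rho> y)"
    using s1 cx by (simp add: scale_right_distrib ac_simps)
  have e2: "\<rho> (a + x + y) = scale (s2 * dy) (\<rho> a) + scale t2 (\<rho> x) + scale (s2 * dy * cy) (\<rho> y)"
    using s2 cy by (simp add: scale_right_distrib ac_simps)
  have "d = s1 * dx \<and> d * c * u = s1 * dx * cx \<and> d * c * v = t1"
    by (rule indep3_eq[OF R]) (use e1 e3 in simp)
  moreover have "d = s2 * dy \<and> d * c * u = t2 \<and> d * c * v = s2 * dy * cy"
    by (rule indep3_eq[OF R]) (use e2 e3 in simp)
  ultimately have "d * (c * u) = d * cx" "d * (c * v) = d * cy" by (metis mult.assoc)+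
  then have "c * u = cx" "c * v = cy" using c(2) by simp_all
  then show ?thesis using c(1) uv cx(1) cy(1) by (simp add: scale_right_distrib)
qed

lemma ex_indep2: "x \<noteq> 0 \<Longrightarrow> \<exists>y. indep2 x y"
  using ex_off_line[of x x] by (auto simp: indep2_iff)

lemma ex_indep3: "indep2 x y \<Longrightarrow> \<exists>z. indep3 x y z"
  using ex_off_line[of x y] by (auto simp: indep3_iff)

text \<open>The normalization makes sense only off the line of \<open>a\<close>. On that line the
  value is a difference, chosen so that additivity with the auxiliary vector \<open>b\<close> holds
  by definition.\<close>

definition lift :: "'v \<Rightarrow> 'v \<Rightarrow> 'v \<Rightarrow> 'v" where
  "lift a b x = (if indep2 a x then lift0 a x else lift0 a (x + b) - lift0 a b)"

text \<open>The value on the line of \<open>a\<close> does not depend on the auxiliary vector. For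
  \<open>z\<close>, \<open>w\<close> independent together with \<open>a\<close>, computing
  \<open>lift0 a (x + z + w)\<close> in two ways gives the same difference for both.\<close>

lemma lift_on_line:
  assumes ab: "indep2 a b" and x: "x \<in> span {a}" and y: "indep2 a y"
  shows "lift0 a (x + y) = lift a b x + lift0 a y"
proof -
  have x2: "x \<in> span {a, z}" for z using x span_mono[of "{a}" "{a,z}"] by blast
  have lx: "lift a b x = lift0 a (x + b) - lift0 a b"
    using x by (simp add: lift_def indep2_iff)
  have *: "lift0 a (x + z) - lift0 a z = lift0 a (x + w) - lift0 a w" if i: "indep3 a z w" for z w
  proof -
    have i': "indep3 a w z" using i indep3_swap23 by blast
    have "lift0 a ((x + w) + z) = lift0 a (x + w) + lift0 a z"
      using lift0_add indep3_add[OF i x2] indep3_swap23 by blast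
    moreover have "lift0 a ((x + z) + w) = lift0 a (x + z) + lift0 a w"
      using lift0_add indep3_add[OF i' x2] indep3_swap23 by blast
    moreover have "x + w + z = x + z + w" by (simp add: ac_simps)
    ultimately show ?thesis by (simp add: algebra_simps)
  qed
  have "lift0 a (x + y) - lift0 a y = lift0 a (x + b) - lift0 a b"
  proof (cases "y \<in> span {a, b}")
    case False
    then show ?thesis using *[of b y] ab by (simp add: indep3_iff)
  next
    case True
    \<comment> \<open>If \<open>y\<close> lies in the plane of \<open>a\<close> and
      \<open>b\<close>, the comparison passes through a third vector outside this plane, which
      exists because no two vectors span \<open>V\<close>.\<close>
    obtain c where c: "indep3 a b c" using ex_indep3 ab by blast
    have "c \<notin> span {a, y}"
    proof
      assume "c \<in> span {a, y}"
      moreover have "span {a, y} \<subseteq> span {a, b}"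
        using True by (intro span_minimal) (auto intro: span_base)
      ultimately show False using c by (auto simp: indep3_iff)
    qed
    then have "indep3 a y c" using y by (simp add: indep3_iff)
    then show ?thesis using *[of y c] *[OF c] by simp
  qed
  then show ?thesis using lx by (metis diff_add_cancel)
qed

text \<open>Additivity is known for triples independent with \<open>a\<close> and for one summand on
  the line of \<open>a\<close>. The remaining positions are reduced to these by adding an auxiliary
  vector and cancelling it afterwards.\<close>

lemma lift_add:
  assumes ab: "indep2 a b"
  shows "lift a b (x + y) = lift a b x + lift a b y"
proof -
  have a0: "a \<noteq> 0" using ab by (simp add: indep2_iff)
  have in_iff: "indep2 a z \<longleftrightarrow> z \<notin> span {a}" for z using a0 by (simp add: indep2_iff)
  have off: "lift a b z = lift0 a z" if "z \<notin> span {a}" for z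
    using that by (simp add: lift_def in_iff)
  have mixed: "lift a b (x + y) = lift a b x + lift a b y" if "x \<in> span {a}" "y \<notin> span {a}" for x y
    using that lift_on_line[OF ab, of x y] span_add_eq[of x "{a}" y] by (simp add: off in_iff)
  show ?thesis
  proof (cases "x \<in> span {a}"; cases "y \<in> span {a}")
    assume x: "x \<in> span {a}" and y: "y \<in> span {a}"
    have b: "b \<notin> span {a}" using ab in_iff by blast
    have yb: "y + b \<notin> span {a}" using y b span_add_eq by blast
    have xy: "x + y \<in> span {a}" using x y span_add by blast
    \<comment> \<open>Both summands lie on the line of \<open>a\<close>; adding \<open>b\<close>
      leaves this line, so each equation has exactly one summand on it.\<close>
    have "lift a b (x + y) + lift a b b = lift a b (x + y + b)" using mixed[OF xy b] by simp
    also have "\<dots> = lift a b x + lift a b (y + b)" using mixed[OF x yb] by (simp add: add.assoc)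
    also have "\<dots> = lift a b x + lift a b y + lift a b b" using mixed[OF y b] by (simp add: add.assoc)
    finally show ?thesis by simp
  next
    assume "x \<in> span {a}" "y \<notin> span {a}" then show ?thesis by (rule mixed)
  next
    assume "x \<notin> span {a}" "y \<in> span {a}" then show ?thesis using mixed[of y x] by (simp add: add.commute)
  next
    assume x: "x \<notin> span {a}" and y: "y \<notin> span {a}"
    show ?thesis
    proof (cases "y \<in> span {a, x}")
      case False
      then have i: "indep3 a x y" using x by (simp add: indep3_iff in_iff)
      then have "indep3 a x (x + y)" using indep3_add[OF i] by (simp add: span_base)
      then have "x + y \<notin> span {a}" using indep3_indep2 in_iff by blast
      then show ?thesis using lift0_add[OF i] off x y by simp
    next
      case True
      \<comment> \<open>\<open>a\<close>, \<open>x\<close>, \<open>y\<close> are coplanar here;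
        \<open>c\<close> is taken outside their plane, so that \<open>lift0_add\<close> applies
        after adding it.\<close>
      obtain c where c: "indep3 a x c" using ex_indep3 x in_iff by blast
      then have c': "c \<notin> span {a}" using indep3_indep2 in_iff by blast
      have i1: "indep3 a x (y + c)" by (rule indep3_add[OF c True])
      then have yc: "y + c \<notin> span {a}" using indep3_indep2 in_iff by blast
      have "span {a, y} \<subseteq> span {a, x}"
        using True by (intro span_minimal) (auto intro: span_base)
      then have i2: "indep3 a y c" using c y by (auto simp: indep3_iff in_iff)
      have "x + y \<in> span {a, x}" by (rule span_add[OF _ True]) (simp add: span_base)
      then have i3: "indep3 a x ((x + y) + c)" using indep3_add[OF c] by blast
      then have xyc: "x + y + c \<notin> span {a}" using indep3_indep2 in_iff by blast
      have "lift a b (x + y + c) = lift a b x + lift a b (y + c)"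
        using lift0_add[OF i1] off x yc xyc by (simp add: add.assoc)
      also have "\<dots> = lift a b x + lift a b y + lift a b c"
        using lift0_add[OF i2] off y c' yc by (simp add: add.assoc)
      finally have e1: "lift a b (x + y + c) = lift a b x + lift a b y + lift a b c" .
      have "lift a b (x + y + c) = lift a b (x + y) + lift a b c"
      proof (cases "x + y \<in> span {a}")
        case True then show ?thesis using mixed c' by blast
      next
        case False
        have "span {a, x + y} \<subseteq> span {a, x}"
          using \<open>x + y \<in> span {a, x}\<close> by (intro span_minimal) (auto intro: span_base)
        then have "indep3 a (x + y) c" using c False by (auto simp: indep3_iff in_iff)
        then show ?thesis using lift0_add off False c' xyc by simp
      qed
      then show ?thesis using e1 by simp
    qed
  qed
qed

text \<open>Only the points of the line of \<open>a\<close> need work. There the value lies in the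
  plane of \<open>\<rho> a\<close> and \<open>\<rho> y\<close> for every admissible
  \<open>y\<close>; two such planes meet in the line of \<open>\<rho> a\<close>.\<close>

lemma lift_point:
  assumes ab: "indep2 a b" and x: "x \<noteq> 0"
  shows "\<exists>c. c \<noteq> 0 \<and> lift a b x = scale c (\<rho> x)"
proof (cases "indep2 a x")
  case True
  then show ?thesis using normalized_lift0[OF True] by (auto simp: lift_def normalized_def)
next
  case False
  have a0: "a \<noteq> 0" and b0: "b \<noteq> 0" using ab indep2_nz by blast+
  then have xa: "x \<in> span {a}" using False by (simp add: indep2_iff)
  have *: "\<exists>u v. lift a b x = scale u (\<rho> a) + scale v (\<rho> y)" if y: "indep2 a y" for y
  proof -
    have y0: "y \<noteq> 0" using y indep2_nz by blast
    have ixy: "indep2 a (x + y)" using indep2_add[OF y xa] .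
    have xy0: "x + y \<noteq> 0" using ixy indep2_nz by blast
    have "x + y \<in> span {a, y}" using xa span_mono[of "{a}" "{a,y}"]
      by (intro span_add) (auto intro: span_base)
    then have r: "\<rho> (x + y) \<in> span {\<rho> a, \<rho> y}" using rho_line[OF a0 y0 xy0] by blast
    obtain c where "lift0 a (x + y) = scale c (\<rho> (x + y))"
      using normalized_lift0[OF ixy] by (auto simp: normalized_def)
    moreover obtain d where "lift0 a y = scale d (\<rho> y)"
      using normalized_lift0[OF y] by (auto simp: normalized_def)
    moreover have "lift a b x = lift0 a (x + y) - lift0 a y"
      using lift_on_line[OF ab xa y] by simp
    moreover have "\<rho> y \<in> span {\<rho> a, \<rho> y}" by (auto intro: span_base)
    ultimately have "lift a b x \<in> span {\<rho> a, \<rho> y}"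
      using r by (simp add: span_diff span_scale)
    then show ?thesis by (simp add: span_two)
  qed
  obtain c where c: "indep3 a b c" using ex_indep3 ab by blast
  then have ac: "indep2 a c" using indep3_indep2 by blast
  obtain u v where uv: "lift a b x = scale u (\<rho> a) + scale v (\<rho> b)" using *[OF ab] by blast
  obtain u' v' where uv': "lift a b x = scale u' (\<rho> a) + scale v' (\<rho> c)" using *[OF ac] by blast
  have "scale u (\<rho> a) + scale v (\<rho> b) + scale 0 (\<rho> c) = scale u' (\<rho> a) + scale 0 (\<rho> b) + scale v' (\<rho> c)"
    using uv uv' by simp
  then have "v = 0" using indep3_eq[OF indep3_rho[OF c]] by blast
  then have la: "lift a b x = scale u (\<rho> a)" using uv by simp
  \<comment> \<open>If the value vanished, \<open>x + b\<close> and \<open>b\<close> would have the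
    same lift and hence be the same point, which puts \<open>x\<close> on the line of
    \<open>b\<close> as well as on that of \<open>a\<close>.\<close>
  have u: "u \<noteq> 0"
  proof
    assume "u = 0"
    then have e: "lift0 a (x + b) = lift0 a b" using la lift_on_line[OF ab xa ab] by simp
    have ixb: "indep2 a (x + b)" using indep2_add[OF ab xa] .
    have xb0: "x + b \<noteq> 0" using ixb indep2_nz by blast
    obtain c where cc: "c \<noteq> 0" "lift0 a (x + b) = scale c (\<rho> (x + b))"
      using normalized_lift0[OF ixb] by (auto simp: normalized_def)
    obtain d where "lift0 a b = scale d (\<rho> b)"
      using normalized_lift0[OF ab] by (auto simp: normalized_def)
    then have "scale c (\<rho> (x + b)) = scale d (\<rho> b)" using e cc by simp
    then have "scale (inverse c) (scale c (\<rho> (x + b))) = scale (inverse c) (scale d (\<rho> b))" by simp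
    then have "\<rho> (x + b) = scale (inverse c * d) (\<rho> b)" using cc by simp
    then have "\<rho> (x + b) \<in> span {\<rho> b}" unfolding span_one by blast
    then have "x + b \<in> span {b}" using rho_point[OF b0 xb0] by blast
    then have "x \<in> span {b}" by (metis insertI1 span_add_eq2 span_base)
    then have "x \<in> span {b}" "x \<in> span {a}" using xa by auto
    then obtain s t where "x = scale s b" "x = scale t a" unfolding span_one by blast
    then have "scale t a + scale 0 b = scale 0 a + scale s b" by simp
    then have "t = 0" using indep2_eq[OF ab] by blast
    then show False using \<open>x = scale t a\<close> x by simp
  qed
  have "\<rho> x \<in> span {\<rho> a}" using rho_point a0 x xa by blast
  then obtain s where s: "\<rho> x = scale s (\<rho> a)" by (auto simp: span_one)
  then have "s \<noteq> 0" using rho_nz[OF x] by auto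
  then have "lift a b x = scale (u / s) (\<rho> x)" unfolding la s by simp
  then show ?thesis using u \<open>s \<noteq> 0\<close> by (intro exI[of _ "u/s"]) simp
qed

text \<open>The lift is additive and induces the given map of points. The accompanying scalars give
  a field homomorphism; it is surjective because the map of points is.\<close>

theorem fundamental_theorem:
  "\<exists>\<phi>. collineation scale \<phi> \<and> (\<forall>x. x \<noteq> 0 \<longrightarrow> (\<exists>c. c \<noteq> 0 \<and> \<phi> x = scale c (\<rho> x)))"
proof -
  obtain a where a0: "a \<noteq> (0::'v)" using ex_off_line span_zero by metis
  obtain b where ab: "indep2 a b" using ex_indep2 a0 by blast
  define \<phi> where "\<phi> = lift a b"
  have add: "\<phi> (x + y) = \<phi> x + \<phi> y" for x y unfolding \<phi>_def by (rule lift_add[OF ab])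
  have pt: "\<exists>c. c \<noteq> 0 \<and> \<phi> x = scale c (\<rho> x)" if "x \<noteq> 0" for x
    unfolding \<phi>_def by (rule lift_point[OF ab that])
  have phi0: "\<phi> 0 = 0" using add[of 0 0] by simp
  have phinz: "\<phi> x \<noteq> 0" if "x \<noteq> 0" for x
    using pt[OF that] rho_nz[OF that] by auto
  have phidiff: "\<phi> (x - y) = \<phi> x - \<phi> y" for x y
    using add[of "x - y" y] by (simp add: algebra_simps)
  have inj: "inj \<phi>"
    by (rule injI) (metis phidiff phinz eq_iff_diff_eq_0)
  have ind: "indep2 (\<phi> x) (\<phi> y)" if xy: "indep2 x y" for x y
  proof -
    have nz: "x \<noteq> 0" "y \<noteq> 0" using indep2_nz xy by blast+
    obtain c d where c: "c \<noteq> 0" "\<phi> x = scale c (\<rho> x)" and d: "d \<noteq> 0" "\<phi> y = scale d (\<rho> y)"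
      using pt nz by blast
    show ?thesis
      unfolding indep2_def
    proof (intro allI impI)
      fix s t assume "scale s (\<phi> x) + scale t (\<phi> y) = 0"
      then have "scale (s * c) (\<rho> x) + scale (t * d) (\<rho> y) = 0" using c d by simp
      then have "s * c = 0 \<and> t * d = 0" using indep2_rho[OF xy] unfolding indep2_def by blast
      then show "s = 0 \<and> t = 0" using c d by simp
    qed
  qed
  have sc: "\<exists>t. \<phi> (scale c x) = scale t (\<phi> x)" for c x
  proof (cases "c = 0 \<or> x = 0")
    case True
    then have "\<phi> (scale c x) = scale 0 (\<phi> x)" using phi0 by auto
    then show ?thesis by blast
  next
    case False
    then have nz: "x \<noteq> 0" "scale c x \<noteq> 0" by auto
    have "scale c x \<in> span {x}" by (auto simp: span_one)
    then have "\<rho> (scale c x) \<in> span {\<rho> x}" using rho_point nz by blast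
    then obtain s where s: "\<rho> (scale c x) = scale s (\<rho> x)" unfolding span_one by blast
    obtain u where u: "u \<noteq> 0" "\<phi> x = scale u (\<rho> x)" using pt nz by blast
    obtain v where v: "\<phi> (scale c x) = scale v (\<rho> (scale c x))" using pt nz by blast
    have "scale (v * s / u) (\<phi> x) = scale (v * s / u * u) (\<rho> x)" unfolding u(2) by simp
    also have "\<dots> = \<phi> (scale c x)" unfolding v s using u(1) by simp
    finally have "\<phi> (scale c x) = scale (v * s / u) (\<phi> x)" by simp
    then show ?thesis by blast
  qed
  define \<tau> where "\<tau> c = (SOME t. \<phi> (scale c a) = scale t (\<phi> a))" for c
  have tau_a: "\<phi> (scale c a) = scale (\<tau> c) (\<phi> a)" for c
    unfolding \<tau>_def by (rule someI_ex) (rule sc)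
  \<comment> \<open>Applying \<open>\<phi>\<close> to \<open>scale c (x + y)\<close> and comparing
    coefficients shows that independent vectors carry the same scalar.\<close>
  have trans: "\<phi> (scale c y) = scale t (\<phi> y)"
    if xy: "indep2 x y" and t: "\<phi> (scale c x) = scale t (\<phi> x)" for x y c t
  proof -
    obtain s where s: "\<phi> (scale c y) = scale s (\<phi> y)" using sc by blast
    obtain u where u: "\<phi> (scale c (x + y)) = scale u (\<phi> (x + y))" using sc by blast
    have "scale u (\<phi> x) + scale u (\<phi> y) = scale t (\<phi> x) + scale s (\<phi> y)"
      using s t u by (simp add: add scale_right_distrib)
    then show ?thesis using s indep2_eq[OF ind[OF xy]] by metis
  qed
  have tau: "\<phi> (scale c x) = scale (\<tau> c) (\<phi> x)" for c x
  proof (cases "x = 0")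
    case True then show ?thesis using phi0 by simp
  next
    case x0: False
    show ?thesis
    proof (cases "indep2 a x")
      case True then show ?thesis using trans tau_a by blast
    next
      case False
      then have xa: "x \<in> span {a}" using a0 by (simp add: indep2_iff)
      have "b \<notin> span {x}"
      proof
        assume "b \<in> span {x}"
        moreover have "span {x} \<subseteq> span {a}" using xa by (intro span_minimal) auto
        ultimately show False using ab by (auto simp: indep2_iff)
      qed
      then have "indep2 b x" using x0 indep2_commute indep2_iff by blast
      \<comment> \<open>For \<open>x\<close> on the line of \<open>a\<close> the scalar is
        transported from \<open>a\<close> to \<open>b\<close> and from there to
        \<open>x\<close>.\<close>
      then show ?thesis using trans[OF ab tau_a] trans by blast
    qed
  qed
  have tau_eq: "s = t" if "scale s (\<phi> a) = scale t (\<phi> a)" for s t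
    using that phinz[OF a0] by simp
  have tadd: "\<tau> (c + d) = \<tau> c + \<tau> d" for c d
    by (rule tau_eq) (metis add scale_left_distrib tau)
  have tmult: "\<tau> (c * d) = \<tau> c * \<tau> d" for c d
    by (rule tau_eq) (metis scale_scale tau)
  have t1: "\<tau> 1 = 1"
    by (rule tau_eq) (metis scale_one tau)
  have t0: "\<tau> c \<noteq> 0" if "c \<noteq> 0" for c
    using tau[of c a] phinz[of "scale c a"] that a0 by auto
  have tdiff: "\<tau> (c - d) = \<tau> c - \<tau> d" for c d
    using tadd[of "c - d" d] by (simp add: algebra_simps)
  have tinj: "inj \<tau>"
    by (rule injI) (metis tdiff t0 eq_iff_diff_eq_0)
  \<comment> \<open>The point of \<open>w = \<phi> a + s \<phi> b\<close> is the image of some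
    \<open>z = \<alpha> a + \<beta> b\<close>, and comparing coefficients gives
    \<open>\<tau> (\<beta> / \<alpha>) = s\<close>.\<close>
  have tsurj: "\<exists>c. s = \<tau> c" for s
  proof -
    define w where "w = \<phi> a + scale s (\<phi> b)"
    have w0: "w \<noteq> 0"
    proof
      assume "w = 0"
      then have "scale 1 (\<phi> a) + scale s (\<phi> b) = 0" by (simp add: w_def)
      then show False using ind[OF ab] unfolding indep2_def by (metis one_neq_zero)
    qed
    have nz: "a \<noteq> 0" "b \<noteq> 0" using ab indep2_nz by blast+
    obtain z t where z: "z \<noteq> 0" "w = scale t (\<rho> z)"
      using rho_surj[OF w0] by (auto simp: span_one)
    obtain ca where ca: "\<phi> a = scale ca (\<rho> a)" using pt nz by blast
    obtain cb where cb: "\<phi> b = scale cb (\<rho> b)" using pt nz by blast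
    obtain cz where cz: "cz \<noteq> 0" "\<phi> z = scale cz (\<rho> z)" using pt z by blast
    have t0': "t \<noteq> 0" using z w0 by auto
    have "\<rho> z = scale (inverse t) w" using z t0' by simp
    also have "\<dots> \<in> span {\<rho> a, \<rho> b}"
      unfolding w_def ca cb by (intro span_scale span_add span_base) auto
    finally have "z \<in> span {a, b}" using rho_line[OF nz z(1)] by blast
    then obtain \<alpha> \<beta> where ab': "z = scale \<alpha> a + scale \<beta> b" by (auto simp: span_two)
    have "\<phi> z = scale (cz / t) w" using cz z t0' by simp
    then have "scale (\<tau> \<alpha>) (\<phi> a) + scale (\<tau> \<beta>) (\<phi> b) = scale (cz / t) (\<phi> a) + scale (cz / t * s) (\<phi> b)"
      unfolding ab' w_def by (simp add: add tau scale_right_distrib)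
    then have e: "\<tau> \<alpha> = cz / t" "\<tau> \<beta> = cz / t * s"
      using indep2_eq[OF ind[OF ab]] by blast+
    then have ta: "\<tau> \<alpha> \<noteq> 0" using cz t0' by simp
    have a0': "\<alpha> \<noteq> 0"
    proof
      assume "\<alpha> = 0"
      then have "\<tau> \<alpha> = 0" using tdiff[of 0 0] by simp
      then show False using ta by simp
    qed
    have "\<tau> (\<beta> / \<alpha>) * \<tau> \<alpha> = \<tau> \<beta>" using tmult[of "\<beta> / \<alpha>" \<alpha>] a0' by simp
    also have "\<dots> = s * \<tau> \<alpha>" using e by simp
    finally show ?thesis using ta by (metis mult_right_cancel)
  qed
  have "bij \<tau>" using tinj tsurj by (auto simp: bij_def surj_def)
  then have "field_automorphism \<tau>" using tadd tmult t1 by (simp add: field_automorphism_def)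
  then have semi: "semilinear scale scale \<phi>" using add tau by (auto simp: semilinear_def)
  have "\<exists>x. w = \<phi> x" for w
  proof (cases "w = 0")
    case True then show ?thesis using phi0[symmetric] by blast
  next
    case False
    obtain z t where z: "z \<noteq> 0" "w = scale t (\<rho> z)"
      using rho_surj[OF False] by (auto simp: span_one)
    obtain c where c: "c \<noteq> 0" "\<phi> z = scale c (\<rho> z)" using pt z by blast
    obtain s where s: "t / c = \<tau> s" using tsurj by blast
    have "\<phi> (scale s z) = scale (t / c) (scale c (\<rho> z))" by (simp only: tau s c)
    then have "w = \<phi> (scale s z)" using c(1) z(2) by simp
    then show ?thesis by blast
  qed
  then have "bij \<phi>" using inj by (auto simp: bij_def surj_def)
  then have "collineation scale \<phi>" using semi by (simp add: collineation_def)
  moreover have "\<forall>x. x \<noteq> 0 \<longrightarrow> (\<exists>c. c \<noteq> 0 \<and> \<phi> x = scale c (\<rho> x))" using pt by simp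
  ultimately show ?thesis by (intro exI[of _ \<phi>] conjI)
qed

end

section \<open>Incidence-preserving bijections\<close>

context finite_dimensional_vector_space
begin

section \<open>Subspaces under collineations\<close>

lemma collineation_zero: "collineation scale g \<Longrightarrow> g 0 = 0"
  unfolding collineation_def semilinear_def by (metis add_cancel_right_right)

lemma Gr_Suc_decompose:
  assumes "S \<in> Gr (Suc m)" "x \<in> S" "x \<noteq> 0"
  obtains T where "T \<in> Gr m" "x \<notin> T" "S = span (insert x T)"
proof -
  obtain T where T: "T \<in> Gr m" "T \<subseteq> S" "x \<notin> T"
    using Gr_hyperplane_avoiding[OF assms(1), of "{0}" x] assms
    by (auto simp: Gr_iff subspace_0)
  have "span (insert x T) \<subseteq> S"
    using T assms by (intro span_minimal) (auto simp: Gr_iff)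
  then have "S = span (insert x T)"
    using Gr_subset_eq[OF Gr_span_insert assms(1)] T by blast
  then show ?thesis using T that by blast
qed

lemma Gr_Suc_nonzero:
  assumes "S \<in> Gr (Suc m)"
  obtains x where "x \<in> S" "x \<noteq> 0"
proof -
  have "\<not> S \<subseteq> {0}"
    using assms dim_subset[of S "{0}"] by (auto simp: Gr_iff)
  then show ?thesis using that by blast
qed

text \<open>Built up one vector at a time: semilinearity changes the coefficient of the new vector
  to \<open>\<tau> c\<close>, which still runs through the whole field.\<close>

lemma collineation_Gr:
  assumes g: "collineation scale g"
  shows "S \<in> Gr m \<Longrightarrow> g ` S \<in> Gr m"
proof (induction m arbitrary: S)
  case 0
  then have "S = {0}" by (auto simp: Gr_iff subspace_0)
  then show ?case using collineation_zero[OF g] 0 by simp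
next
  case (Suc m)
  obtain \<tau> where \<tau>: "field_automorphism \<tau>" "\<forall>x y. g (x + y) = g x + g y"
    "\<forall>c x. g (scale c x) = scale (\<tau> c) (g x)" "bij g" using g unfolding collineation_def semilinear_def by blast
  have surj: "\<exists>c. d = \<tau> c" for d
    using \<tau>(1) by (auto simp: field_automorphism_def bij_def surj_def)
  obtain x where x: "x \<in> S" "x \<noteq> 0" using Gr_Suc_nonzero Suc.prems by blast
  obtain T where T: "T \<in> Gr m" "x \<notin> T" "S = span (insert x T)"
    using Gr_Suc_decompose[OF Suc.prems x] by blast
  have sT: "subspace T" using T by (simp add: Gr_iff)
  have gT: "g ` T \<in> Gr m" using Suc.IH T by blast
  then have sgT: "subspace (g ` T)" by (simp add: Gr_iff)
  have gx: "g x \<notin> g ` T" using T(2) \<tau>(4) by (simp add: bij_def inj_image_mem_iff)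
  have "y \<in> g ` S \<longleftrightarrow> y \<in> span (insert (g x) (g ` T))" for y
  proof -
    have "y \<in> g ` S \<longleftrightarrow> (\<exists>c. \<exists>t\<in>T. y = g (t + scale c x))"
      unfolding T(3) image_iff Bex_def mem_span_insert_subspace[OF sT] by blast
    also have "\<dots> \<longleftrightarrow> (\<exists>c. \<exists>t\<in>T. y = g t + scale (\<tau> c) (g x))" using \<tau> by simp
    also have "\<dots> \<longleftrightarrow> (\<exists>c. \<exists>t\<in>T. y = g t + scale c (g x))" by (metis surj)
    also have "\<dots> \<longleftrightarrow> y \<in> span (insert (g x) (g ` T))"
      unfolding mem_span_insert_subspace[OF sgT] by blast
    finally show ?thesis .
  qed
  then have "g ` S = span (insert (g x) (g ` T))" by blast
  then show ?case using Gr_span_insert[OF gT gx] by simp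
qed

lemma Gr_one_span: "x \<noteq> 0 \<Longrightarrow> span {x} \<in> Gr 1"
  by (simp add: Gr_iff)

lemma Gr_one_eq_span:
  assumes "P \<in> Gr 1" "x \<in> P" "x \<noteq> 0"
  shows "P = span {x}"
proof -
  have "span {x} \<subseteq> P" using assms by (intro span_minimal) (auto simp: Gr_iff)
  then show ?thesis using Gr_subset_eq[OF Gr_one_span assms(1)] assms(3) by blast
qed

lemma Gr_one_obtain:
  assumes "P \<in> Gr 1"
  obtains x where "x \<noteq> 0" "P = span {x}"
  using Gr_Suc_nonzero[of P 0] Gr_one_eq_span assms by (metis One_nat_def)

lemma Gr_between_point:
  assumes "L \<in> Gr (Suc j)" "1 \<le> j" "x \<in> L"
  obtains S where "S \<in> Gr j" "x \<in> S" "S \<subseteq> L"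
proof -
  have "dim (span {x}) \<le> 1" by simp
  then have "\<not> L \<subseteq> span {x}" using dim_subset[of L "span {x}"] assms by (auto simp: Gr_iff)
  then obtain y where y: "y \<in> L" "y \<notin> span {x}" by blast
  have "span {x} \<subseteq> L" using assms by (intro span_minimal) (auto simp: Gr_iff)
  then obtain S where "S \<in> Gr j" "span {x} \<subseteq> S" "S \<subseteq> L"
    using Gr_hyperplane_avoiding[OF assms(1) _ subspace_span y] by blast
  then show ?thesis using that by (auto intro: span_base)
qed

section \<open>Adjacency and cliques in the Grassmann graph\<close>

text \<open>The dimension part of \<open>adjacent_subspaces\<close>; the subspace property is
  supplied separately by membership in \<open>Gr\<close>.\<close>

definition adj :: "'b set \<Rightarrow> 'b set \<Rightarrow> bool" where
  "adj S T \<longleftrightarrow> dim S = dim T \<and> Suc (dim (S \<inter> T)) = dim S"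

lemma adj_neq: "adj S T \<Longrightarrow> S \<noteq> T"
  by (auto simp: adj_def)

lemma adj_meet:
  assumes "S \<in> Gr (Suc m)" "T \<in> Gr (Suc m)" "adj S T"
  shows "S \<inter> T \<in> Gr m"
  using assms by (auto simp: Gr_iff adj_def subspace_inter)

lemma adj_join:
  assumes "S \<in> Gr m" "T \<in> Gr m" "adj S T"
  shows "span (S \<union> T) \<in> Gr (Suc m)"
  using assms dim_Un_Int[of S T] by (auto simp: Gr_iff adj_def)

lemma dim_inter_less:
  assumes "S \<in> Gr m" "T \<in> Gr m" "S \<noteq> T"
  shows "dim (S \<inter> T) < m"
proof (rule ccontr)
  assume "\<not> ?thesis"
  moreover have "dim (S \<inter> T) \<le> m" using dim_subset[of "S \<inter> T" S] assms by (simp add: Gr_iff)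
  ultimately have "S \<inter> T \<in> Gr m" using assms by (auto simp: Gr_iff subspace_inter)
  then have "S \<inter> T = S" "S \<inter> T = T" using Gr_subset_eq assms by (metis Int_lower1, metis Int_lower2)
  then show False using assms by blast
qed

lemma adjI_meet:
  assumes "S \<in> Gr (Suc m)" "T \<in> Gr (Suc m)" "S \<noteq> T" "M \<in> Gr m" "M \<subseteq> S" "M \<subseteq> T"
  shows "adj S T"
proof -
  have "m \<le> dim (S \<inter> T)" using assms dim_subset[of M "S \<inter> T"] by (simp add: Gr_iff)
  then show ?thesis using dim_inter_less[OF assms(1-3)] assms by (auto simp: Gr_iff adj_def)
qed

lemma adjI_join:
  assumes "S \<in> Gr m" "T \<in> Gr m" "S \<noteq> T" "L \<in> Gr (Suc m)" "S \<subseteq> L" "T \<subseteq> L"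
  shows "adj S T"
proof -
  have "dim (S \<union> T) \<le> Suc m" using assms dim_subset[of "S \<union> T" L] by (simp add: Gr_iff)
  moreover have "dim (S \<union> T) + dim (S \<inter> T) = m + m"
    using dim_Un_Int[of S T] assms by (simp add: Gr_iff)
  ultimately show ?thesis
    using dim_inter_less[OF assms(1-3)] assms by (auto simp: Gr_iff adj_def)
qed

lemma hyperplanes_span:
  assumes "L \<in> Gr (Suc m)" "S \<in> Gr m" "T \<in> Gr m" "S \<noteq> T" "S \<subseteq> L" "T \<subseteq> L"
    "subspace R" "S \<subseteq> R" "T \<subseteq> R"
  shows "L \<subseteq> R"
proof -
  have "span (S \<union> T) \<in> Gr (Suc m)"
    using adj_join[OF assms(2,3) adjI_join[OF assms(2-4,1,5,6)]] .
  moreover have "span (S \<union> T) \<subseteq> L" using assms by (intro span_minimal) (auto simp: Gr_iff)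
  ultimately have "span (S \<union> T) = L" using Gr_subset_eq assms by blast
  moreover have "span (S \<union> T) \<subseteq> R" using assms by (intro span_minimal) auto
  ultimately show ?thesis by blast
qed

text \<open>If all members contain \<open>S1 \<inter> S2\<close>, the clique lies in a star.
  Otherwise a member \<open>S3\<close> missing this meet forces every other member into the join of
  \<open>S1\<close> and \<open>S2\<close>.\<close>

lemma clique_star_or_top:
  assumes C: "C \<subseteq> Gr (Suc m)" and clique: "\<And>S T. S \<in> C \<Longrightarrow> T \<in> C \<Longrightarrow> S \<noteq> T \<Longrightarrow> adj S T"
    and S12: "S1 \<in> C" "S2 \<in> C" "S1 \<noteq> S2"
  shows "(\<exists>M\<in>Gr m. \<forall>S\<in>C. M \<subseteq> S) \<or> (\<exists>L\<in>Gr (Suc (Suc m)). \<forall>S\<in>C. S \<subseteq> L)"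
proof -
  \<comment> \<open>A third member not containing \<open>A \<inter> B\<close> meets \<open>A\<close>
    and \<open>B\<close> in two different hyperplanes of itself, and these span it.\<close>
  have two: "A \<inter> B \<subseteq> S \<or> S \<subseteq> span (A \<union> B)" if A: "A \<in> C" "B \<in> C" "A \<noteq> B" and S: "S \<in> C" for A B S
  proof (cases "A \<inter> B \<subseteq> S")
    case False
    then have "S \<noteq> A" "S \<noteq> B" by auto
    then have SA: "S \<inter> A \<in> Gr m" and SB: "S \<inter> B \<in> Gr m" and AB: "A \<inter> B \<in> Gr m"
      using adj_meet clique C A S by (meson subsetD)+
    have ne: "S \<inter> A \<noteq> S \<inter> B"
    proof
      assume "S \<inter> A = S \<inter> B"
      then have "S \<inter> A \<subseteq> A \<inter> B" by blast
      then have "S \<inter> A = A \<inter> B" using Gr_subset_eq SA AB by blast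
      then show False using False by blast
    qed
    have "S \<subseteq> span (A \<union> B)"
      by (rule hyperplanes_span[OF _ SA SB ne])
        (use C S in \<open>auto intro: span_base\<close>)
    then show ?thesis by blast
  qed simp
  show ?thesis
  proof (cases "\<forall>S\<in>C. S1 \<inter> S2 \<subseteq> S")
    case True
    then show ?thesis using adj_meet clique S12 C by (meson subsetD)
  next
    case False
    then obtain S3 where S3: "S3 \<in> C" "\<not> S1 \<inter> S2 \<subseteq> S3" by blast
    then have ne: "S3 \<noteq> S1" "S3 \<noteq> S2" by auto
    define L where "L = span (S1 \<union> S2)"
    have L: "L \<in> Gr (Suc (Suc m))"
      unfolding L_def using adj_join clique S12 C by (meson subsetD)
    then have sL: "subspace L" by (simp add: Gr_iff)
    have S1L: "S1 \<subseteq> L" "S2 \<subseteq> L" by (auto simp: L_def intro: span_base)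
    have S3L: "S3 \<subseteq> L" using two[OF S12 S3(1)] S3 by (auto simp: L_def)
    \<comment> \<open>A member outside \<open>L\<close> would contain both
      \<open>S1 \<inter> S3\<close> and \<open>S1 \<inter> S2\<close>, two different hyperplanes of
      \<open>S1\<close>, and hence \<open>S1\<close> itself.\<close>
    have "S \<subseteq> L" if S: "S \<in> C" for S
    proof (rule ccontr)
      assume n: "\<not> S \<subseteq> L"
      have "span (S1 \<union> S3) \<subseteq> L" using S1L S3L sL by (intro span_minimal) auto
      then have 1: "S1 \<inter> S3 \<subseteq> S" using two[of S1 S3 S] S S3 S12 n ne by blast
      have 3: "S1 \<inter> S2 \<subseteq> S" using two[OF S12 S] n by (auto simp: L_def)
      have a: "S1 \<inter> S3 \<in> Gr m" "S1 \<inter> S2 \<in> Gr m"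
        using adj_meet clique C S12 S3 ne by (metis subsetD)+
      have "S1 \<inter> S3 \<noteq> S1 \<inter> S2" using S3 by blast
      moreover have "S1 \<in> Gr (Suc m)" "subspace S" using C S12 S by (auto simp: Gr_iff)
      ultimately have "S1 \<subseteq> S"
        using hyperplanes_span[OF _ a _ Int_lower1 Int_lower1 _ 1 3] by blast
      then have "S1 = S" using Gr_subset_eq C S12 S by blast
      then show False using n S1L by simp
    qed
    then show ?thesis using L by blast
  qed
qed

section \<open>Incidence automorphisms and their descent to points\<close>

text \<open>Two consecutive dimensions are kept together so that the map on the lower one can become
  the map on the upper one when the dimension is decreased.\<close>

definition incidence_auto :: "nat \<Rightarrow> ('b set \<Rightarrow> 'b set) \<Rightarrow> ('b set \<Rightarrow> 'b set) \<Rightarrow> bool" where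
  "incidence_auto j a b \<longleftrightarrow> bij_betw a (Gr j) (Gr j) \<and> bij_betw b (Gr (Suc j)) (Gr (Suc j)) \<and>
    (\<forall>S\<in>Gr j. \<forall>L\<in>Gr (Suc j). S \<subseteq> L \<longleftrightarrow> a S \<subseteq> b L)"

lemma incidence_auto_inv:
  assumes "incidence_auto j a b"
  shows "incidence_auto j (inv_into (Gr j) a) (inv_into (Gr (Suc j)) b)"
proof -
  have ab: "bij_betw a (Gr j) (Gr j)" "bij_betw b (Gr (Suc j)) (Gr (Suc j))"
    using assms by (auto simp: incidence_auto_def)
  have "S \<subseteq> L \<longleftrightarrow> inv_into (Gr j) a S \<subseteq> inv_into (Gr (Suc j)) b L"
    if "S \<in> Gr j" "L \<in> Gr (Suc j)" for S L
    using assms that bij_betw_inv_into_right[OF ab(1)] bij_betw_inv_into_right[OF ab(2)]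
      bij_betw_apply[OF bij_betw_inv_into[OF ab(1)]] bij_betw_apply[OF bij_betw_inv_into[OF ab(2)]]
    unfolding incidence_auto_def by metis
  then show ?thesis using ab by (auto simp: incidence_auto_def bij_betw_inv_into)
qed

lemma incidence_auto_adj:
  assumes i: "incidence_auto j a b" and S: "S \<in> Gr j" "T \<in> Gr j" "adj S T"
  shows "adj (a S) (a T)"
proof -
  have a: "bij_betw a (Gr j) (Gr j)" and b: "bij_betw b (Gr (Suc j)) (Gr (Suc j))"
    and inc: "\<And>S L. S \<in> Gr j \<Longrightarrow> L \<in> Gr (Suc j) \<Longrightarrow> S \<subseteq> L \<longleftrightarrow> a S \<subseteq> b L"
    using i by (auto simp: incidence_auto_def)
  have L: "span (S \<union> T) \<in> Gr (Suc j)" using adj_join S by blast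
  have "S \<subseteq> span (S \<union> T)" "T \<subseteq> span (S \<union> T)" by (auto intro: span_base)
  then have "a S \<subseteq> b (span (S \<union> T))" "a T \<subseteq> b (span (S \<union> T))" using inc S L by blast+
  moreover have "a S \<noteq> a T" using a S adj_neq[OF S(3)] by (auto simp: bij_betw_def inj_on_def)
  moreover have "a S \<in> Gr j" "a T \<in> Gr j" "b (span (S \<union> T)) \<in> Gr (Suc j)"
    using a b S L by (auto dest: bij_betw_apply)
  ultimately show ?thesis using adjI_join by blast
qed

text \<open>\<open>N\<close> is the intersection of the spaces one dimension above it; the bound on
  \<open>i\<close> leaves room for such a space to avoid a given vector.\<close>

lemma Gr_star_determines:
  assumes "N \<in> Gr i" "N' \<in> Gr i" "Suc i < dimension"
    "\<And>M. M \<in> Gr (Suc i) \<Longrightarrow> N \<subseteq> M \<Longrightarrow> N' \<subseteq> M"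
  shows "N' = N"
proof -
  have "N' \<subseteq> N"
  proof
    fix x assume x: "x \<in> N'"
    show "x \<in> N"
    proof (rule ccontr)
      assume "x \<notin> N"
      then obtain M where "M \<in> Gr (Suc i)" "N \<subseteq> M" "x \<notin> M"
        by (rule Gr_superspace_avoiding[OF assms(1) _ assms(3)])
      then show False using assms(4) x by blast
    qed
  qed
  then show ?thesis using Gr_subset_eq assms by blast
qed

lemma Gr_top_determines:
  assumes "L \<in> Gr (Suc j)" "L' \<in> Gr (Suc j)" "1 \<le> j"
    "\<And>M. M \<in> Gr j \<Longrightarrow> M \<subseteq> L \<Longrightarrow> M \<subseteq> L'"
  shows "L' = L"
proof -
  have "L \<subseteq> L'" using Gr_between_point[OF assms(1,3)] assms(4) by (metis subsetD subsetI)
  then show ?thesis using Gr_subset_eq assms by blast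
qed

text \<open>The spaces above \<open>N\<close> form a clique, so their images lie in a star or in a
  top. A top is excluded because inclusion is also reflected.\<close>

lemma incidence_auto_star:
  assumes i: "incidence_auto (Suc i) a b" and n: "Suc (Suc i) < dimension" and N: "N \<in> Gr i"
  shows "\<exists>N'\<in>Gr i. \<forall>M\<in>Gr (Suc i). N \<subseteq> M \<longrightarrow> N' \<subseteq> a M"
proof -
  have a: "bij_betw a (Gr (Suc i)) (Gr (Suc i))"
    and b: "bij_betw b (Gr (Suc (Suc i))) (Gr (Suc (Suc i)))"
    and inc: "\<And>S L. S \<in> Gr (Suc i) \<Longrightarrow> L \<in> Gr (Suc (Suc i)) \<Longrightarrow> S \<subseteq> L \<longleftrightarrow> a S \<subseteq> b L"
    using i by (auto simp: incidence_auto_def)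
  define C where "C = a ` {M\<in>Gr (Suc i). N \<subseteq> M}"
  have C: "C \<subseteq> Gr (Suc i)" using a by (auto simp: C_def dest: bij_betw_apply)
  have cl: "adj S T" if ST: "S \<in> C" "T \<in> C" "S \<noteq> T" for S T
  proof -
    obtain M M' where M: "M \<in> Gr (Suc i)" "N \<subseteq> M" "M' \<in> Gr (Suc i)" "N \<subseteq> M'" "S = a M" "T = a M'"
      using ST unfolding C_def by blast
    then have "adj M M'" using adjI_meet[OF M(1,3) _ N M(2,4)] that by blast
    then show ?thesis using incidence_auto_adj[OF i] M by blast
  qed
  obtain x where x: "x \<notin> N" using Gr_not_UNIV[OF N] n by auto
  have M1: "span (insert x N) \<in> Gr (Suc i)" "N \<subseteq> span (insert x N)"
    using Gr_span_insert[OF N x] by (auto intro: span_base)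
  obtain y where y: "y \<notin> span (insert x N)" using Gr_not_UNIV[OF M1(1)] n by auto
  then have yN: "y \<notin> N" using M1 by blast
  have M2: "span (insert y N) \<in> Gr (Suc i)" "N \<subseteq> span (insert y N)"
    using Gr_span_insert[OF N yN] by (auto intro: span_base)
  have ne: "span (insert x N) \<noteq> span (insert y N)" using y by (metis insertI1 span_base)
  have "a (span (insert x N)) \<noteq> a (span (insert y N))"
    using a ne M1 M2 by (auto simp: bij_betw_def inj_on_def)
  moreover have "a (span (insert x N)) \<in> C" "a (span (insert y N)) \<in> C"
    using M1 M2 by (auto simp: C_def)
  ultimately have "(\<exists>M\<in>Gr i. \<forall>S\<in>C. M \<subseteq> S) \<or> (\<exists>L\<in>Gr (Suc (Suc i)). \<forall>S\<in>C. S \<subseteq> L)"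
    using clique_star_or_top[OF C cl] by blast
  \<comment> \<open>A top containing the images has the form \<open>b L\<close>, so every space
    above \<open>N\<close> would lie in \<open>L\<close>; but \<open>N\<close> together with a
    vector outside \<open>L\<close> does not.\<close>
  moreover have "\<not> (\<forall>S\<in>C. S \<subseteq> L')" if L': "L' \<in> Gr (Suc (Suc i))" for L'
  proof
    assume h: "\<forall>S\<in>C. S \<subseteq> L'"
    obtain L where L: "L \<in> Gr (Suc (Suc i))" "L' = b L"
      using b L' by (auto simp: bij_betw_def)
    have sub: "M \<subseteq> L" if "M \<in> Gr (Suc i)" "N \<subseteq> M" for M
      using h that inc[OF that(1) L(1)] L by (auto simp: C_def)
    obtain z where z: "z \<notin> L" using Gr_not_UNIV[OF L(1) n] by blast
    then have "z \<notin> N" using sub M1 by blast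
    then have "span (insert z N) \<subseteq> L" using sub[OF Gr_span_insert[OF N]] by (auto intro: span_base)
    then show False using z by (auto intro: span_base)
  qed
  ultimately obtain N' where "N' \<in> Gr i" "\<forall>S\<in>C. N' \<subseteq> S" by blast
  then show ?thesis by (auto simp: C_def)
qed

text \<open>Stars give a map of their centres, for the automorphism as well as for its inverse. The
  two maps are inverse to each other because a space is determined by its star.\<close>

lemma incidence_auto_descend:
  assumes i: "incidence_auto (Suc i) a b" and n: "Suc (Suc i) < dimension"
  shows "\<exists>c. incidence_auto i c a"
proof -
  let ?a' = "inv_into (Gr (Suc i)) a"
  have a: "bij_betw a (Gr (Suc i)) (Gr (Suc i))" using i by (auto simp: incidence_auto_def)
  note a' = bij_betw_inv_into[OF a]
  obtain c where c: "\<And>N. N \<in> Gr i \<Longrightarrow> c N \<in> Gr i"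
    "\<And>N M. N \<in> Gr i \<Longrightarrow> M \<in> Gr (Suc i) \<Longrightarrow> N \<subseteq> M \<Longrightarrow> c N \<subseteq> a M"
    using incidence_auto_star[OF i n] by metis
  obtain d where d: "\<And>N. N \<in> Gr i \<Longrightarrow> d N \<in> Gr i"
    "\<And>N M. N \<in> Gr i \<Longrightarrow> M \<in> Gr (Suc i) \<Longrightarrow> N \<subseteq> M \<Longrightarrow> d N \<subseteq> ?a' M"
    using incidence_auto_star[OF incidence_auto_inv[OF i] n] by metis
  have aM: "a M \<in> Gr (Suc i)" "?a' M \<in> Gr (Suc i)" "?a' (a M) = M" "a (?a' M) = M"
    if "M \<in> Gr (Suc i)" for M
    using that a a' by (auto dest: bij_betw_apply simp: bij_betw_inv_into_left bij_betw_inv_into_right)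
  have dc: "d (c N) = N" if N: "N \<in> Gr i" for N
  proof (rule Gr_star_determines[OF N d(1)[OF c(1)[OF N]]])
    show "Suc i < dimension" using n by simp
    fix M assume M: "M \<in> Gr (Suc i)" "N \<subseteq> M"
    show "d (c N) \<subseteq> M"
      using d(2)[OF c(1)[OF N] aM(1)[OF M(1)] c(2)[OF N M]] aM(3)[OF M(1)] by simp
  qed
  have cd: "c (d N) = N" if N: "N \<in> Gr i" for N
  proof (rule Gr_star_determines[OF N c(1)[OF d(1)[OF N]]])
    show "Suc i < dimension" using n by simp
    fix M assume M: "M \<in> Gr (Suc i)" "N \<subseteq> M"
    show "c (d N) \<subseteq> M"
      using c(2)[OF d(1)[OF N] aM(2)[OF M(1)] d(2)[OF N M]] aM(4)[OF M(1)] by simp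
  qed
  have "bij_betw c (Gr i) (Gr i)"
    by (rule bij_betw_byWitness[where f' = d]) (use c d dc cd in auto)
  moreover have "N \<subseteq> M \<longleftrightarrow> c N \<subseteq> a M" if "N \<in> Gr i" "M \<in> Gr (Suc i)" for N M
    using c d dc aM that by metis
  ultimately have "incidence_auto i c a" using a by (simp add: incidence_auto_def)
  then show ?thesis by blast
qed

text \<open>The dual of the descent: a space is determined by its hyperplanes, so the maps on tops
  obtained from \<open>g\<close> and from its inverse are inverse to each other.\<close>

lemma incidence_auto_from_tops:
  assumes g: "bij_betw g (Gr j) (Gr j)" and j: "1 \<le> j"
    and t: "\<And>L. L \<in> Gr (Suc j) \<Longrightarrow> \<exists>L'\<in>Gr (Suc j). \<forall>S\<in>Gr j. S \<subseteq> L \<longrightarrow> g S \<subseteq> L'"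
    and t': "\<And>L. L \<in> Gr (Suc j) \<Longrightarrow> \<exists>L'\<in>Gr (Suc j). \<forall>S\<in>Gr j. S \<subseteq> L \<longrightarrow> inv_into (Gr j) g S \<subseteq> L'"
  shows "\<exists>b. incidence_auto j g b"
proof -
  let ?g' = "inv_into (Gr j) g"
  note g' = bij_betw_inv_into[OF g]
  obtain c where c: "\<And>L. L \<in> Gr (Suc j) \<Longrightarrow> c L \<in> Gr (Suc j)"
    "\<And>S L. L \<in> Gr (Suc j) \<Longrightarrow> S \<in> Gr j \<Longrightarrow> S \<subseteq> L \<Longrightarrow> g S \<subseteq> c L"
    using t by metis
  obtain d where d: "\<And>L. L \<in> Gr (Suc j) \<Longrightarrow> d L \<in> Gr (Suc j)"
    "\<And>S L. L \<in> Gr (Suc j) \<Longrightarrow> S \<in> Gr j \<Longrightarrow> S \<subseteq> L \<Longrightarrow> ?g' S \<subseteq> d L"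
    using t' by metis
  have gS: "g S \<in> Gr j" "?g' S \<in> Gr j" "?g' (g S) = S" "g (?g' S) = S"
    if "S \<in> Gr j" for S
    using that g g' by (auto dest: bij_betw_apply simp: bij_betw_inv_into_left bij_betw_inv_into_right)
  have dc: "d (c L) = L" if L: "L \<in> Gr (Suc j)" for L
  proof (rule Gr_top_determines[OF L d(1)[OF c(1)[OF L]] j])
    fix M assume M: "M \<in> Gr j" "M \<subseteq> L"
    show "M \<subseteq> d (c L)"
      using d(2)[OF c(1)[OF L] gS(1)[OF M(1)] c(2)[OF L M]] gS(3)[OF M(1)] by simp
  qed
  have cd: "c (d L) = L" if L: "L \<in> Gr (Suc j)" for L
  proof (rule Gr_top_determines[OF L c(1)[OF d(1)[OF L]] j])
    fix M assume M: "M \<in> Gr j" "M \<subseteq> L"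
    show "M \<subseteq> c (d L)"
      using c(2)[OF d(1)[OF L] gS(2)[OF M(1)] d(2)[OF L M]] gS(4)[OF M(1)] by simp
  qed
  have "bij_betw c (Gr (Suc j)) (Gr (Suc j))"
    by (rule bij_betw_byWitness[where f' = d]) (use c d dc cd in auto)
  moreover have "S \<subseteq> L \<longleftrightarrow> g S \<subseteq> c L" if "S \<in> Gr j" "L \<in> Gr (Suc j)" for S L
    using c d dc gS that by metis
  ultimately have "incidence_auto j g c" using g by (simp add: incidence_auto_def)
  then show ?thesis by blast
qed

text \<open>Choosing a spanning vector for the image of each point produces the data of
  \<open>point_collineation\<close>.\<close>

lemma point_bijection_collineation:
  assumes n: "3 \<le> dimension" and a: "bij_betw a (Gr 1) (Gr 1)"
    and line: "\<And>P Q R. P \<in> Gr 1 \<Longrightarrow> Q \<in> Gr 1 \<Longrightarrow> R \<in> Gr 1 \<Longrightarrow>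
      R \<subseteq> span (P \<union> Q) \<longleftrightarrow> a R \<subseteq> span (a P \<union> a Q)"
  shows "\<exists>l. collineation scale l \<and> (\<forall>P\<in>Gr 1. a P = l ` P)"
proof -
  define \<rho> where "\<rho> x = (SOME w. w \<noteq> 0 \<and> a (span {x}) = span {w})" for x
  have rho: "\<rho> x \<noteq> 0 \<and> a (span {x}) = span {\<rho> x}" if "x \<noteq> 0" for x
  proof -
    have "a (span {x}) \<in> Gr 1" using a Gr_one_span[OF that] by (auto dest: bij_betw_apply)
    then have "\<exists>w. w \<noteq> 0 \<and> a (span {x}) = span {w}" by (metis Gr_one_obtain)
    then show ?thesis unfolding \<rho>_def by (rule someI_ex)
  qed
  have sp: "span {z} \<subseteq> span (span {x} \<union> span {y}) \<longleftrightarrow> z \<in> span {x, y}" for x y z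
  proof -
    have "span (span {x} \<union> span {y}) = span {x, y}"
    proof
      have "span {x} \<subseteq> span {x, y}" "span {y} \<subseteq> span {x, y}" by (rule span_mono, simp)+
      then show "span (span {x} \<union> span {y}) \<subseteq> span {x, y}" by (intro span_minimal) auto
      show "span {x, y} \<subseteq> span (span {x} \<union> span {y})"
        by (rule span_mono) (auto intro: span_base)
    qed
    moreover have "span {z} \<subseteq> W \<longleftrightarrow> z \<in> W" if "subspace W" for W
      using that by (meson insert_subset span_minimal span_superset empty_subsetI subset_trans)
    ultimately show ?thesis by simp
  qed
  interpret R: point_collineation scale Basis \<rho>
  proof
    fix x y :: 'b
    have "dim (span {x, y}) \<le> card {x, y}" by (metis dim_span dim_le_card finite.emptyI finite.insertI span_superset)
    also have "\<dots> \<le> 2" by (simp add: card_insert_if)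
    finally have "dim (span {x, y}) \<le> 2" .
    then have "span {x, y} \<noteq> UNIV" using n dim_UNIV_dimension by (metis not_less_eq_eq numeral_2_eq_2 numeral_3_eq_3 order_trans)
    then show "\<exists>z. z \<notin> span {x, y}" by blast
  next
    fix x :: 'b assume "x \<noteq> 0" then show "\<rho> x \<noteq> 0" using rho by blast
  next
    fix x y z :: 'b assume nz: "x \<noteq> 0" "y \<noteq> 0" "z \<noteq> 0"
    have "span {z} \<subseteq> span (span {x} \<union> span {y}) \<longleftrightarrow>
        a (span {z}) \<subseteq> span (a (span {x}) \<union> a (span {y}))"
      using line nz Gr_one_span by blast
    then show "z \<in> span {x, y} \<longleftrightarrow> \<rho> z \<in> span {\<rho> x, \<rho> y}"
      using rho nz by (simp add: sp)
  next
    fix w :: 'b assume w: "w \<noteq> 0"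
    then obtain P where P: "P \<in> Gr 1" "a P = span {w}"
      using a Gr_one_span by (metis bij_betw_iff_bijections)
    then obtain x where "x \<noteq> 0" "P = span {x}" by (metis Gr_one_obtain)
    then show "\<exists>x. x \<noteq> 0 \<and> w \<in> span {\<rho> x}" using rho P by (metis insertI1 span_base)
  qed
  obtain l where l: "collineation scale l" "\<And>x. x \<noteq> 0 \<Longrightarrow> \<exists>c. c \<noteq> 0 \<and> l x = scale c (\<rho> x)"
    using R.fundamental_theorem by blast
  have "a P = l ` P" if P: "P \<in> Gr 1" for P
  proof -
    obtain x where x: "x \<noteq> 0" "P = span {x}" using Gr_one_obtain[OF P] by blast
    obtain c where c: "c \<noteq> 0" "l x = scale c (\<rho> x)" using l x by blast
    have lx: "l x \<noteq> 0" "l x \<in> a P" using c rho x by (auto intro: span_scale span_base)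
    have "l x \<in> l ` P" using x by (auto intro: span_base)
    moreover have "a P \<in> Gr 1" using a P by (auto dest: bij_betw_apply)
    ultimately show ?thesis using lx Gr_one_eq_span collineation_Gr[OF l(1) P] by metis
  qed
  then show ?thesis using l by blast
qed

text \<open>Descends to points. There the upper map acts on lines, hence takes the line through two
  points to the line through their images, and the fundamental theorem applies.\<close>

lemma incidence_auto_collineation:
  assumes "incidence_auto j a b" "1 \<le> j" "Suc j < dimension"
  shows "\<exists>l. collineation scale l \<and> (\<forall>S\<in>Gr j. a S = l ` S) \<and> (\<forall>L\<in>Gr (Suc j). b L = l ` L)"
  using assms
proof (induction j arbitrary: a b rule: nat_induct)
  case 0 then show ?case by simp
next
  case (Suc i)
  let ?j = "Suc i"
  have a: "bij_betw a (Gr ?j) (Gr ?j)" and b: "bij_betw b (Gr (Suc ?j)) (Gr (Suc ?j))"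
    and inc: "\<And>S L. S \<in> Gr ?j \<Longrightarrow> L \<in> Gr (Suc ?j) \<Longrightarrow> S \<subseteq> L \<longleftrightarrow> a S \<subseteq> b L"
    using Suc.prems by (auto simp: incidence_auto_def)
  have "\<exists>l. collineation scale l \<and> (\<forall>S\<in>Gr ?j. a S = l ` S)"
  proof (cases "i = 0")
    case False
    \<comment> \<open>One dimension lower, \<open>a\<close> is the upper map, so the induction
      hypothesis already describes it.\<close>
    obtain c where "incidence_auto i c a" using incidence_auto_descend Suc.prems by blast
    then show ?thesis using Suc.IH[of c a] False Suc.prems by auto
  next
    case True
    have a1: "bij_betw a (Gr 1) (Gr 1)" using a True by simp
    have "R \<subseteq> span (P \<union> Q) \<longleftrightarrow> a R \<subseteq> span (a P \<union> a Q)"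
      if P: "P \<in> Gr 1" and Q: "Q \<in> Gr 1" and R: "R \<in> Gr 1" for P Q R
    proof -
      have im: "a P \<in> Gr 1" "a Q \<in> Gr 1" "a R \<in> Gr 1"
        using a1 P Q R by (auto dest: bij_betw_apply)
      show ?thesis
      proof (cases "P = Q")
        case True
        have "R \<subseteq> P \<longleftrightarrow> R = P" "a R \<subseteq> a P \<longleftrightarrow> a R = a P"
          using Gr_subset_eq P R im by blast+
        moreover have "R = P \<longleftrightarrow> a R = a P" using a1 P R by (auto simp: bij_betw_def inj_on_def)
        moreover have "span (P \<union> Q) = P" "span (a P \<union> a Q) = a P"
          using True P im by (simp_all add: Gr_iff span_eq_iff[THEN iffD2])
        ultimately show ?thesis by simp
      next
        case False
        have adjoin: "span (A \<union> B) \<in> Gr 2" if "A \<in> Gr 1" "B \<in> Gr 1" "A \<noteq> B" for A B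
        proof -
          have "adj A B" using that dim_inter_less[OF that] by (simp add: adj_def Gr_iff)
          then show ?thesis using adj_join that by (simp add: numeral_2_eq_2)
        qed
        have L: "span (P \<union> Q) \<in> Gr 2" using adjoin P Q False by blast
        have "a P \<noteq> a Q" using a1 P Q False by (auto simp: bij_betw_def inj_on_def)
        then have L': "span (a P \<union> a Q) \<in> Gr 2" using adjoin im by blast
        have bL: "b (span (P \<union> Q)) \<in> Gr 2" using b L True by (auto dest: bij_betw_apply simp: numeral_2_eq_2)
        have inc': "S \<subseteq> L \<longleftrightarrow> a S \<subseteq> b L" if "S \<in> Gr 1" "L \<in> Gr 2" for S L
          using inc[of S L] that True by (simp add: numeral_2_eq_2)
        have "P \<subseteq> span (P \<union> Q)" "Q \<subseteq> span (P \<union> Q)" by (auto intro: span_base)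
        then have "a P \<subseteq> b (span (P \<union> Q))" "a Q \<subseteq> b (span (P \<union> Q))"
          using inc' P Q L by blast+
        then have "span (a P \<union> a Q) \<subseteq> b (span (P \<union> Q))"
          using bL by (intro span_minimal) (auto simp: Gr_iff)
        then have "span (a P \<union> a Q) = b (span (P \<union> Q))" using Gr_subset_eq L' bL by blast
        then show ?thesis using inc' R L by simp
      qed
    qed
    from point_bijection_collineation[OF _ a1 this] Suc.prems True
    show ?thesis by auto
  qed
  then obtain l where l: "collineation scale l" "\<And>S. S \<in> Gr ?j \<Longrightarrow> a S = l ` S" by blast
  \<comment> \<open>\<open>L\<close> is the union of its hyperplanes, because each vector of
    \<open>L\<close> lies in one of them; so \<open>b\<close> is determined by
    \<open>a\<close>.\<close>
  have "b L = l ` L" if L: "L \<in> Gr (Suc ?j)" for L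
  proof -
    have "l ` L \<subseteq> b L"
    proof clarify
      fix x assume "x \<in> L"
      then obtain S where S: "S \<in> Gr ?j" "x \<in> S" "S \<subseteq> L" using Gr_between_point[OF L] by auto
      then have "l ` S \<subseteq> b L" using inc[OF S(1) L] l(2)[OF S(1)] by simp
      then show "l x \<in> b L" using S by blast
    qed
    moreover have "b L \<in> Gr (Suc ?j)" using b L by (auto dest: bij_betw_apply)
    ultimately show ?thesis using Gr_subset_eq collineation_Gr[OF l(1) L] by metis
  qed
  then show ?case using l by blast
qed

end

section \<open>Complementarity-preserving bijections\<close>

context finite_dimensional_vector_space
begin

section \<open>Recovering adjacency from complementarity\<close>

definition complement_auto :: "nat \<Rightarrow> ('b set \<Rightarrow> 'b set) \<Rightarrow> ('b set \<Rightarrow> 'b set) \<Rightarrow> bool" where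
  "complement_auto k g h \<longleftrightarrow> bij_betw g (Gr k) (Gr k) \<and>
    bij_betw h (Gr (dimension - k)) (Gr (dimension - k)) \<and>
    (\<forall>S\<in>Gr k. \<forall>U\<in>Gr (dimension - k). S \<inter> U = {0} \<longleftrightarrow> g S \<inter> h U = {0})"

lemma complement_auto_inv:
  assumes "complement_auto k g h"
  shows "complement_auto k (inv_into (Gr k) g) (inv_into (Gr (dimension - k)) h)"
proof -
  have gh: "bij_betw g (Gr k) (Gr k)" "bij_betw h (Gr (dimension - k)) (Gr (dimension - k))"
    using assms by (auto simp: complement_auto_def)
  have "S \<inter> U = {0} \<longleftrightarrow> inv_into (Gr k) g S \<inter> inv_into (Gr (dimension - k)) h U = {0}"
    if "S \<in> Gr k" "U \<in> Gr (dimension - k)" for S U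
    using assms that bij_betw_inv_into_right[OF gh(1)] bij_betw_inv_into_right[OF gh(2)]
      bij_betw_apply[OF bij_betw_inv_into[OF gh(1)]] bij_betw_apply[OF bij_betw_inv_into[OF gh(2)]]
    unfolding complement_auto_def by metis
  then show ?thesis using gh by (auto simp: complement_auto_def bij_betw_inv_into)
qed

lemma complement_auto_swap:
  assumes "complement_auto k g h" "k \<le> dimension"
  shows "complement_auto (dimension - k) h g"
  using assms by (auto simp: complement_auto_def Int_commute)

text \<open>If \<open>x \<in> W'\<close> were outside \<open>W\<close>, the line of \<open>x\<close>
  could be extended to a complement of \<open>W\<close>, and this complement meets \<open>W'\<close>
  in \<open>x\<close>.\<close>

lemma complement_determines:
  assumes "W \<in> Gr (dimension - k)" "W' \<in> Gr (dimension - k)" "k \<le> dimension"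
    "\<And>T. T \<in> Gr k \<Longrightarrow> T \<inter> W = {0} \<Longrightarrow> T \<inter> W' = {0}"
  shows "W' = W"
proof -
  have "W' \<subseteq> W"
  proof
    fix x assume x: "x \<in> W'"
    show "x \<in> W"
    proof (rule ccontr)
      assume xW: "x \<notin> W"
      have sW: "subspace W" and dW: "dim W = dimension - k" using assms by (auto simp: Gr_iff)
      have "W \<inter> {0} = {0}" using sW by (auto simp: subspace_0)
      moreover have "x \<notin> span (W \<union> {0})"
        using xW sW by (metis Un_commute insert_is_Un span_eq_iff span_insert_0)
      ultimately have "W \<inter> span (insert x {0}) = {0}"
        using disjoint_insert[OF sW subspace_single_0] by blast
      then obtain T where T: "T \<in> Gr (dimension - dim W)" "span (insert x {0}) \<subseteq> T" "W \<inter> T = {0}"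
        using extend_disjoint[OF sW subspace_span] by blast
      have "T \<in> Gr k" using T dW assms by simp
      then have "T \<inter> W' = {0}" using assms(4) T by (auto simp: Int_commute)
      moreover have "x \<in> T" using T by (auto intro: span_base)
      ultimately have "x = 0" using x by blast
      then show False using xW sW by (simp add: subspace_0)
    qed
  qed
  then show ?thesis using Gr_subset_eq assms by blast
qed

text \<open>Once \<open>g\<close> comes from \<open>l\<close>, the complements of \<open>h U\<close>
  are exactly the images under \<open>l\<close> of the complements of \<open>U\<close>, and a space
  is determined by its complements.\<close>

lemma complement_auto_collineation:
  assumes c: "complement_auto k g h" and k: "k \<le> dimension" and l: "collineation scale l"
    and g: "\<And>S. S \<in> Gr k \<Longrightarrow> g S = l ` S" and U: "U \<in> Gr (dimension - k)"
  shows "h U = l ` U"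
proof -
  have "inj l" "l 0 = 0" using l collineation_zero by (auto simp: collineation_def bij_def)
  then have l0: "l ` S \<inter> l ` T = {0} \<longleftrightarrow> S \<inter> T = {0}" for S T
    by (metis image_Int image_empty image_insert inj_image_eq_iff)
  have hU: "h U \<in> Gr (dimension - k)" using c U by (auto simp: complement_auto_def dest: bij_betw_apply)
  show ?thesis
  proof (rule complement_determines[OF collineation_Gr[OF l U] hU k])
    fix T assume T: "T \<in> Gr k" "T \<inter> l ` U = {0}"
    have "g ` Gr k = Gr k" using c by (simp add: complement_auto_def bij_betw_def)
    then obtain S where S: "S \<in> Gr k" "T = g S" using T(1) by blast
    then have "S \<inter> U = {0}" using T g l0 by simp
    then show "T \<inter> h U = {0}" using c S U by (auto simp: complement_auto_def)
  qed
qed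

text \<open>Adjacency in terms of complementarity, after Blunck and Havlicek: a third element of the
  pencil of \<open>S\<close> and \<open>T\<close> witnesses that \<open>S\<close> and \<open>T\<close> are adjacent.\<close>

lemma adj_pencil_complement:
  assumes S: "S \<in> Gr (Suc m)" and T: "T \<in> Gr (Suc m)" and a: "adj S T"
  obtains R where "R \<in> Gr (Suc m)" "R \<noteq> S" "R \<noteq> T"
    "\<And>U. subspace U \<Longrightarrow> R \<inter> U = {0} \<Longrightarrow> S \<inter> U = {0} \<or> T \<inter> U = {0}"
proof -
  define M where "M = S \<inter> T"
  define L where "L = span (S \<union> T)"
  have M: "M \<in> Gr m" unfolding M_def by (rule adj_meet[OF assms])
  have L: "L \<in> Gr (Suc (Suc m))" unfolding L_def by (rule adj_join[OF assms])
  have sub: "subspace S" "subspace T" "subspace M" "subspace L" using S T M L by (auto simp: Gr_iff)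
  have SL: "S \<subseteq> L" "T \<subseteq> L" by (auto simp: L_def intro: span_base)
  have "\<not> S \<subseteq> T" "\<not> T \<subseteq> S" using adj_neq[OF a] Gr_subset_eq S T by blast+
  then obtain x y where x: "x \<in> S" "x \<notin> T" and y: "y \<in> T" "y \<notin> S" by blast
  have xyS: "x + y \<notin> S" using x y sub by (metis add_diff_cancel_left' subspace_diff)
  have xyT: "x + y \<notin> T" using x y sub by (metis add_diff_cancel_right' subspace_diff)
  \<comment> \<open>A third element of the pencil between \<open>S \<inter> T\<close> and the join
    of \<open>S\<close> and \<open>T\<close>; it exists over every field.\<close>
  define R where "R = span (insert (x + y) M)"
  have xyM: "x + y \<notin> M" using xyS by (simp add: M_def)
  have R: "R \<in> Gr (Suc m)" unfolding R_def by (rule Gr_span_insert[OF M xyM])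
  have xyR: "x + y \<in> R" "M \<subseteq> R" by (auto simp: R_def intro: span_base)
  have "x + y \<in> L" using x y SL sub by (meson subsetD subspace_add)
  then have RL: "R \<subseteq> L" unfolding R_def
    using SL sub by (intro span_minimal) (auto simp: M_def)
  show ?thesis
  proof (rule that[OF R])
    show "R \<noteq> S" "R \<noteq> T" using xyR xyS xyT by auto
    fix U assume U: "subspace U" "R \<inter> U = {0}"
    show "S \<inter> U = {0} \<or> T \<inter> U = {0}"
    proof (rule ccontr)
      assume "\<not> ?thesis"
      moreover have "0 \<in> S \<inter> U" "0 \<in> T \<inter> U" using U sub by (auto simp: subspace_0)
      ultimately obtain u v where u: "u \<in> S" "u \<in> U" "u \<noteq> 0" and v: "v \<in> T" "v \<in> U" "v \<noteq> 0"
        by blast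
      \<comment> \<open>\<open>R\<close> is a hyperplane of \<open>L\<close> and disjoint from
        \<open>U\<close>, so \<open>U \<inter> L\<close> is at most a line. Meeting both
        \<open>S\<close> and \<open>T\<close>, this line would lie in \<open>S \<inter> T\<close>
        and thus in \<open>R\<close>.\<close>
      have "dim (R \<union> (U \<inter> L)) \<le> dim L" using RL by (intro dim_subset) auto
      moreover have "R \<inter> (U \<inter> L) = {0}" using U sub by (auto simp: subspace_0)
      moreover have "dim (R \<union> (U \<inter> L)) + dim (R \<inter> (U \<inter> L)) = dim R + dim (U \<inter> L)"
        using R U sub by (intro dim_Un_Int) (auto simp: Gr_iff subspace_inter)
      ultimately have d: "dim (U \<inter> L) \<le> 1" using R L by (simp add: Gr_iff)
      have "u \<in> U \<inter> L" "v \<in> U \<inter> L" using u v SL by auto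
      moreover have su: "subspace (U \<inter> L)" using U sub by (simp add: subspace_inter)
      moreover have "U \<inter> L \<in> Gr 1"
      proof -
        have "dim (U \<inter> L) \<noteq> 0" using \<open>u \<in> U \<inter> L\<close> u(3) by auto
        then have "dim (U \<inter> L) = 1" using d by linarith
        then show ?thesis using su unfolding Gr_iff by blast
      qed
      ultimately have "U \<inter> L = span {u}" "U \<inter> L = span {v}"
        using Gr_one_eq_span u v by blast+
      then have "u \<in> span {v}" by (auto intro: span_base)
      then have "u \<in> T" using v sub span_minimal[of "{v}" T] by blast
      then have "u \<in> R \<inter> U" using u xyR by (auto simp: M_def)
      then show False using U u by blast
    qed
  qed
qed

text \<open>The converse criterion. Vectors of \<open>S\<close> and \<open>T\<close> that are
  independent modulo \<open>R\<close> would lie in a common complement of \<open>R\<close>, which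
  then meets both \<open>S\<close> and \<open>T\<close>. So \<open>S\<close> and \<open>T\<close>
  add only one dimension to \<open>R\<close>.\<close>

lemma complement_pencil_adj:
  assumes S: "S \<in> Gr k" and T: "T \<in> Gr k" and R: "R \<in> Gr k" and ne: "S \<noteq> T" "R \<noteq> S" "R \<noteq> T"
    and compl: "\<And>U. U \<in> Gr (dimension - k) \<Longrightarrow> R \<inter> U = {0} \<Longrightarrow> S \<inter> U = {0} \<or> T \<inter> U = {0}"
  shows "adj S T"
proof -
  have sub: "subspace S" "subspace T" "subspace R" using S T R by (auto simp: Gr_iff)
  have *: "y \<in> span (insert x R)" if xy: "x \<in> S" "x \<notin> R" "y \<in> T" for x y
  proof (rule ccontr)
    assume y: "y \<notin> span (insert x R)"
    have R0: "R \<inter> {0} = {0}" using sub by (auto simp: subspace_0)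
    have "x \<notin> span (R \<union> {0})"
      using xy sub by (metis Un_commute insert_is_Un span_eq_iff span_insert_0)
    then have 1: "R \<inter> span (insert x {0}) = {0}"
      using disjoint_insert[OF sub(3) subspace_single_0 R0] by blast
    have "span (R \<union> span (insert x {0})) \<subseteq> span (insert x R)"
    proof (rule span_minimal)
      have "span (insert x {0}) \<subseteq> span (insert x R)"
        by (intro span_minimal) (auto intro: span_base span_zero)
      then show "R \<union> span (insert x {0}) \<subseteq> span (insert x R)" by (auto intro: span_base)
    qed simp
    then have "y \<notin> span (R \<union> span (insert x {0}))" using y by blast
    then have "R \<inter> span (insert y (span (insert x {0}))) = {0}"
      using disjoint_insert[OF sub(3) subspace_span 1] by blast
    then obtain U where U: "U \<in> Gr (dimension - dim R)" "span (insert y (span (insert x {0}))) \<subseteq> U" "R \<inter> U = {0}"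
      using extend_disjoint[OF sub(3) subspace_span] by blast
    have "x \<in> U" "y \<in> U" using U(2) by (auto intro: span_base)
    moreover have "x \<noteq> 0" "y \<noteq> 0" using xy y sub by (auto simp: subspace_0 span_zero)
    ultimately have "S \<inter> U \<noteq> {0}" "T \<inter> U \<noteq> {0}" using xy by blast+
    moreover have "U \<in> Gr (dimension - k)" using U R by (simp add: Gr_iff)
    ultimately show False using compl U by blast
  qed
  have "\<not> S \<subseteq> R" "\<not> T \<subseteq> R" using Gr_subset_eq S T R ne by blast+
  then obtain x y where x: "x \<in> S" "x \<notin> R" and y: "y \<in> T" "y \<notin> R" by blast
  define L where "L = span (insert x R)"
  have L: "L \<in> Gr (Suc k)" unfolding L_def by (rule Gr_span_insert[OF R x(2)])
  have TL: "T \<subseteq> L" using * x by (auto simp: L_def)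
  have SL: "S \<subseteq> L"
  proof
    fix z assume z: "z \<in> S"
    show "z \<in> L"
    proof (cases "z \<in> R")
      case True then show ?thesis by (auto simp: L_def intro: span_base)
    next
      case False
      \<comment> \<open>Since \<open>y\<close> is not in \<open>R\<close>, the exchange property
        turns this into \<open>z \<in> span (insert y R)\<close>, which lies in
        \<open>L\<close>.\<close>
      then have "y \<in> span (insert z R)" using * z y by blast
      moreover have "y \<notin> span R" using y sub by (simp add: span_eq_iff[THEN iffD2])
      ultimately have "z \<in> span (insert y R)" using in_span_insert by blast
      moreover have "span (insert y R) \<subseteq> L"
        using TL y L by (intro span_minimal) (auto simp: L_def Gr_iff intro: span_base)
      ultimately show ?thesis by blast
    qed
  qed
  show ?thesis by (rule adjI_join[OF S T ne(1) L SL TL])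
qed

text \<open>The pencil criterion mentions only complementarity, so it is carried along by
  \<open>g\<close> and \<open>h\<close>.\<close>

lemma complement_auto_adj:
  assumes c: "complement_auto (Suc m) g h" and S: "S \<in> Gr (Suc m)" "T \<in> Gr (Suc m)" "adj S T"
  shows "adj (g S) (g T)"
proof -
  have g: "bij_betw g (Gr (Suc m)) (Gr (Suc m))"
    and h: "bij_betw h (Gr (dimension - Suc m)) (Gr (dimension - Suc m))"
    and gh: "\<And>S U. S \<in> Gr (Suc m) \<Longrightarrow> U \<in> Gr (dimension - Suc m) \<Longrightarrow> S \<inter> U = {0} \<longleftrightarrow> g S \<inter> h U = {0}"
    using c by (auto simp: complement_auto_def)
  obtain R where R: "R \<in> Gr (Suc m)" "R \<noteq> S" "R \<noteq> T"
    "\<And>U. subspace U \<Longrightarrow> R \<inter> U = {0} \<Longrightarrow> S \<inter> U = {0} \<or> T \<inter> U = {0}"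
    using adj_pencil_complement[OF S] by blast
  have mem: "g S \<in> Gr (Suc m)" "g T \<in> Gr (Suc m)" "g R \<in> Gr (Suc m)"
    using g S R by (auto dest: bij_betw_apply)
  have ne: "g S \<noteq> g T" "g R \<noteq> g S" "g R \<noteq> g T"
    using g S R adj_neq[OF S(3)] by (auto simp: bij_betw_def inj_on_def)
  show ?thesis
  proof (rule complement_pencil_adj[OF mem ne])
    fix U' assume U': "U' \<in> Gr (dimension - Suc m)" "g R \<inter> U' = {0}"
    obtain U where U: "U \<in> Gr (dimension - Suc m)" "U' = h U"
      using h U' unfolding bij_betw_def by blast
    have "R \<inter> U = {0}" using gh R U U' by blast
    then have "S \<inter> U = {0} \<or> T \<inter> U = {0}" using R(4) U by (auto simp: Gr_iff)
    then show "g S \<inter> U' = {0} \<or> g T \<inter> U' = {0}" using gh S U by blast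
  qed
qed

lemma complement_auto_adj_iff:
  assumes c: "complement_auto (Suc m) g h" and S: "S \<in> Gr (Suc m)" "T \<in> Gr (Suc m)"
  shows "adj (g S) (g T) \<longleftrightarrow> adj S T"
proof
  have g: "bij_betw g (Gr (Suc m)) (Gr (Suc m))"
    using c by (auto simp: complement_auto_def)
  assume "adj (g S) (g T)"
  then have "adj (inv_into (Gr (Suc m)) g (g S)) (inv_into (Gr (Suc m)) g (g T))"
    using complement_auto_adj[OF complement_auto_inv[OF c]] g S by (auto dest: bij_betw_apply)
  then show "adj S T" using bij_betw_inv_into_left[OF g] S by simp
qed (rule complement_auto_adj[OF c S])

lemma Gr_one_disjoint_iff:
  assumes "P \<in> Gr 1" "subspace U"
  shows "P \<inter> U = {0} \<longleftrightarrow> \<not> P \<subseteq> U"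
proof -
  obtain x where x: "x \<noteq> 0" "P = span {x}" using Gr_one_obtain[OF assms(1)] by blast
  have "P \<inter> U = {0}" if "\<not> P \<subseteq> U"
  proof (rule ccontr)
    assume "P \<inter> U \<noteq> {0}"
    moreover have "0 \<in> P \<inter> U" using assms x by (auto simp: subspace_0 span_zero)
    ultimately obtain y where y: "y \<in> P" "y \<in> U" "y \<noteq> 0" by blast
    then have "P = span {y}" using Gr_one_eq_span assms by blast
    then have "P \<subseteq> U" using y assms by (simp add: span_minimal)
    then show False using that by blast
  qed
  moreover have "P \<inter> U \<noteq> {0}" if "P \<subseteq> U"
  proof -
    have "x \<in> P \<inter> U" using that x by (auto intro: span_base)
    then show ?thesis using x by blast
  qed
  ultimately show ?thesis by blast
qed

text \<open>Any two points are adjacent, so for \<open>k = 1\<close> adjacency carries no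
  information. Instead, collinearity is read off complementarity directly: \<open>R\<close> is on
  the line of \<open>P\<close> and \<open>Q\<close> iff every hyperplane missing \<open>R\<close>
  misses \<open>P\<close> or \<open>Q\<close>.\<close>

lemma complement_auto_points:
  assumes c: "complement_auto 1 g h" and n: "3 \<le> dimension"
  shows "\<exists>l. collineation scale l \<and> (\<forall>P\<in>Gr 1. g P = l ` P)"
proof (rule point_bijection_collineation[OF n])
  have g: "bij_betw g (Gr 1) (Gr 1)"
    and h: "bij_betw h (Gr (dimension - 1)) (Gr (dimension - 1))"
    and gh: "\<And>S U. S \<in> Gr 1 \<Longrightarrow> U \<in> Gr (dimension - 1) \<Longrightarrow> S \<inter> U = {0} \<longleftrightarrow> g S \<inter> h U = {0}"
    using c by (auto simp: complement_auto_def)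
  show "bij_betw g (Gr 1) (Gr 1)" by (rule g)
  fix P Q R assume PQR: "P \<in> Gr 1" "Q \<in> Gr 1" "R \<in> Gr 1"
  have line: "R \<subseteq> span (P \<union> Q) \<longleftrightarrow>
      (\<forall>U\<in>Gr (dimension - 1). R \<inter> U = {0} \<longrightarrow> P \<inter> U = {0} \<or> Q \<inter> U = {0})"
    if P: "P \<in> Gr 1" "Q \<in> Gr 1" "R \<in> Gr 1" for P Q R
  proof
    assume R: "R \<subseteq> span (P \<union> Q)"
    show "\<forall>U\<in>Gr (dimension - 1). R \<inter> U = {0} \<longrightarrow> P \<inter> U = {0} \<or> Q \<inter> U = {0}"
    proof (intro ballI impI, rule ccontr)
      fix U assume U: "U \<in> Gr (dimension - 1)" "R \<inter> U = {0}" "\<not> (P \<inter> U = {0} \<or> Q \<inter> U = {0})"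
      then have sU: "subspace U" by (simp add: Gr_iff)
      then have "P \<subseteq> U" "Q \<subseteq> U" using U P Gr_one_disjoint_iff by blast+
      then have "span (P \<union> Q) \<subseteq> U" using sU by (intro span_minimal) auto
      then have "R \<subseteq> U" using R by blast
      then show False using U P Gr_one_disjoint_iff sU by blast
    qed
  next
    assume h: "\<forall>U\<in>Gr (dimension - 1). R \<inter> U = {0} \<longrightarrow> P \<inter> U = {0} \<or> Q \<inter> U = {0}"
    show "R \<subseteq> span (P \<union> Q)"
    proof (rule ccontr)
      assume "\<not> ?thesis"
      then have "R \<inter> span (P \<union> Q) = {0}" using Gr_one_disjoint_iff P by blast
      moreover have "subspace R" using P by (simp add: Gr_iff)
      ultimately obtain U where U: "U \<in> Gr (dimension - dim R)" "span (P \<union> Q) \<subseteq> U" "R \<inter> U = {0}"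
        using extend_disjoint[OF _ subspace_span] by blast
      then have U1: "U \<in> Gr (dimension - 1)" using P by (simp add: Gr_iff)
      have "P \<subseteq> U" "Q \<subseteq> U" using U(2) by (auto intro: span_base)
      then show False using h U U1 P Gr_one_disjoint_iff by (metis Gr_iff)
    qed
  qed
  have mem: "g P \<in> Gr 1" "g Q \<in> Gr 1" "g R \<in> Gr 1" using g PQR by (auto dest: bij_betw_apply)
  have hX: "h ` Gr (dimension - 1) = Gr (dimension - 1)" using h by (simp add: bij_betw_def)
  have ex: "(\<forall>U\<in>Gr (dimension - 1). A U) \<longleftrightarrow> (\<forall>U\<in>Gr (dimension - 1). A (h U))"
    for A :: "'b set \<Rightarrow> bool"
  proof -
    have "(\<forall>U\<in>h ` Gr (dimension - 1). A U) \<longleftrightarrow> (\<forall>U\<in>Gr (dimension - 1). A (h U))" by blast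
    then show ?thesis unfolding hX .
  qed
  show "R \<subseteq> span (P \<union> Q) \<longleftrightarrow> g R \<subseteq> span (g P \<union> g Q)"
    unfolding line[OF PQR] line[OF mem] ex[of "\<lambda>U. g R \<inter> U = {0} \<longrightarrow> g P \<inter> U = {0} \<or> g Q \<inter> U = {0}"]
    using gh PQR by simp
qed

section \<open>Whether tops become tops or stars\<close>

definition tops_to_tops :: "nat \<Rightarrow> ('b set \<Rightarrow> 'b set) \<Rightarrow> bool" where
  "tops_to_tops k g \<longleftrightarrow>
    (\<forall>L\<in>Gr (Suc k). \<exists>L'\<in>Gr (Suc k). \<forall>S\<in>Gr k. S \<subseteq> L \<longrightarrow> g S \<subseteq> L')"

definition tops_to_stars :: "nat \<Rightarrow> ('b set \<Rightarrow> 'b set) \<Rightarrow> bool" where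
  "tops_to_stars k g \<longleftrightarrow>
    (\<forall>L\<in>Gr (Suc k). \<exists>M\<in>Gr (k - 1). \<forall>S\<in>Gr k. S \<subseteq> L \<longrightarrow> M \<subseteq> g S)"

lemma Gr_subspace_exists:
  assumes "L \<in> Gr (Suc m)"
  obtains S where "S \<in> Gr m" "S \<subseteq> L"
proof -
  obtain x where x: "x \<in> L" "x \<noteq> 0" using Gr_Suc_nonzero[OF assms] by blast
  obtain T where "T \<in> Gr m" "L = span (insert x T)" using Gr_Suc_decompose[OF assms x] by blast
  moreover then have "T \<subseteq> L" by (auto intro: span_base)
  ultimately show ?thesis using that by blast
qed

lemma pencil_two:
  assumes M: "M \<in> Gr m" and L: "L \<in> Gr (Suc (Suc m))" and MsL: "M \<subseteq> L"
  obtains S T where "S \<in> Gr (Suc m)" "T \<in> Gr (Suc m)" "S \<noteq> T" "M \<subseteq> S" "M \<subseteq> T" "S \<subseteq> L" "T \<subseteq> L"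
proof -
  have sM: "subspace M" and sL: "subspace L" using M L by (auto simp: Gr_iff)
  have "\<not> L \<subseteq> M" using dim_subset[of L M] M L by (auto simp: Gr_iff)
  then obtain x where x: "x \<in> L" "x \<notin> M" by blast
  have S: "span (insert x M) \<in> Gr (Suc m)" by (rule Gr_span_insert[OF M x(2)])
  have "\<not> L \<subseteq> span (insert x M)" using dim_subset[of L "span (insert x M)"] S L by (auto simp: Gr_iff)
  then obtain y where y: "y \<in> L" "y \<notin> span (insert x M)" by blast
  have yM: "y \<notin> M" using y by (auto intro: span_base)
  have "y \<in> span (insert y M)" by (auto intro: span_base)
  then have ne: "span (insert x M) \<noteq> span (insert y M)" using y by blast
  have "M \<subseteq> span (insert x M)" "M \<subseteq> span (insert y M)" by (auto intro: span_base)
  moreover have "span (insert x M) \<subseteq> L" "span (insert y M) \<subseteq> L"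
    using x y MsL sL span_minimal[of "insert x M" L] span_minimal[of "insert y M" L] by simp_all
  ultimately show ?thesis using that[OF S Gr_span_insert[OF M yM] ne] by blast
qed

lemma image_clique:
  assumes c: "complement_auto (Suc m) g h"
    and C: "C \<subseteq> Gr (Suc m)" "\<And>S T. S \<in> C \<Longrightarrow> T \<in> C \<Longrightarrow> S \<noteq> T \<Longrightarrow> adj S T"
    and AB: "A \<in> C" "B \<in> C" "A \<noteq> B"
  shows "(\<exists>M\<in>Gr m. \<forall>S\<in>C. M \<subseteq> g S) \<or> (\<exists>L\<in>Gr (Suc (Suc m)). \<forall>S\<in>C. g S \<subseteq> L)"
proof -
  have g: "bij_betw g (Gr (Suc m)) (Gr (Suc m))" using c by (auto simp: complement_auto_def)
  have "g ` C \<subseteq> Gr (Suc m)" using g C by (auto dest: bij_betw_apply)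
  moreover have "adj S T" if ST: "S \<in> g ` C" "T \<in> g ` C" "S \<noteq> T" for S T
  proof -
    obtain S' T' where "S' \<in> C" "S = g S'" "T' \<in> C" "T = g T'" using ST by blast
    then show ?thesis using complement_auto_adj[OF c] C ST by blast
  qed
  moreover have "g A \<in> g ` C" "g B \<in> g ` C" using AB by auto
  moreover have "A \<in> Gr (Suc m)" "B \<in> Gr (Suc m)" using C AB by auto
  then have "g A \<noteq> g B" using bij_betw_imp_inj_on[OF g] AB by (meson inj_onD)
  ultimately have "(\<exists>M\<in>Gr m. \<forall>S\<in>g ` C. M \<subseteq> S) \<or> (\<exists>L\<in>Gr (Suc (Suc m)). \<forall>S\<in>g ` C. S \<subseteq> L)"
    by (rule clique_star_or_top)
  then show ?thesis by simp
qed

lemma image_top_clique: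
  assumes c: "complement_auto (Suc m) g h" and L: "L \<in> Gr (Suc (Suc m))"
  shows "(\<exists>M\<in>Gr m. \<forall>S\<in>Gr (Suc m). S \<subseteq> L \<longrightarrow> M \<subseteq> g S) \<or>
    (\<exists>L'\<in>Gr (Suc (Suc m)). \<forall>S\<in>Gr (Suc m). S \<subseteq> L \<longrightarrow> g S \<subseteq> L')"
proof -
  define C where "C = {S\<in>Gr (Suc m). S \<subseteq> L}"
  obtain K where K: "K \<in> Gr (Suc m)" "K \<subseteq> L" using Gr_subspace_exists[OF L] by blast
  obtain M where M: "M \<in> Gr m" "M \<subseteq> K" using Gr_subspace_exists[OF K(1)] by blast
  have "M \<subseteq> L" using M K by blast
  obtain A B where AB: "A \<in> Gr (Suc m)" "B \<in> Gr (Suc m)" "A \<noteq> B" "M \<subseteq> A" "M \<subseteq> B"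
    "A \<subseteq> L" "B \<subseteq> L"
    by (rule pencil_two[OF M(1) L \<open>M \<subseteq> L\<close>])
  have adj: "adj S T" if "S \<in> C" "T \<in> C" "S \<noteq> T" for S T
    using adjI_join[of S "Suc m" T L] L that by (simp add: C_def)
  have C: "C \<subseteq> Gr (Suc m)" "A \<in> C" "B \<in> C" using AB by (auto simp: C_def)
  have "(\<exists>M\<in>Gr m. \<forall>S\<in>C. M \<subseteq> g S) \<or> (\<exists>L\<in>Gr (Suc (Suc m)). \<forall>S\<in>C. g S \<subseteq> L)"
    by (rule image_clique[OF c C(1) adj C(2,3) AB(3)])
  then show ?thesis by (simp add: C_def Ball_def imp_conjL)
qed

lemma image_star_clique:
  assumes c: "complement_auto (Suc m) g h" and M: "M \<in> Gr m" and n: "Suc m < dimension"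
  shows "(\<exists>M'\<in>Gr m. \<forall>S\<in>Gr (Suc m). M \<subseteq> S \<longrightarrow> M' \<subseteq> g S) \<or>
    (\<exists>L\<in>Gr (Suc (Suc m)). \<forall>S\<in>Gr (Suc m). M \<subseteq> S \<longrightarrow> g S \<subseteq> L)"
proof -
  define C where "C = {S\<in>Gr (Suc m). M \<subseteq> S}"
  obtain x where x: "x \<notin> M" using Gr_not_UNIV[OF M] n by auto
  have A: "span (insert x M) \<in> Gr (Suc m)" "x \<in> span (insert x M)" "M \<subseteq> span (insert x M)"
    using Gr_span_insert[OF M x] by (auto intro: span_base)
  obtain B where B: "B \<in> Gr (Suc m)" "M \<subseteq> B" "x \<notin> B" by (rule Gr_superspace_avoiding[OF M x n])
  have ne: "span (insert x M) \<noteq> B" using A B by blast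
  have adj: "adj S T" if "S \<in> C" "T \<in> C" "S \<noteq> T" for S T
    using adjI_meet[of S m T M] M that by (simp add: C_def)
  have C: "C \<subseteq> Gr (Suc m)" "span (insert x M) \<in> C" "B \<in> C" using A B by (auto simp: C_def)
  have "(\<exists>M\<in>Gr m. \<forall>S\<in>C. M \<subseteq> g S) \<or> (\<exists>L\<in>Gr (Suc (Suc m)). \<forall>S\<in>C. g S \<subseteq> L)"
    by (rule image_clique[OF c C(1) adj C(2,3) ne])
  then show ?thesis by (simp add: C_def Ball_def imp_conjL)
qed

text \<open>The hyperplanes of \<open>L\<close> have no nonzero vector in common. The bound
  \<open>1 \<le> m\<close> makes \<open>N\<close> nonzero.\<close>

lemma top_not_in_star:
  assumes L: "L \<in> Gr (Suc (Suc m))" and N: "N \<in> Gr m" and m: "1 \<le> m"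
  shows "\<exists>S\<in>Gr (Suc m). S \<subseteq> L \<and> \<not> N \<subseteq> S"
proof (rule ccontr)
  assume "\<not> ?thesis"
  then have sub: "\<And>S. S \<in> Gr (Suc m) \<Longrightarrow> S \<subseteq> L \<Longrightarrow> N \<subseteq> S" by blast
  obtain x where x: "x \<in> N" "x \<noteq> 0" using Gr_Suc_nonzero[of N "m - 1"] N m by auto
  obtain K where "K \<in> Gr (Suc m)" "K \<subseteq> L" using Gr_subspace_exists[OF L] by blast
  then have xL: "x \<in> L" using sub x by blast
  have "subspace L" using L by (simp add: Gr_iff)
  then have "{0} \<subseteq> L" by (simp add: subspace_0)
  moreover have "x \<notin> {0}" using x by simp
  ultimately obtain T where "T \<in> Gr (Suc m)" "{0} \<subseteq> T" "T \<subseteq> L" "x \<notin> T"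
    by (rule Gr_hyperplane_avoiding[OF L _ subspace_single_0 xL])
  then show False using sub x by blast
qed

text \<open>\<open>S\<close> is \<open>M\<close> together with a vector outside \<open>L\<close>, so
  \<open>S \<inter> L = M\<close>; and \<open>T\<close> is a hyperplane of \<open>L\<close> that
  does not contain \<open>M\<close>. Their meet is therefore too small.\<close>

lemma star_and_top_not_clique:
  assumes M: "M \<in> Gr m" and L: "L \<in> Gr (Suc (Suc m))" and MsL: "M \<subseteq> L"
    and m: "1 \<le> m" and n: "Suc (Suc m) < dimension"
  obtains S T where "S \<in> Gr (Suc m)" "M \<subseteq> S" "T \<in> Gr (Suc m)" "T \<subseteq> L" "S \<noteq> T" "\<not> adj S T"
proof -
  obtain z where z: "z \<notin> L" using Gr_not_UNIV[OF L n] by blast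
  then have zM: "z \<notin> M" using MsL by blast
  define S where "S = span (insert z M)"
  have S: "S \<in> Gr (Suc m)" unfolding S_def by (rule Gr_span_insert[OF M zM])
  have zS: "z \<in> S" "M \<subseteq> S" by (auto simp: S_def intro: span_base)
  obtain T where T: "T \<in> Gr (Suc m)" "T \<subseteq> L" "\<not> M \<subseteq> T" using top_not_in_star[OF L M m] by blast
  have sL: "subspace L" using L by (simp add: Gr_iff)
  have SL: "S \<inter> L = M"
  proof -
    have "subspace (S \<inter> L)" using S sL by (auto simp: Gr_iff subspace_inter)
    moreover have "dim (S \<inter> L) < Suc m"
    proof -
      have "span (S \<inter> L) \<subset> span S"
        using z zS S \<open>subspace (S \<inter> L)\<close> by (auto simp: Gr_iff span_eq_iff[THEN iffD2])
      then have "dim (S \<inter> L) < dim S" using dim_psubset by blast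
      then show ?thesis using S by (simp add: Gr_iff)
    qed
    moreover have "M \<subseteq> S \<inter> L" using zS MsL by blast
    moreover then have "dim M \<le> dim (S \<inter> L)" by (rule dim_subset)
    ultimately show ?thesis using M subspace_dim_equal[of M "S \<inter> L"] by (auto simp: Gr_iff)
  qed
  have "\<not> adj S T"
  proof
    assume "adj S T"
    then have "S \<inter> T \<in> Gr m" by (rule adj_meet[OF S T(1)])
    moreover have "S \<inter> T \<subseteq> M" using SL T by blast
    ultimately have "S \<inter> T = M" using Gr_subset_eq M by blast
    then show False using T by blast
  qed
  moreover have "S \<noteq> T" using zS T z by blast
  ultimately show ?thesis using that S zS T by blast
qed

text \<open>The star of \<open>M\<close> and the top of \<open>L\<close> share two members
  \<open>P\<close>, \<open>Q\<close>. If both were mapped into stars, the centres would agree with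
  the meet of \<open>g P\<close> and \<open>g Q\<close>; if both into tops, these would agree with
  their join. Either way the nonadjacent \<open>S\<close> and \<open>T\<close> would get adjacent
  images.\<close>

lemma star_top_types_differ:
  assumes c: "complement_auto (Suc m) g h" and M: "M \<in> Gr m" and L: "L \<in> Gr (Suc (Suc m))"
    and MsL: "M \<subseteq> L" and m: "1 \<le> m" and n: "Suc (Suc m) < dimension"
  shows "\<not> ((\<exists>A\<in>Gr m. \<forall>S\<in>Gr (Suc m). M \<subseteq> S \<longrightarrow> A \<subseteq> g S) \<and>
      (\<exists>B\<in>Gr m. \<forall>S\<in>Gr (Suc m). S \<subseteq> L \<longrightarrow> B \<subseteq> g S))"
    and "\<not> ((\<exists>A\<in>Gr (Suc (Suc m)). \<forall>S\<in>Gr (Suc m). M \<subseteq> S \<longrightarrow> g S \<subseteq> A) \<and>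
      (\<exists>B\<in>Gr (Suc (Suc m)). \<forall>S\<in>Gr (Suc m). S \<subseteq> L \<longrightarrow> g S \<subseteq> B))"
proof -
  have g: "bij_betw g (Gr (Suc m)) (Gr (Suc m))" using c by (auto simp: complement_auto_def)
  have gm: "g S \<in> Gr (Suc m)" if "S \<in> Gr (Suc m)" for S using g that by (auto dest: bij_betw_apply)
  have gne: "g S \<noteq> g T" if "S \<in> Gr (Suc m)" "T \<in> Gr (Suc m)" "S \<noteq> T" for S T
    using g that by (auto simp: bij_betw_def inj_on_def)
  obtain P Q where PQ: "P \<in> Gr (Suc m)" "Q \<in> Gr (Suc m)" "P \<noteq> Q" "M \<subseteq> P" "M \<subseteq> Q" "P \<subseteq> L" "Q \<subseteq> L"
    by (rule pencil_two[OF M L MsL])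
  obtain S T where ST: "S \<in> Gr (Suc m)" "M \<subseteq> S" "T \<in> Gr (Suc m)" "T \<subseteq> L" "S \<noteq> T" "\<not> adj S T"
    by (rule star_and_top_not_clique[OF M L MsL m n])
  then have nadj: "\<not> adj (g S) (g T)" using complement_auto_adj_iff[OF c] by blast
  have aPQ: "adj (g P) (g Q)"
    using complement_auto_adj[OF c PQ(1,2)] adjI_meet[OF PQ(1-3) M PQ(4,5)] by blast
  show "\<not> ((\<exists>A\<in>Gr m. \<forall>S\<in>Gr (Suc m). M \<subseteq> S \<longrightarrow> A \<subseteq> g S) \<and>
      (\<exists>B\<in>Gr m. \<forall>S\<in>Gr (Suc m). S \<subseteq> L \<longrightarrow> B \<subseteq> g S))"
  proof
    assume "((\<exists>A\<in>Gr m. \<forall>S\<in>Gr (Suc m). M \<subseteq> S \<longrightarrow> A \<subseteq> g S) \<and>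
      (\<exists>B\<in>Gr m. \<forall>S\<in>Gr (Suc m). S \<subseteq> L \<longrightarrow> B \<subseteq> g S))"
    then obtain A B where A: "A \<in> Gr m" "\<forall>S\<in>Gr (Suc m). M \<subseteq> S \<longrightarrow> A \<subseteq> g S"
      and B: "B \<in> Gr m" "\<forall>S\<in>Gr (Suc m). S \<subseteq> L \<longrightarrow> B \<subseteq> g S" by blast
    have "g P \<inter> g Q \<in> Gr m" using adj_meet gm PQ aPQ by blast
    moreover have "A \<subseteq> g P \<inter> g Q" "B \<subseteq> g P \<inter> g Q" using A B PQ by blast+
    ultimately have "A = B" using Gr_subset_eq A B by metis
    then have "A \<subseteq> g S" "A \<subseteq> g T" using A B ST by blast+
    then have "adj (g S) (g T)"
      using adjI_meet[OF gm[OF ST(1)] gm[OF ST(3)] gne[OF ST(1,3,5)] A(1)] by blast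
    then show False using nadj by blast
  qed
  show "\<not> ((\<exists>A\<in>Gr (Suc (Suc m)). \<forall>S\<in>Gr (Suc m). M \<subseteq> S \<longrightarrow> g S \<subseteq> A) \<and>
      (\<exists>B\<in>Gr (Suc (Suc m)). \<forall>S\<in>Gr (Suc m). S \<subseteq> L \<longrightarrow> g S \<subseteq> B))"
  proof
    assume "((\<exists>A\<in>Gr (Suc (Suc m)). \<forall>S\<in>Gr (Suc m). M \<subseteq> S \<longrightarrow> g S \<subseteq> A) \<and>
      (\<exists>B\<in>Gr (Suc (Suc m)). \<forall>S\<in>Gr (Suc m). S \<subseteq> L \<longrightarrow> g S \<subseteq> B))"
    then obtain A B where A: "A \<in> Gr (Suc (Suc m))" "\<forall>S\<in>Gr (Suc m). M \<subseteq> S \<longrightarrow> g S \<subseteq> A"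
      and B: "B \<in> Gr (Suc (Suc m))" "\<forall>S\<in>Gr (Suc m). S \<subseteq> L \<longrightarrow> g S \<subseteq> B" by blast
    have J: "span (g P \<union> g Q) \<in> Gr (Suc (Suc m))" using adj_join gm PQ aPQ by blast
    have "g P \<subseteq> A" "g Q \<subseteq> A" "g P \<subseteq> B" "g Q \<subseteq> B" using A B PQ by blast+
    then have "span (g P \<union> g Q) \<subseteq> A" "span (g P \<union> g Q) \<subseteq> B"
      using A(1) B(1) span_minimal[of "g P \<union> g Q"] by (simp_all add: Gr_iff)
    then have "A = B" using Gr_subset_eq J A B by metis
    then have "g S \<subseteq> A" "g T \<subseteq> A" using A B ST by blast+
    then have "adj (g S) (g T)"
      using adjI_join[OF gm[OF ST(1)] gm[OF ST(3)] gne[OF ST(1,3,5)] A(1)] by blast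
    then show False using nadj by blast
  qed
qed

text \<open>Exchanging a direction of \<open>X\<close> outside \<open>Y\<close> for a vector of
  \<open>Y\<close> outside \<open>X\<close> gives a neighbour of \<open>X\<close> that meets
  \<open>Y\<close> in a larger space; \<open>m - dim (X \<inter> Y)\<close> measures what is
  left.\<close>

lemma Gr_connected:
  assumes X: "X \<in> Gr m" and Y: "Y \<in> Gr m" and P: "P X"
    and step: "\<And>A B. A \<in> Gr m \<Longrightarrow> B \<in> Gr m \<Longrightarrow> adj A B \<Longrightarrow> P A \<Longrightarrow> P B"
  shows "P Y"
  using X P
proof (induction "m - dim (X \<inter> Y)" arbitrary: X rule: less_induct)
  case less
  show ?case
  proof (cases "X = Y")
    case True then show ?thesis using less by simp
  next
    case False
    have sXY: "subspace (X \<inter> Y)" using less.prems Y by (auto simp: Gr_iff subspace_inter)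
    have "\<not> X \<subseteq> Y" "\<not> Y \<subseteq> X" using Gr_subset_eq less.prems Y False by blast+
    then obtain x y where x: "x \<in> X" "x \<notin> Y" and y: "y \<in> Y" "y \<notin> X" by blast
    obtain j where m: "m = Suc j"
      using less.prems(1) x(1) Y x(2) by (cases m) (auto simp: Gr_iff subspace_0)
    have X': "X \<in> Gr (Suc j)" using less.prems m by simp
    have "x \<notin> X \<inter> Y" using x by blast
    then obtain T where T: "T \<in> Gr j" "X \<inter> Y \<subseteq> T" "T \<subseteq> X" "x \<notin> T"
      by (rule Gr_hyperplane_avoiding[OF X' Int_lower1 sXY x(1)])
    define Z where "Z = span (insert y T)"
    have yT: "y \<notin> T" using T y by blast
    have Z: "Z \<in> Gr (Suc j)" unfolding Z_def by (rule Gr_span_insert[OF T(1) yT])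
    have yZ: "y \<in> Z" "T \<subseteq> Z" by (auto simp: Z_def intro: span_base)
    have "adj X Z" by (rule adjI_meet[OF X' Z _ T(1,3) yZ(2)]) (use yZ y in blast)
    then have PZ: "P Z" using step X' Z less.prems m by blast
    have sub: "X \<inter> Y \<subseteq> Z \<inter> Y" "y \<in> Z \<inter> Y" "y \<notin> X \<inter> Y" using T yZ y by auto
    have sZY: "subspace (Z \<inter> Y)" using Z Y by (auto simp: Gr_iff subspace_inter)
    have "span (X \<inter> Y) \<subset> span (Z \<inter> Y)"
      using sub sXY sZY by (auto simp: span_eq_iff[THEN iffD2])
    then have "dim (X \<inter> Y) < dim (Z \<inter> Y)" using dim_psubset by blast
    moreover have "dim (Z \<inter> Y) \<le> m" using dim_subset[of "Z \<inter> Y" Y] Y by (simp add: Gr_iff)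
    ultimately have "m - dim (Z \<inter> Y) < m - dim (X \<inter> Y)" by linarith
    then show ?thesis using less.hyps Z PZ m by blast
  qed
qed

text \<open>Tops of two adjacent spaces behave alike, since the star of an \<open>M\<close> inside
  both behaves differently from each of them. Connectedness spreads the behaviour to all
  tops.\<close>

lemma tops_dichotomy:
  assumes c: "complement_auto (Suc m) g h" and m: "1 \<le> m" and n: "Suc (Suc m) < dimension"
  shows "tops_to_tops (Suc m) g \<or> tops_to_stars (Suc m) g"
proof (rule ccontr)
  define ts where "ts L \<longleftrightarrow> (\<exists>B\<in>Gr m. \<forall>S\<in>Gr (Suc m). S \<subseteq> L \<longrightarrow> B \<subseteq> g S)" for L
  define tt where "tt L \<longleftrightarrow> (\<exists>B\<in>Gr (Suc (Suc m)). \<forall>S\<in>Gr (Suc m). S \<subseteq> L \<longrightarrow> g S \<subseteq> B)" for L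
  have dich: "ts L \<or> tt L" if "L \<in> Gr (Suc (Suc m))" for L
    using image_top_clique[OF c that] unfolding ts_def tt_def by blast
  assume "\<not> ?thesis"
  then obtain L1 L2 where L: "L1 \<in> Gr (Suc (Suc m))" "\<not> tt L1" "L2 \<in> Gr (Suc (Suc m))" "\<not> ts L2"
    unfolding tops_to_tops_def tops_to_stars_def ts_def tt_def by auto
  then have "ts L1" using dich by blast
  have "ts L2"
  proof (rule Gr_connected[where P = ts, OF L(1,3) \<open>ts L1\<close>])
    fix A B assume AB: "A \<in> Gr (Suc (Suc m))" "B \<in> Gr (Suc (Suc m))" "adj A B" "ts A"
    have "A \<inter> B \<in> Gr (Suc m)" by (rule adj_meet[OF AB(1-3)])
    then obtain M where M: "M \<in> Gr m" "M \<subseteq> A \<inter> B" using Gr_subspace_exists by blast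
    have n1: "Suc m < dimension" using n by simp
    have MA: "M \<subseteq> A" "M \<subseteq> B" using M by auto
    have "\<not> (\<exists>A\<in>Gr m. \<forall>S\<in>Gr (Suc m). M \<subseteq> S \<longrightarrow> A \<subseteq> g S)"
      using star_top_types_differ(1)[OF c M(1) AB(1) MA(1) m n] AB(4) unfolding ts_def by blast
    then have "\<exists>L\<in>Gr (Suc (Suc m)). \<forall>S\<in>Gr (Suc m). M \<subseteq> S \<longrightarrow> g S \<subseteq> L"
      using image_star_clique[OF c M(1) n1] by blast
    then have "\<not> tt B"
      using star_top_types_differ(2)[OF c M(1) AB(2) MA(2) m n] unfolding tt_def by blast
    then show "ts B" using dich AB by blast
  qed
  then show False using L by blast
qed

lemma dim_Un_finite: "finite X \<Longrightarrow> dim (X \<union> M) \<le> dim M + card X"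
proof (induction X rule: finite_induct)
  case (insert x F)
  have "dim (insert x (F \<union> M)) \<le> Suc (dim (F \<union> M))" by (simp add: dim_insert)
  then show ?case using insert by simp
qed simp

text \<open>Each new hyperplane misses a vector of the current intersection, so the dimension drops
  and at most \<open>dim R\<close> of them are used.\<close>

lemma hyperplanes_trivial_intersection:
  assumes L: "L \<in> Gr (Suc k)"
  shows "subspace R \<Longrightarrow> R \<subseteq> L \<Longrightarrow> dim R \<le> r \<Longrightarrow>
    \<exists>F. finite F \<and> card F \<le> r \<and> F \<subseteq> {S\<in>Gr k. S \<subseteq> L} \<and> R \<inter> \<Inter>F = {0}"
proof (induction r arbitrary: R)
  case 0
  then have "R = {0}" by (auto simp: subspace_0)
  then show ?case by (intro exI[of _ "{}"]) simp
next
  case (Suc r)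
  show ?case
  proof (cases "R = {0}")
    case True then show ?thesis by (intro exI[of _ "{}"]) simp
  next
    case False
    then obtain x where x: "x \<in> R" "x \<noteq> 0" using Suc.prems by (auto simp: subspace_0)
    have "subspace L" using L by (simp add: Gr_iff)
    then have "{0} \<subseteq> L" by (simp add: subspace_0)
    moreover have "x \<in> L" "x \<notin> {0}" using x Suc.prems by auto
    ultimately obtain S where S: "S \<in> Gr k" "{0} \<subseteq> S" "S \<subseteq> L" "x \<notin> S"
      by (rule Gr_hyperplane_avoiding[OF L _ subspace_single_0])
    have sRS: "subspace (R \<inter> S)" using Suc.prems S by (auto simp: Gr_iff subspace_inter)
    have "span (R \<inter> S) \<subset> span R"
      using x S Suc.prems sRS by (auto simp: span_eq_iff[THEN iffD2])
    then have "dim (R \<inter> S) < dim R" by (rule dim_psubset)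
    then obtain F where F: "finite F" "card F \<le> r" "F \<subseteq> {S\<in>Gr k. S \<subseteq> L}" "(R \<inter> S) \<inter> \<Inter>F = {0}"
      using Suc.IH[OF sRS le_infI1[OF Suc.prems(2)]] Suc.prems(3) less_Suc_eq_le order_less_le_trans by meson
    have "card (insert S F) \<le> Suc r" using F by (simp add: card_insert_if)
    moreover have "R \<inter> \<Inter>(insert S F) = {0}" using F by auto
    ultimately show ?thesis using F S by (intro exI[of _ "insert S F"]) auto
  qed
qed

text \<open>Suppose the top of \<open>L\<close> goes into the star of \<open>M\<close>. A few
  hyperplanes of \<open>L\<close> with zero intersection have images inside one hyperplane
  \<open>H\<close> of \<open>V\<close>. A space \<open>U\<close> complementary to \<open>M\<close>
  in \<open>H\<close> comes from some \<open>U'\<close> that must then meet every hyperplane of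
  \<open>L\<close>, although \<open>U\<close> is complementary to a member of the star of
  \<open>M\<close> outside \<open>H\<close>.\<close>

lemma tops_to_tops_small:
  assumes c: "complement_auto (Suc m) g h" and m: "1 \<le> m" and n: "2 * Suc m < dimension"
  shows "tops_to_tops (Suc m) g"
  unfolding tops_to_tops_def
proof (intro ballI, rule ccontr)
  let ?k = "Suc m"
  fix L assume L: "L \<in> Gr (Suc ?k)"
    and nt: "\<not> (\<exists>L'\<in>Gr (Suc ?k). \<forall>S\<in>Gr ?k. S \<subseteq> L \<longrightarrow> g S \<subseteq> L')"
  have g: "bij_betw g (Gr ?k) (Gr ?k)"
    and h: "bij_betw h (Gr (dimension - ?k)) (Gr (dimension - ?k))"
    and gh: "\<And>S U. S \<in> Gr ?k \<Longrightarrow> U \<in> Gr (dimension - ?k) \<Longrightarrow> S \<inter> U = {0} \<longleftrightarrow> g S \<inter> h U = {0}"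
    using c by (auto simp: complement_auto_def)
  have gm: "g S \<in> Gr ?k" if "S \<in> Gr ?k" for S using g that by (auto dest: bij_betw_apply)
  obtain M where M': "M \<in> Gr m" "\<forall>S\<in>Gr ?k. S \<subseteq> L \<longrightarrow> M \<subseteq> g S"
    using image_top_clique[OF c L] nt by blast
  then have M: "M \<in> Gr m" "\<And>S. S \<in> Gr ?k \<Longrightarrow> S \<subseteq> L \<Longrightarrow> M \<subseteq> g S" by blast+
  have sM: "subspace M" and sL: "subspace L" using M L by (auto simp: Gr_iff)
  let ?g' = "inv_into (Gr ?k) g"
  \<comment> \<open>The inverse images of the star of \<open>M\<close> form a clique containing all
    hyperplanes of \<open>L\<close>. These have no common centre, so the clique lies in a top, and
    this top is that of \<open>L\<close>.\<close>
  have inL: "?g' T \<subseteq> L" if T: "T \<in> Gr ?k" "M \<subseteq> T" for T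
  proof -
    have "(\<exists>N\<in>Gr m. \<forall>T\<in>Gr ?k. M \<subseteq> T \<longrightarrow> N \<subseteq> ?g' T) \<or>
        (\<exists>L1\<in>Gr (Suc ?k). \<forall>T\<in>Gr ?k. M \<subseteq> T \<longrightarrow> ?g' T \<subseteq> L1)"
      using image_star_clique[OF complement_auto_inv[OF c] M(1)] n by simp
    then show ?thesis
    proof
      assume "\<exists>N\<in>Gr m. \<forall>T\<in>Gr ?k. M \<subseteq> T \<longrightarrow> N \<subseteq> ?g' T"
      then obtain N where N': "N \<in> Gr m" "\<forall>T\<in>Gr ?k. M \<subseteq> T \<longrightarrow> N \<subseteq> ?g' T" by blast
      then have N: "N \<in> Gr m" "\<And>T. T \<in> Gr ?k \<Longrightarrow> M \<subseteq> T \<Longrightarrow> N \<subseteq> ?g' T" by blast+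
      have "N \<subseteq> S" if "S \<in> Gr ?k" "S \<subseteq> L" for S
        using N(2)[OF gm M(2)] that bij_betw_inv_into_left[OF g] by simp
      then show ?thesis using top_not_in_star[OF L N(1) m] by blast
    next
      assume "\<exists>L1\<in>Gr (Suc ?k). \<forall>T\<in>Gr ?k. M \<subseteq> T \<longrightarrow> ?g' T \<subseteq> L1"
      then obtain L1 where L1': "L1 \<in> Gr (Suc ?k)" "\<forall>T\<in>Gr ?k. M \<subseteq> T \<longrightarrow> ?g' T \<subseteq> L1" by blast
      then have L1: "L1 \<in> Gr (Suc ?k)" "\<And>T. T \<in> Gr ?k \<Longrightarrow> M \<subseteq> T \<Longrightarrow> ?g' T \<subseteq> L1" by blast+
      have "S \<subseteq> L1" if "S \<in> Gr ?k" "S \<subseteq> L" for S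
        using L1(2)[OF gm M(2)] that bij_betw_inv_into_left[OF g] by simp
      then have "L1 = L" using Gr_top_determines[OF L L1(1)] by simp
      then show ?thesis using L1 T by blast
    qed
  qed
  obtain F where F: "finite F" "card F \<le> Suc ?k" "F \<subseteq> {S\<in>Gr ?k. S \<subseteq> L}" "L \<inter> \<Inter>F = {0}"
    using hyperplanes_trivial_intersection[OF L sL, of "Suc ?k"] L by (auto simp: Gr_iff)
  have "\<exists>x. g S = span (insert x M)" if S: "S \<in> F" for S
  proof -
    have "S \<in> Gr ?k" "S \<subseteq> L" using F S by auto
    then have gS: "g S \<in> Gr ?k" "M \<subseteq> g S" using gm M(2) by blast+
    have "\<not> g S \<subseteq> M" using dim_subset[of "g S" M] gS M by (auto simp: Gr_iff)
    then obtain x where x: "x \<in> g S" "x \<notin> M" by blast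
    have "span (insert x M) \<subseteq> g S" using x gS by (intro span_minimal) (auto simp: Gr_iff)
    then show ?thesis using Gr_subset_eq[OF Gr_span_insert[OF M(1) x(2)] gS(1)] by metis
  qed
  then obtain x where x: "\<And>S. S \<in> F \<Longrightarrow> g S = span (insert (x S) M)" by metis
  define W where "W = span (x ` F \<union> M)"
  have "dim W \<le> dim M + card (x ` F)" unfolding W_def using dim_Un_finite[of "x ` F" M] F by simp
  \<comment> \<open>Each image adds one vector to \<open>M\<close> and there are at most
    \<open>k + 1\<close> of them, where \<open>k\<close> is \<open>Suc m\<close>; the bound
    \<open>m + k + 1\<close> equals \<open>2 * k\<close>.\<close>
  also have "\<dots> \<le> m + Suc ?k" using M card_image_le[OF F(1), of x] F by (simp add: Gr_iff)
  finally have "dim W < dimension" using n by simp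
  then have "W \<noteq> UNIV" using dim_UNIV_dimension by (metis less_irrefl)
  then obtain w where w: "w \<notin> W" by blast
  have U1: "UNIV \<in> Gr (Suc (dimension - 1))" using n dim_UNIV_dimension by (simp add: Gr_iff)
  obtain H where H: "H \<in> Gr (dimension - 1)" "W \<subseteq> H"
    using Gr_hyperplane_avoiding[OF U1 subset_UNIV _ UNIV_I w] by (auto simp: W_def)
  have sH: "subspace H" using H by (simp add: Gr_iff)
  have MH: "M \<subseteq> H" using H by (auto simp: W_def intro: span_base)
  obtain U0 where U0: "U0 \<in> Gr (dimension - dim M)" "M \<inter> U0 = {0}"
    using complement_exists[OF sM] by blast
  have sU0: "subspace U0" and dU0: "dim U0 = dimension - m" using U0 M by (auto simp: Gr_iff)
  define U where "U = U0 \<inter> H"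
  have dUH: "dim (U0 \<union> H) = dimension"
  proof -
    have "dim M = m" "dim (M \<inter> U0) = 0" using M(1) U0(2) by (auto simp: Gr_iff)
    then have "dim (M \<union> U0) = dimension" using dim_Un_Int[OF sM sU0] dU0 n by (simp del: dim_eq_0)
    moreover have "dim (M \<union> U0) \<le> dim (U0 \<union> H)" using MH by (intro dim_subset) auto
    ultimately show ?thesis using dim_le_dimension[of "U0 \<union> H"] by simp
  qed
  have U: "U \<in> Gr (dimension - ?k)"
    using dim_Un_Int[OF sU0 sH] dUH dU0 H n sU0 sH by (simp add: Gr_iff U_def subspace_inter)
  then have sU: "subspace U" by (simp add: Gr_iff)
  obtain U' where U': "U' \<in> Gr (dimension - ?k)" "U = h U'"
    using bij_betw_imp_surj_on[OF h] U by blast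
  have sU': "subspace U'" using U' by (simp add: Gr_iff)
  \<comment> \<open>\<open>g S\<close> and \<open>U\<close> both lie in the hyperplane
    \<open>H\<close>, so they are not complementary, and neither are \<open>S\<close> and
    \<open>U'\<close>.\<close>
  have meet: "S \<inter> U' \<noteq> {0}" if S: "S \<in> F" for S
  proof
    assume "S \<inter> U' = {0}"
    have SG: "S \<in> Gr ?k" using F S by blast
    have "g S \<inter> U = {0}" using gh[OF SG U'(1)] U'(2) \<open>S \<inter> U' = {0}\<close> by simp
    moreover have "g S \<in> Gr ?k" by (rule gm[OF SG])
    moreover then have "dim (g S \<union> U) + dim (g S \<inter> U) = ?k + (dimension - ?k)"
      using dim_Un_Int[of "g S" U] U by (simp add: Gr_iff)
    moreover have "g S \<subseteq> W"
    proof -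
      have "insert (x S) M \<subseteq> x ` F \<union> M" using S by blast
      then show ?thesis unfolding x[OF S] W_def by (rule span_mono)
    qed
    then have "dim (g S \<union> U) \<le> dim H" using H by (intro dim_subset) (auto simp: U_def)
    ultimately show False using H n by (simp add: Gr_iff)
  qed
  \<comment> \<open>If \<open>U'\<close> missed one hyperplane of \<open>L\<close>, it would meet
    \<open>L\<close> in at most a line. By \<open>meet\<close> this line would lie in all members of
    \<open>F\<close>, whose common part is zero.\<close>
  have all: "S \<inter> U' \<noteq> {0}" if S: "S \<in> Gr ?k" "S \<subseteq> L" for S
  proof
    assume S0: "S \<inter> U' = {0}"
    have "dim (S \<union> (U' \<inter> L)) \<le> dim L" using S by (intro dim_subset) auto
    moreover have "S \<inter> (U' \<inter> L) = {0}" using S0 sL by (auto simp: subspace_0)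
    moreover have "dim (S \<union> (U' \<inter> L)) + dim (S \<inter> (U' \<inter> L)) = dim S + dim (U' \<inter> L)"
      using S sU' sL by (intro dim_Un_Int) (auto simp: Gr_iff subspace_inter)
    ultimately have d: "dim (U' \<inter> L) \<le> 1" using S L by (simp add: Gr_iff)
    have sUL: "subspace (U' \<inter> L)" using sU' sL by (simp add: subspace_inter)
    have "L \<noteq> {0}" using L by (auto simp: Gr_iff)
    then have "F \<noteq> {}" using F(4) by auto
    then obtain T0 where T0: "T0 \<in> F" by blast
    have pt: "\<exists>t. t \<in> T \<and> t \<in> U' \<inter> L \<and> t \<noteq> 0" if T: "T \<in> F" for T
    proof -
      have "subspace T" "T \<subseteq> L" using F T by (auto simp: Gr_iff)
      then have "0 \<in> T \<inter> U'" using sU' by (simp add: subspace_0)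
      then show ?thesis using meet[OF T] \<open>T \<subseteq> L\<close> by blast
    qed
    obtain p where p: "p \<in> U' \<inter> L" "p \<noteq> 0" using pt T0 by blast
    have "dim (U' \<inter> L) \<noteq> 0" using p by auto
    then have "dim (U' \<inter> L) = 1" using d by linarith
    then have G1: "U' \<inter> L \<in> Gr 1" using sUL unfolding Gr_iff by blast
    have "p \<in> T" if T: "T \<in> F" for T
    proof -
      obtain t where t: "t \<in> T" "t \<in> U' \<inter> L" "t \<noteq> 0" using pt T by blast
      then have "p \<in> span {t}" using p Gr_one_eq_span[OF G1] by blast
      moreover have "span {t} \<subseteq> T" using t F T by (intro span_minimal) (auto simp: Gr_iff)
      ultimately show ?thesis by blast
    qed
    then have "p \<in> L \<inter> \<Inter>F" using p by blast
    then show False using F p by blast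
  qed
  have "H \<noteq> UNIV" using H dim_UNIV_dimension n by (auto simp: Gr_iff)
  \<comment> \<open>\<open>M\<close> extended by \<open>z\<close> meets \<open>H\<close> only in
    \<open>M\<close> and is therefore disjoint from \<open>U\<close>, while its inverse image is a
    hyperplane of \<open>L\<close> and so meets \<open>U'\<close>.\<close>
  then obtain z where z: "z \<notin> H" by blast
  then have zM: "z \<notin> M" using MH by blast
  define T where "T = span (insert z M)"
  have T: "T \<in> Gr ?k" unfolding T_def by (rule Gr_span_insert[OF M(1) zM])
  have "M \<subseteq> T" by (auto simp: T_def intro: span_base)
  then have "?g' T \<subseteq> L" using inL T by blast
  moreover have "?g' T \<in> Gr ?k" using T bij_betw_inv_into[OF g] by (auto dest: bij_betw_apply)
  ultimately have "?g' T \<inter> U' \<noteq> {0}" using all by blast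
  then have "T \<inter> U \<noteq> {0}"
    using gh[OF \<open>?g' T \<in> Gr ?k\<close> U'(1)] U' bij_betw_inv_into_right[OF g T] by simp
  moreover have "T \<inter> U \<subseteq> {0}"
  proof
    fix u assume u: "u \<in> T \<inter> U"
    then obtain a s where a: "s \<in> M" "u = s + scale a z"
      using mem_span_insert_subspace[OF sM] by (auto simp: T_def)
    have "u \<in> H" "s \<in> H" using u a(1) MH by (auto simp: U_def)
    then have "u - s \<in> H" using sH by (simp add: subspace_diff)
    then have az: "scale a z \<in> H" using a by simp
    have "a = 0"
    proof (rule ccontr)
      assume "a \<noteq> 0"
      then have "z = scale (inverse a) (scale a z)" by simp
      then show False using z az sH by (metis subspace_scale)
    qed
    then show "u \<in> {0}" using a u U0 by (auto simp: U_def)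
  qed
  moreover have "0 \<in> T \<inter> U" using T sU by (simp add: Gr_iff subspace_0)
  ultimately show False by blast
qed

text \<open>By the dichotomy the inverse would otherwise send tops to stars; following it after
  \<open>g\<close>, the hyperplanes of some space would share a nonzero centre.\<close>

lemma tops_to_tops_inv:
  assumes c: "complement_auto (Suc m) g h" and m: "1 \<le> m" and n: "Suc (Suc m) < dimension"
    and t: "tops_to_tops (Suc m) g"
  shows "tops_to_tops (Suc m) (inv_into (Gr (Suc m)) g)"
proof (rule ccontr)
  have g: "bij_betw g (Gr (Suc m)) (Gr (Suc m))" using c by (auto simp: complement_auto_def)
  assume "\<not> ?thesis"
  then have ts: "tops_to_stars (Suc m) (inv_into (Gr (Suc m)) g)"
    using tops_dichotomy[OF complement_auto_inv[OF c] m n] by blast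
  \<comment> \<open>Some space of this dimension must exist; it is spanned by part of a
    basis.\<close>
  obtain A where "A \<in> Gr (Suc (Suc m))"
  proof -
    obtain B where "independent B" "span B = UNIV" "card B = dimension"
      using independent_Basis span_Basis dimension_def by metis
    then obtain B' where "B' \<subseteq> B" "card B' = Suc (Suc m)" 
      using n by (metis obtain_subset_with_card_n less_imp_le)
    then have "independent B'" using \<open>independent B\<close> independent_mono by blast
    then have "span B' \<in> Gr (Suc (Suc m))"
      using dim_span_eq_card_independent \<open>card B' = _\<close> by (simp add: Gr_iff dim_eq_card_independent)
    then show ?thesis using that by blast
  qed
  then obtain L where L: "L \<in> Gr (Suc (Suc m))" "\<forall>S\<in>Gr (Suc m). S \<subseteq> A \<longrightarrow> g S \<subseteq> L"
    using t by (auto simp: tops_to_tops_def)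
  obtain M where M: "M \<in> Gr m" "\<forall>S\<in>Gr (Suc m). S \<subseteq> L \<longrightarrow> M \<subseteq> inv_into (Gr (Suc m)) g S"
    using ts L by (auto simp: tops_to_stars_def)
  have "M \<subseteq> S" if S: "S \<in> Gr (Suc m)" "S \<subseteq> A" for S
  proof -
    have "g S \<in> Gr (Suc m)" "g S \<subseteq> L" using g L S by (auto dest: bij_betw_apply)
    then have "M \<subseteq> inv_into (Gr (Suc m)) g (g S)" using M by blast
    then show ?thesis using bij_betw_inv_into_left[OF g S(1)] by simp
  qed
  then show False using top_not_in_star[OF \<open>A \<in> _\<close> M(1) m] by blast
qed

text \<open>In the middle dimension the behaviour of tops has to be assumed, since maps coming from
  correlations send tops to stars there. For \<open>k = 1\<close> the argument on points replaces
  the one on cliques.\<close>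

lemma complement_auto_small:
  assumes c: "complement_auto k g h" and k: "1 \<le> k" "2 * k \<le> dimension" and n: "3 \<le> dimension"
    and t: "2 * k = dimension \<Longrightarrow> tops_to_tops k g"
  shows "\<exists>l. collineation scale l \<and> (\<forall>S\<in>Gr k. g S = l ` S) \<and> (\<forall>U\<in>Gr (dimension - k). h U = l ` U)"
proof -
  have "\<exists>l. collineation scale l \<and> (\<forall>S\<in>Gr k. g S = l ` S)"
  proof (cases "k = 1")
    case True
    then show ?thesis using complement_auto_points[of g h] c n by simp
  next
    case False
    then obtain m where m: "k = Suc m" "1 \<le> m" using k by (cases k) auto
    have n2: "Suc (Suc m) < dimension" using k m n by simp
    have tt: "tops_to_tops k g"
    proof (cases "2 * k = dimension")
      case True then show ?thesis by (rule t)
    next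
      case False
      then show ?thesis using tops_to_tops_small c k m by simp
    qed
    have tt': "tops_to_tops k (inv_into (Gr k) g)" using tops_to_tops_inv c m n2 tt by blast
    have g: "bij_betw g (Gr k) (Gr k)" using c by (simp add: complement_auto_def)
    have "\<exists>b. incidence_auto k g b"
    proof (rule incidence_auto_from_tops[OF g k(1)])
      fix L assume L: "L \<in> Gr (Suc k)"
      show "\<exists>L'\<in>Gr (Suc k). \<forall>S\<in>Gr k. S \<subseteq> L \<longrightarrow> g S \<subseteq> L'"
        using tt L by (simp add: tops_to_tops_def)
      show "\<exists>L'\<in>Gr (Suc k). \<forall>S\<in>Gr k. S \<subseteq> L \<longrightarrow> inv_into (Gr k) g S \<subseteq> L'"
        using tt' L by (simp add: tops_to_tops_def)
    qed
    then obtain b where "incidence_auto k g b" ..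
    then show ?thesis using incidence_auto_collineation[of k g b] k m n2 by blast
  qed
  then obtain l where l: "collineation scale l" "\<forall>S\<in>Gr k. g S = l ` S" by blast
  have "h U = l ` U" if "U \<in> Gr (dimension - k)" for U
    using complement_auto_collineation[OF c _ l(1) _ that] l(2) k by simp
  then show ?thesis using l by blast
qed

lemma complement_auto_induced:
  assumes c: "complement_auto k g h" and k: "1 \<le> k" "k < dimension" and n: "3 \<le> dimension"
    and t: "2 * k = dimension \<Longrightarrow> tops_to_tops k g"
  shows "\<exists>l. collineation scale l \<and> (\<forall>S\<in>Gr k. g S = l ` S) \<and> (\<forall>U\<in>Gr (dimension - k). h U = l ` U)"
proof (cases "2 * k \<le> dimension")
  case True
  then show ?thesis using complement_auto_small[OF c k(1) True n t] by blast
next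
  case False
  \<comment> \<open>The two maps exchange roles. The new dimension \<open>dimension - k\<close> is
    below half, so the condition on tops in the middle dimension is vacuous.\<close>
  have "dimension - (dimension - k) = k" using k by simp
  then show ?thesis
    using complement_auto_small[OF complement_auto_swap[OF c]] k n False by fastforce
qed

end

section \<open>Involutions and their fibres\<close>

locale involution_space = finite_dimensional_vector_space scale Basis
  for scale :: "'a::field \<Rightarrow> 'v::ab_group_add \<Rightarrow> 'v" and Basis :: "'v set" +
  assumes two_nz: "(2::'a) \<noteq> 0"
begin

section \<open>Eigenspaces of involutions\<close>

definition linear_involution :: "('v \<Rightarrow> 'v) \<Rightarrow> bool" where
  "linear_involution \<sigma> \<longleftrightarrow> Vector_Spaces.linear scale scale \<sigma> \<and> (\<forall>x. \<sigma> (\<sigma> x) = x)"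

lemma linear_self_iff: "Vector_Spaces.linear scale scale f \<longleftrightarrow>
    (\<forall>x y. f (x + y) = f x + f y) \<and> (\<forall>c x. f (scale c x) = scale c (f x))"
  unfolding Vector_Spaces.linear_iff using vector_space_axioms by simp

lemma functional_iff: "Vector_Spaces.linear scale (*) f \<longleftrightarrow>
    (\<forall>x y. f (x + y) = f x + f y) \<and> (\<forall>c x. f (scale c x) = c * f x)"
proof -
  have "vector_space ((*) :: 'a \<Rightarrow> 'a \<Rightarrow> 'a)" by unfold_locales (auto simp: algebra_simps)
  then show ?thesis unfolding Vector_Spaces.linear_iff using vector_space_axioms by simp
qed

lemma linear_involution_simps:
  assumes "linear_involution \<sigma>"
  shows "\<sigma> (x + y) = \<sigma> x + \<sigma> y" "\<sigma> (scale c x) = scale c (\<sigma> x)" "\<sigma> (\<sigma> x) = x" "\<sigma> 0 = 0"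
    "\<sigma> (- x) = - \<sigma> x" "\<sigma> (x - y) = \<sigma> x - \<sigma> y"
proof -
  show a: "\<sigma> (x + y) = \<sigma> x + \<sigma> y" for x y
    using assms by (simp add: linear_involution_def linear_self_iff)
  show s: "\<sigma> (scale c x) = scale c (\<sigma> x)" for c x
    using assms by (simp add: linear_involution_def linear_self_iff)
  show "\<sigma> (\<sigma> x) = x" using assms by (simp add: linear_involution_def)
  show "\<sigma> 0 = 0" using s[of 0 0] by simp
  show m: "\<sigma> (- x) = - \<sigma> x" for x using s[of "-1" x] by simp
  show "\<sigma> (x - y) = \<sigma> x - \<sigma> y" using a[of x "- y"] m by simp
qed

lemma eq_neg_zero: "(x::'v) = - x \<Longrightarrow> x = 0"
proof -
  assume "x = - x"
  then have "x + x = 0" by (metis add.right_inverse)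
  then have "scale 2 x = 0" by (metis one_add_one scale_left_distrib scale_one)
  then show ?thesis using two_nz by simp
qed

lemma U_plus_subspace: "linear_involution \<sigma> \<Longrightarrow> subspace (U_plus \<sigma>)"
  by (rule subspaceI) (auto simp: U_plus_def linear_involution_simps)

lemma U_minus_subspace: "linear_involution \<sigma> \<Longrightarrow> subspace (U_minus \<sigma>)"
  by (rule subspaceI) (auto simp: U_minus_def linear_involution_simps)

lemma U_plus_minus_disjoint: "linear_involution \<sigma> \<Longrightarrow> U_plus \<sigma> \<inter> U_minus \<sigma> = {0}"
  using eq_neg_zero by (auto simp: U_plus_def U_minus_def linear_involution_simps) 

lemma involution_decompose:
  assumes "linear_involution \<sigma>"
  obtains s u where "s \<in> U_plus \<sigma>" "u \<in> U_minus \<sigma>" "x = s + u"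
proof
  show "scale (1/2) (x + \<sigma> x) \<in> U_plus \<sigma>" "scale (1/2) (x - \<sigma> x) \<in> U_minus \<sigma>"
    using assms by (auto simp: U_plus_def U_minus_def linear_involution_simps add.commute
        simp flip: scale_minus_right)
  have "(1/2 + 1/2 :: 'a) = 1" using two_nz by (simp add: add_divide_distrib[symmetric])
  then have "scale (1/2) x + scale (1/2) x = x" by (metis scale_left_distrib scale_one)
  then show "x = scale (1/2) (x + \<sigma> x) + scale (1/2) (x - \<sigma> x)"
    by (simp add: scale_right_distrib scale_right_diff_distrib)
qed

lemma dim_U_plus_minus:
  assumes "linear_involution \<sigma>"
  shows "dim (U_plus \<sigma>) + dim (U_minus \<sigma>) = dimension"
proof -
  have "span (U_plus \<sigma> \<union> U_minus \<sigma>) = UNIV"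
    using involution_decompose[OF assms] U_plus_subspace[OF assms] U_minus_subspace[OF assms]
    by (metis (no_types, lifting) UNIV_eq_I UnCI span_add span_base)
  then have "dim (U_plus \<sigma> \<union> U_minus \<sigma>) = dimension" by (simp add: dim_eq_full)
  then show ?thesis
    using dim_Un_Int[OF U_plus_subspace[OF assms] U_minus_subspace[OF assms]]
      U_plus_minus_disjoint[OF assms] by simp
qed

text \<open>Bijectivity is automatic for an involution, and the dimension of the minus space follows
  from the decomposition.\<close>

lemma involutions_iff:
  "\<sigma> \<in> involutions scale k (dimension - k) \<longleftrightarrow> linear_involution \<sigma> \<and> dim (U_plus \<sigma>) = k"
proof -
  have "bij \<sigma>" if "linear_involution \<sigma>"
    using that by (intro o_bij[of \<sigma> \<sigma>]) (auto simp: linear_involution_simps)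
  moreover have "dim (U_minus \<sigma>) = dimension - dim (U_plus \<sigma>)" if "linear_involution \<sigma>"
    using dim_U_plus_minus[OF that] by simp
  moreover have "linear_involution \<sigma> \<longleftrightarrow> Vector_Spaces.linear scale scale \<sigma> \<and> \<sigma> \<circ> \<sigma> = id"
    by (auto simp: linear_involution_def fun_eq_iff)
  ultimately show ?thesis by (auto simp: involutions_def general_linear_def)
qed

abbreviation Inv :: "nat \<Rightarrow> ('v \<Rightarrow> 'v) set" where
  "Inv k \<equiv> involutions scale k (dimension - k)"

lemma involution_Gr:
  assumes "\<sigma> \<in> Inv k"
  shows "U_plus \<sigma> \<in> Gr k" "U_minus \<sigma> \<in> Gr (dimension - k)" "U_plus \<sigma> \<inter> U_minus \<sigma> = {0}" "k \<le> dimension"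
  using assms dim_U_plus_minus[of \<sigma>] U_plus_minus_disjoint[of \<sigma>] U_plus_subspace[of \<sigma>] U_minus_subspace[of \<sigma>]
  unfolding involutions_iff Gr_iff by auto

lemma involution_eqI:
  assumes "linear_involution \<sigma>" "linear_involution \<sigma>'" "U_plus \<sigma> = U_plus \<sigma>'" "U_minus \<sigma> = U_minus \<sigma>'"
  shows "\<sigma> = \<sigma>'"
proof
  fix x
  obtain s u where su: "s \<in> U_plus \<sigma>" "u \<in> U_minus \<sigma>" "x = s + u" by (rule involution_decompose[OF assms(1)])
  then have "s \<in> U_plus \<sigma>'" "u \<in> U_minus \<sigma>'" using assms by auto
  then show "\<sigma> x = \<sigma>' x"
    using su assms by (simp add: U_plus_def U_minus_def linear_involution_simps)
qed

text \<open>The involution is \<open>p - (1 - p)\<close>, where \<open>p\<close> is the projection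
  onto \<open>S\<close> along \<open>U\<close>; it is well defined because the decomposition exists
  and is unique.\<close>

lemma involution_exists:
  assumes S: "S \<in> Gr k" and U: "U \<in> Gr (dimension - k)" and k: "k \<le> dimension" and SU: "S \<inter> U = {0}"
  obtains \<sigma> where "\<sigma> \<in> Inv k" "U_plus \<sigma> = S" "U_minus \<sigma> = U"
proof -
  have sS: "subspace S" and sU: "subspace U" using S U by (auto simp: Gr_iff)
  have ex: "\<exists>s. s \<in> S \<and> x - s \<in> U" for x
  proof -
    have "x \<in> span (S \<union> U)" using complement_span[OF S U k SU] by simp
    then obtain s u where "s \<in> S" "u \<in> U" "x = s + u" unfolding span_subspace_Un[OF sS sU] by blast
    then show ?thesis by (intro exI[of _ s]) simp
  qed
  have uniq: "s = t" if "s \<in> S" "x - s \<in> U" "t \<in> S" "x - t \<in> U" for s t x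
  proof -
    have "s - t \<in> S" using that sS by (simp add: subspace_diff)
    moreover have "(x - t) - (x - s) \<in> U" by (rule subspace_diff[OF sU that(4,2)])
    then have "s - t \<in> U" by simp
    ultimately have "s - t = 0" using SU by blast
    then show ?thesis by simp
  qed
  define p where "p x = (SOME s. s \<in> S \<and> x - s \<in> U)" for x
  have p: "p x \<in> S" "x - p x \<in> U" for x using someI_ex[OF ex[of x]] by (auto simp: p_def)
  have p_add: "p (x + y) = p x + p y" for x y
  proof (rule uniq[of _ "x + y"])
    show "p (x + y) \<in> S" "x + y - p (x + y) \<in> U" by (rule p)+
    show "p x + p y \<in> S" using p sS by (simp add: subspace_add)
    have "(x - p x) + (y - p y) \<in> U" using p sU by (simp add: subspace_add)
    then show "x + y - (p x + p y) \<in> U" by (simp add: algebra_simps)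
  qed
  have p_scale: "p (scale c x) = scale c (p x)" for c x
  proof (rule uniq[of _ "scale c x"])
    show "p (scale c x) \<in> S" "scale c x - p (scale c x) \<in> U" by (rule p)+
    show "scale c (p x) \<in> S" using p sS by (simp add: subspace_scale)
    have "scale c (x - p x) \<in> U" using p sU by (simp add: subspace_scale)
    then show "scale c x - scale c (p x) \<in> U" by (simp add: scale_right_diff_distrib)
  qed
  have p_S: "p x = x" if "x \<in> S" for x
    by (rule uniq[of _ x]) (use that p sU in \<open>auto simp: subspace_0\<close>)
  have p_U: "p x = 0" if "x \<in> U" for x
    by (rule uniq[of _ x]) (use that p sS in \<open>auto simp: subspace_0\<close>)
  define \<sigma> where "\<sigma> x = p x - (x - p x)" for x
  have lin: "linear_involution \<sigma>"
    unfolding linear_involution_def linear_self_iff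
  proof (intro conjI allI)
    show "\<sigma> (x + y) = \<sigma> x + \<sigma> y" for x y by (simp add: \<sigma>_def p_add algebra_simps)
    show "\<sigma> (scale c x) = scale c (\<sigma> x)" for c x
      by (simp add: \<sigma>_def p_scale scale_right_diff_distrib)
    fix x
    have "p (- (x - p x)) = 0" by (rule p_U) (use p sU in \<open>simp only: subspace_neg\<close>)
    moreover have "\<sigma> x = p x + - (x - p x)" by (simp add: \<sigma>_def)
    ultimately have "p (\<sigma> x) = p x" using p_S[OF p(1)] by (simp only: p_add add_0_right)
    then show "\<sigma> (\<sigma> x) = x" by (simp add: \<sigma>_def)
  qed
  have plus: "U_plus \<sigma> = S"
  proof
    show "S \<subseteq> U_plus \<sigma>" by (auto simp: U_plus_def \<sigma>_def p_S)
    show "U_plus \<sigma> \<subseteq> S"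
    proof
      fix x assume "x \<in> U_plus \<sigma>"
      then have "x - p x = - (x - p x)" by (simp add: U_plus_def \<sigma>_def algebra_simps)
      then have "x - p x = 0" by (rule eq_neg_zero)
      then show "x \<in> S" using p(1)[of x] by simp
    qed
  qed
  have inI: "\<sigma> \<in> Inv k" using lin plus S by (simp add: involutions_iff Gr_iff)
  have "U \<subseteq> U_minus \<sigma>" by (auto simp: U_minus_def \<sigma>_def p_U)
  then have "U = U_minus \<sigma>" using Gr_subset_eq[OF U involution_Gr(2)[OF inI]] by blast
  then show ?thesis using that inI plus by blast
qed

definition neg :: "('v \<Rightarrow> 'v) \<Rightarrow> 'v \<Rightarrow> 'v" where
  "neg \<sigma> = (\<lambda>x. - \<sigma> x)"

lemma neg_neg [simp]: "neg (neg \<sigma>) = \<sigma>"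
  by (simp add: neg_def)

lemma U_plus_neg [simp]: "U_plus (neg \<sigma>) = U_minus \<sigma>"
  by (auto simp: U_plus_def U_minus_def neg_def minus_equation_iff)

lemma U_minus_neg [simp]: "U_minus (neg \<sigma>) = U_plus \<sigma>"
  by (auto simp: U_plus_def U_minus_def neg_def)

lemma linear_involution_neg:
  assumes "linear_involution \<sigma>"
  shows "linear_involution (neg \<sigma>)"
  using linear_involution_simps[OF assms] by (simp add: linear_involution_def linear_self_iff neg_def)

lemma add_involution_U_plus: "linear_involution \<sigma> \<Longrightarrow> x + \<sigma> x \<in> U_plus \<sigma>"
  by (simp add: U_plus_def linear_involution_simps add.commute)

lemma neg_Inv: "\<sigma> \<in> Inv k \<Longrightarrow> neg \<sigma> \<in> Inv (dimension - k)"
  using involution_Gr(2)[of \<sigma> k] linear_involution_neg[of \<sigma>]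
  by (auto simp: involutions_iff Gr_iff)

lemma neg_Inv': "\<sigma> \<in> Inv (dimension - k) \<Longrightarrow> k \<le> dimension \<Longrightarrow> neg \<sigma> \<in> Inv k"
  using neg_Inv[of \<sigma> "dimension - k"] by simp

lemma adjacent_neg: "adjacent_involutions scale (neg \<sigma>) (neg \<sigma>') \<longleftrightarrow> adjacent_involutions scale \<sigma> \<sigma>'"
  unfolding adjacent_involutions_def by auto

text \<open>For \<open>x\<close> in the minus space of \<open>\<sigma>'\<close>, the vector
  \<open>x + \<sigma> x\<close> is fixed by both involutions, whereas commutativity makes
  \<open>\<sigma>'\<close> negate it. So it is zero and \<open>x\<close> is in the minus space of
  \<open>\<sigma>\<close>.\<close>

lemma commute_same_plus_eq:
  assumes l: "linear_involution \<sigma>" "linear_involution \<sigma>'" and c: "\<sigma> \<circ> \<sigma>' = \<sigma>' \<circ> \<sigma>"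
    and p: "U_plus \<sigma> = U_plus \<sigma>'"
  shows "\<sigma> = \<sigma>'"
proof -
  have comm: "\<sigma> (\<sigma>' x) = \<sigma>' (\<sigma> x)" for x using c by (metis comp_apply)
  have sub: "U_minus \<sigma>' \<subseteq> U_minus \<sigma>"
    if l: "linear_involution \<sigma>" "linear_involution \<sigma>'" and comm: "\<And>x. \<sigma> (\<sigma>' x) = \<sigma>' (\<sigma> x)"
      and p: "U_plus \<sigma> = U_plus \<sigma>'" for \<sigma> \<sigma>'
  proof
    fix x assume x: "x \<in> U_minus \<sigma>'"
    have "x + \<sigma> x \<in> U_plus \<sigma>'" using add_involution_U_plus[OF l(1)] p by blast
    moreover have "\<sigma>' (x + \<sigma> x) = - (x + \<sigma> x)"
      using x l comm[of x] by (simp add: U_minus_def linear_involution_simps)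
    ultimately have "x + \<sigma> x = - (x + \<sigma> x)" by (simp add: U_plus_def)
    then have "x + \<sigma> x = 0" by (rule eq_neg_zero)
    then show "x \<in> U_minus \<sigma>" by (simp add: U_minus_def eq_neg_iff_add_eq_0 add.commute)
  qed
  have "U_minus \<sigma> = U_minus \<sigma>'"
    using sub[OF l comm p] sub[OF l(2,1) comm[symmetric] p[symmetric]] by blast
  then show ?thesis using involution_eqI l p by blast
qed

section \<open>Moving inside a fibre\<close>

text \<open>A change by a map of rank at most one. If \<open>\<phi>\<close> kills the plus space and
  \<open>v\<close> lies in it, the result is again an involution with the same plus space.\<close>

definition transvect :: "('v \<Rightarrow> 'v) \<Rightarrow> ('v \<Rightarrow> 'a) \<Rightarrow> 'v \<Rightarrow> 'v \<Rightarrow> 'v" where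
  "transvect \<sigma> \<phi> v = (\<lambda>x. \<sigma> x + scale (\<phi> x) v)"

definition functional_killing :: "'v set \<Rightarrow> ('v \<Rightarrow> 'a) \<Rightarrow> bool" where
  "functional_killing S \<phi> \<longleftrightarrow> Vector_Spaces.linear scale (*) \<phi> \<and> (\<forall>x\<in>S. \<phi> x = 0)"

lemma transvect_Inv:
  assumes \<sigma>: "\<sigma> \<in> Inv k" and \<phi>: "functional_killing (U_plus \<sigma>) \<phi>" and v: "v \<in> U_plus \<sigma>"
  shows "transvect \<sigma> \<phi> v \<in> Inv k" "U_plus (transvect \<sigma> \<phi> v) = U_plus \<sigma>"
proof -
  have l: "linear_involution \<sigma>" using \<sigma> by (simp add: involutions_iff)
  have add: "\<phi> (x + y) = \<phi> x + \<phi> y" and sc: "\<phi> (scale c x) = c * \<phi> x" for x y c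
    using \<phi> by (auto simp: functional_killing_def functional_iff)
  have \<phi>v: "\<phi> v = 0" and \<sigma>v: "\<sigma> v = v" using \<phi> v by (auto simp: functional_killing_def U_plus_def)
  \<comment> \<open>\<open>x + \<sigma> x\<close> is fixed by \<open>\<sigma>\<close>, hence killed
    by \<open>\<phi>\<close>.\<close>
  have \<phi>\<sigma>: "\<phi> (\<sigma> x) = - \<phi> x" for x
  proof -
    have "x + \<sigma> x \<in> U_plus \<sigma>" by (rule add_involution_U_plus[OF l])
    then have "\<phi> x + \<phi> (\<sigma> x) = 0" using \<phi> add by (metis functional_killing_def)
    then show ?thesis by (simp add: eq_neg_iff_add_eq_0 add.commute)
  qed
  have lt: "linear_involution (transvect \<sigma> \<phi> v)"
    unfolding linear_involution_def linear_self_iff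
    using l by (auto simp: transvect_def linear_involution_simps add sc \<phi>\<sigma> \<phi>v \<sigma>v scale_left_distrib
        scale_right_distrib)
  have "U_plus (transvect \<sigma> \<phi> v) = U_plus \<sigma>"
  proof
    show "U_plus \<sigma> \<subseteq> U_plus (transvect \<sigma> \<phi> v)"
      using \<phi> by (auto simp: U_plus_def transvect_def functional_killing_def)
    show "U_plus (transvect \<sigma> \<phi> v) \<subseteq> U_plus \<sigma>"
    proof
      fix x assume "x \<in> U_plus (transvect \<sigma> \<phi> v)"
      then have e: "\<sigma> x + scale (\<phi> x) v = x" by (simp add: U_plus_def transvect_def)
      then have "\<phi> (\<sigma> x + scale (\<phi> x) v) = \<phi> x" by simp
      then have "\<phi> x = - \<phi> x" by (simp add: add sc \<phi>v \<phi>\<sigma>)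
      then have "2 * \<phi> x = 0" by (metis add.right_inverse mult_2)
      then have "\<phi> x = 0" using two_nz by simp
      then show "x \<in> U_plus \<sigma>" using e by (simp add: U_plus_def)
    qed
  qed
  then show "transvect \<sigma> \<phi> v \<in> Inv k" "U_plus (transvect \<sigma> \<phi> v) = U_plus \<sigma>"
    using lt \<sigma> by (auto simp: involutions_iff)
qed

lemma dim_functional_kernel:
  assumes "subspace U" "Vector_Spaces.linear scale (*) \<phi>" "w \<in> U" "\<phi> w \<noteq> 0"
  shows "Suc (dim {x\<in>U. \<phi> x = 0}) = dim U"
proof -
  have add: "\<phi> (x + y) = \<phi> x + \<phi> y" and sc: "\<phi> (scale c x) = c * \<phi> x" for x y c
    using assms by (auto simp: functional_iff)
  have "\<phi> 0 = 0" using sc[of 0 0] by simp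
  then have sK: "subspace {x\<in>U. \<phi> x = 0}"
    using assms(1) by (intro subspaceI) (auto simp: add sc subspace_0 subspace_add subspace_scale)
  have "w \<notin> {x\<in>U. \<phi> x = 0}" using assms by simp
  then have d: "dim (span (insert w {x\<in>U. \<phi> x = 0})) = Suc (dim {x\<in>U. \<phi> x = 0})"
    using Gr_span_insert[of "{x\<in>U. \<phi> x = 0}"] sK by (simp add: Gr_iff)
  have "span (insert w {x\<in>U. \<phi> x = 0}) = U"
  proof
    show "span (insert w {x\<in>U. \<phi> x = 0}) \<subseteq> U" using assms by (intro span_minimal) auto
    show "U \<subseteq> span (insert w {x\<in>U. \<phi> x = 0})"
    proof
      fix x assume x: "x \<in> U"
      let ?c = "\<phi> x / \<phi> w"
      have "x - scale ?c w \<in> U" using x assms by (simp add: subspace_diff subspace_scale)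
      moreover have "\<phi> (x - scale ?c w) = 0"
        using add[of "x - scale ?c w" "scale ?c w"] sc assms by simp
      ultimately show "x \<in> span (insert w {x\<in>U. \<phi> x = 0})"
        unfolding mem_span_insert_subspace[OF sK]
        by (intro exI[of _ ?c] bexI[of _ "x - scale ?c w"]) auto
    qed
  qed
  then show ?thesis using d by simp
qed

text \<open>The two minus spaces meet exactly in the kernel of \<open>\<phi>\<close> on the first
  one, and \<open>\<phi>\<close> does not vanish there because it already vanishes on the plus
  space.\<close>

lemma transvect_adjacent:
  assumes \<sigma>: "\<sigma> \<in> Inv k" and \<phi>: "functional_killing (U_plus \<sigma>) \<phi>" and v: "v \<in> U_plus \<sigma>"
    and nz: "\<phi> y \<noteq> 0" "v \<noteq> 0"
  shows "adjacent_involutions scale \<sigma> (transvect \<sigma> \<phi> v)"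
proof -
  let ?t = "transvect \<sigma> \<phi> v"
  note t = transvect_Inv[OF \<sigma> \<phi> v]
  have l: "linear_involution \<sigma>" "linear_involution ?t" using \<sigma> t by (simp_all add: involutions_iff)
  have lin: "Vector_Spaces.linear scale (*) \<phi>" using \<phi> by (simp add: functional_killing_def)
  obtain s u where su: "s \<in> U_plus \<sigma>" "u \<in> U_minus \<sigma>" "y = s + u" by (rule involution_decompose[OF l(1)])
  then have "\<phi> y = \<phi> u" using \<phi> lin by (simp add: functional_killing_def functional_iff)
  then have "\<phi> u \<noteq> 0" using nz by simp
  then have "Suc (dim {x\<in>U_minus \<sigma>. \<phi> x = 0}) = dim (U_minus \<sigma>)"
    using dim_functional_kernel[OF U_minus_subspace[OF l(1)] lin su(2)] by blast
  moreover have "U_minus \<sigma> \<inter> U_minus ?t = {x\<in>U_minus \<sigma>. \<phi> x = 0}"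
    using nz by (auto simp: U_minus_def transvect_def)
  moreover have "dim (U_minus \<sigma>) = dim (U_minus ?t)"
    using involution_Gr(2)[OF \<sigma>] involution_Gr(2)[OF t(1)] by (simp add: Gr_iff)
  ultimately have "adjacent_subspaces scale (U_minus \<sigma>) (U_minus ?t)"
    using U_minus_subspace l by (simp add: adjacent_subspaces_def)
  then show ?thesis using t by (simp add: adjacent_involutions_def)
qed

text \<open>The difference of two involutions with plus space \<open>S\<close> kills
  \<open>S\<close> and takes values in \<open>S\<close>. Expanded in a basis of \<open>S\<close> it
  becomes a sum of maps of rank at most one, which are added one after the other.\<close>

lemma fibre_induct:
  assumes \<sigma>0: "\<sigma>0 \<in> Inv k" "U_plus \<sigma>0 = S" and P0: "P \<sigma>0"
    and step: "\<And>\<sigma> \<phi> v. \<sigma> \<in> Inv k \<Longrightarrow> U_plus \<sigma> = S \<Longrightarrow> P \<sigma> \<Longrightarrow> functional_killing S \<phi> \<Longrightarrow>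
      \<exists>y. \<phi> y \<noteq> 0 \<Longrightarrow> v \<in> S \<Longrightarrow> v \<noteq> 0 \<Longrightarrow> P (transvect \<sigma> \<phi> v)"
    and \<sigma>': "\<sigma>' \<in> Inv k" "U_plus \<sigma>' = S"
  shows "P \<sigma>'"
proof -
  have l: "linear_involution \<sigma>0" "linear_involution \<sigma>'" using \<sigma>0 \<sigma>' by (simp_all add: involutions_iff)
  have sS: "subspace S" using U_plus_subspace[OF l(1)] \<sigma>0 by simp
  obtain B where B: "B \<subseteq> S" "independent B" "S \<subseteq> span B" using basis_exists[of S] by metis
  have finB: "finite B" using B finiteI_independent by blast
  have spB: "span B = S" using B sS by (metis span_subspace)
  define N where "N x = \<sigma>' x - \<sigma>0 x" for x
  \<comment> \<open>\<open>x + \<sigma>' x\<close> and \<open>x + \<sigma>0 x\<close> are both fixed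
    vectors and thus in \<open>S\<close>; their difference is \<open>N x\<close>.\<close>
  have NS: "N x \<in> S" for x
  proof -
    have "x + \<sigma>' x \<in> S" "x + \<sigma>0 x \<in> S"
      using add_involution_U_plus l \<sigma>0(2) \<sigma>'(2) by blast+
    then have "(x + \<sigma>' x) - (x + \<sigma>0 x) \<in> S" using sS subspace_diff by blast
    then show ?thesis by (simp add: N_def)
  qed
  have N0: "N x = 0" if "x \<in> S" for x
  proof -
    have "x \<in> U_plus \<sigma>0" "x \<in> U_plus \<sigma>'" using that \<sigma>0 \<sigma>' by auto
    then show ?thesis by (simp add: N_def U_plus_def)
  qed
  define \<phi> where "\<phi> b x = representation B (N x) b" for b x
  have NsB: "N x \<in> span B" for x using NS spB by simp
  have \<phi>: "functional_killing S (\<phi> b)" for b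
  proof -
    have "N (x + y) = N x + N y" "N (scale c x) = scale c (N x)" for x y c
      using l by (simp_all add: N_def linear_involution_simps scale_right_diff_distrib)
    then show ?thesis
      using representation_add[OF B(2) NsB NsB] representation_scale[OF B(2) NsB]
        N0 representation_zero[of B]
      by (simp add: functional_killing_def functional_iff \<phi>_def)
  qed
  define \<tau> where "\<tau> A x = \<sigma>0 x + (\<Sum>b\<in>A. scale (\<phi> b x) b)" for A x
  have main: "A \<subseteq> B \<longrightarrow> \<tau> A \<in> Inv k \<and> U_plus (\<tau> A) = S \<and> P (\<tau> A)" if "finite A" for A
    using that
  proof (induction A rule: finite_induct)
    case empty
    have "\<tau> {} = \<sigma>0" by (simp add: \<tau>_def fun_eq_iff)
    then show ?case using \<sigma>0 P0 by simp
  next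
    case (insert b A)
    show ?case
    proof
      assume A: "insert b A \<subseteq> B"
      then have IH: "\<tau> A \<in> Inv k" "U_plus (\<tau> A) = S" "P (\<tau> A)" using insert by auto
      have b: "b \<in> S" "b \<noteq> 0" using A B dependent_zero by auto
      have e: "\<tau> (insert b A) = transvect (\<tau> A) (\<phi> b) b"
        using insert by (simp add: \<tau>_def transvect_def fun_eq_iff ac_simps)
      have t: "transvect (\<tau> A) (\<phi> b) b \<in> Inv k" "U_plus (transvect (\<tau> A) (\<phi> b) b) = S"
        using transvect_Inv[OF IH(1)] IH(2) \<phi> b by auto
      have "P (transvect (\<tau> A) (\<phi> b) b)"
      proof (cases "\<exists>y. \<phi> b y \<noteq> 0")
        case True then show ?thesis using step IH \<phi> b by blast
      next
        case False
        then have "transvect (\<tau> A) (\<phi> b) b = \<tau> A" by (simp add: transvect_def fun_eq_iff)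
        then show ?thesis using IH by simp
      qed
      then show "\<tau> (insert b A) \<in> Inv k \<and> U_plus (\<tau> (insert b A)) = S \<and> P (\<tau> (insert b A))"
        using t unfolding e by blast
    qed
  qed
  have "\<tau> B x = \<sigma>' x" for x
  proof -
    have "(\<Sum>b\<in>B. scale (\<phi> b x) b) = N x"
      unfolding \<phi>_def by (rule sum_representation_eq[OF B(2) NsB finB order_refl])
    then show ?thesis by (simp add: \<tau>_def N_def)
  qed
  then have "\<tau> B = \<sigma>'" by blast
  then show ?thesis using main[OF finB] by simp
qed

text \<open>If \<open>c\<close> shared its minus space with \<open>a\<close> instead, the edge from
  \<open>b\<close> to \<open>c\<close> would make one of the three pairs agree in both eigenspaces,
  and adjacency excludes this.\<close>

lemma adjacent_triangle:
  assumes "adjacent_involutions scale a b" "adjacent_involutions scale a c" "adjacent_involutions scale b c"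
    and "U_plus a = U_plus b"
  shows "U_plus a = U_plus c"
proof -
  have irr: "\<not> adjacent_subspaces scale X X" for X by (simp add: adjacent_subspaces_def)
  show ?thesis using assms irr unfolding adjacent_involutions_def by metis
qed

lemma adjacent_not_both:
  "adjacent_involutions scale a b \<Longrightarrow> (U_plus a = U_plus b) \<noteq> (U_minus a = U_minus b)"
  by (auto simp: adjacent_involutions_def adjacent_subspaces_def)

lemma adjacent_commute: "adjacent_involutions scale a b \<longleftrightarrow> adjacent_involutions scale b a"
  by (auto simp: adjacent_involutions_def adjacent_subspaces_def Int_commute)

text \<open>Two edges of the fibre at \<open>\<sigma>\<close> are joined by a chain of triangles, and the image of a triangle
  has a constant eigenspace.\<close>

lemma plus_fibre_image:
  assumes pres: "\<And>\<sigma> \<sigma>'. \<sigma> \<in> Inv k \<Longrightarrow> \<sigma>' \<in> Inv k \<Longrightarrow> adjacent_involutions scale \<sigma> \<sigma>' \<Longrightarrow>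
      adjacent_involutions scale (F \<sigma>) (F \<sigma>')"
  shows "(\<forall>\<sigma>\<in>Inv k. \<forall>\<sigma>'\<in>Inv k. U_plus \<sigma> = S \<longrightarrow> U_plus \<sigma>' = S \<longrightarrow> U_plus (F \<sigma>) = U_plus (F \<sigma>')) \<or>
    (\<forall>\<sigma>\<in>Inv k. \<forall>\<sigma>'\<in>Inv k. U_plus \<sigma> = S \<longrightarrow> U_plus \<sigma>' = S \<longrightarrow> U_minus (F \<sigma>) = U_minus (F \<sigma>'))"
proof (cases "\<exists>\<sigma>\<in>Inv k. U_plus \<sigma> = S")
  case False then show ?thesis by blast
next
  case True
  then obtain \<sigma>0 where \<sigma>0: "\<sigma>0 \<in> Inv k" "U_plus \<sigma>0 = S" by blast
  define ok where "ok \<phi> v \<longleftrightarrow> functional_killing S \<phi> \<and> (\<exists>y. \<phi> y \<noteq> 0) \<and> v \<in> S \<and> v \<noteq> 0" for \<phi> v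
  define in_fib where "in_fib \<sigma> \<longleftrightarrow> \<sigma> \<in> Inv k \<and> U_plus \<sigma> = S" for \<sigma>
  \<comment> \<open>The type of an edge at \<open>\<sigma>\<close>: whether its image keeps the plus
    space. Otherwise the image keeps the minus space.\<close>
  define T where "T \<sigma> \<phi> v \<longleftrightarrow> U_plus (F \<sigma>) = U_plus (F (transvect \<sigma> \<phi> v))" for \<sigma> \<phi> v
  have fib: "in_fib (transvect \<sigma> \<phi> v)" if "in_fib \<sigma>" "ok \<phi> v" for \<sigma> \<phi> v
    using that transvect_Inv[of \<sigma> k \<phi> v] by (auto simp: in_fib_def ok_def)
  have adj_t: "adjacent_involutions scale \<sigma> (transvect \<sigma> \<phi> v)" if "in_fib \<sigma>" "ok \<phi> v" for \<sigma> \<phi> v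
    using that transvect_adjacent[of \<sigma> k \<phi> v] by (auto simp: in_fib_def ok_def)
  have adjF: "adjacent_involutions scale (F \<sigma>) (F (transvect \<sigma> \<phi> v))" if "in_fib \<sigma>" "ok \<phi> v" for \<sigma> \<phi> v
    using that pres adj_t fib by (auto simp: in_fib_def)
  have sS: "subspace S" using \<sigma>0 involution_Gr(1)[OF \<sigma>0(1)] by (simp add: Gr_iff)
  have fk: "functional_killing S (\<lambda>x. \<psi> x - \<phi> x)"
    if "functional_killing S \<phi>" "functional_killing S \<psi>" for \<phi> \<psi>
    using that by (simp add: functional_killing_def functional_iff right_diff_distrib)
  have Tv: "T \<sigma> \<phi> v \<longleftrightarrow> T \<sigma> \<phi> w" if s: "in_fib \<sigma>" and o: "ok \<phi> v" "ok \<phi> w" for \<sigma> \<phi> v w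
  proof (cases "v = w")
    case False
    \<comment> \<open>The two neighbours of \<open>\<sigma>\<close> are themselves joined by a
      transvection, so the three form a triangle and the two edges have the same type.\<close>
    have e: "transvect \<sigma> \<phi> w = transvect (transvect \<sigma> \<phi> v) \<phi> (w - v)"
      by (simp add: transvect_def fun_eq_iff scale_right_diff_distrib)
    have "ok \<phi> (w - v)" using o False sS by (auto simp: ok_def subspace_diff)
    then have "adjacent_involutions scale (F (transvect \<sigma> \<phi> v)) (F (transvect \<sigma> \<phi> w))"
      unfolding e using adjF fib s o by blast
    then show ?thesis unfolding T_def
      using adjacent_triangle adjF[OF s o(1)] adjF[OF s o(2)] adjacent_commute by metis
  qed simp
  have T\<phi>: "T \<sigma> \<phi> v \<longleftrightarrow> T \<sigma> \<psi> v" if s: "in_fib \<sigma>" and o: "ok \<phi> v" "ok \<psi> v" for \<sigma> \<phi> \<psi> v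
  proof (cases "\<phi> = \<psi>")
    case False
    have e: "transvect \<sigma> \<psi> v = transvect (transvect \<sigma> \<phi> v) (\<lambda>x. \<psi> x - \<phi> x) v"
      by (simp add: transvect_def fun_eq_iff scale_left_diff_distrib)
    have "\<exists>y. \<psi> y - \<phi> y \<noteq> 0" using False by (metis ext eq_iff_diff_eq_0)
    then have "ok (\<lambda>x. \<psi> x - \<phi> x) v" using o fk by (auto simp: ok_def)
    then have "adjacent_involutions scale (F (transvect \<sigma> \<phi> v)) (F (transvect \<sigma> \<psi> v))"
      unfolding e using adjF fib s o by blast
    then show ?thesis unfolding T_def
      using adjacent_triangle adjF[OF s o(1)] adjF[OF s o(2)] adjacent_commute by metis
  qed simp
  have Tall: "T \<sigma> \<phi> v \<longleftrightarrow> T \<sigma> \<psi> w" if s: "in_fib \<sigma>" and o: "ok \<phi> v" "ok \<psi> w" for \<sigma> \<phi> \<psi> v w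
  proof -
    have "ok \<phi> w" using o by (simp add: ok_def)
    then show ?thesis using Tv[OF s o(1)] T\<phi>[OF s _ o(2)] by blast
  qed
  \<comment> \<open>The same edge seen from its other end is the transvection with
    \<open>-\<phi>\<close>; so the common type of the edges at \<open>\<sigma>\<close> passes on to
    its neighbour.\<close>
  have Tstep: "T (transvect \<sigma> \<phi> v) \<psi> w \<longleftrightarrow> T \<sigma> \<phi> v"
    if s: "in_fib \<sigma>" and o: "ok \<phi> v" "ok \<psi> w" for \<sigma> \<phi> \<psi> v w
  proof -
    have "functional_killing S (\<lambda>x. 0 - \<phi> x)"
      using o by (intro fk) (auto simp: ok_def functional_killing_def functional_iff)
    then have n: "ok (\<lambda>x. - \<phi> x) v" using o by (simp add: ok_def)
    have "transvect (transvect \<sigma> \<phi> v) (\<lambda>x. - \<phi> x) v = \<sigma>" by (simp add: transvect_def)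
    then have "T (transvect \<sigma> \<phi> v) (\<lambda>x. - \<phi> x) v \<longleftrightarrow> T \<sigma> \<phi> v" by (auto simp: T_def)
    then show ?thesis using Tall[OF fib[OF s o(1)] o(2) n] by blast
  qed
  \<comment> \<open>The common type of all edges in the fibre. If no admissible pair exists,
    \<open>t\<close> is false, and this is consistent since there is then no edge to be
    tested.\<close>
  define t where "t \<longleftrightarrow> (\<exists>\<phi> v. ok \<phi> v \<and> T \<sigma>0 \<phi> v)"
  define P where "P \<sigma> \<longleftrightarrow> (\<forall>\<phi> v. ok \<phi> v \<longrightarrow> T \<sigma> \<phi> v = t) \<and>
    (if t then U_plus (F \<sigma>) = U_plus (F \<sigma>0) else U_minus (F \<sigma>) = U_minus (F \<sigma>0))" for \<sigma>
  have f0: "in_fib \<sigma>0" using \<sigma>0 by (simp add: in_fib_def)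
  have "T \<sigma>0 \<phi> v = t" if o: "ok \<phi> v" for \<phi> v
  proof
    assume "T \<sigma>0 \<phi> v"
    then show t unfolding t_def using o by (intro exI conjI)
  next
    assume t
    then obtain \<phi>' v' where o': "ok \<phi>' v'" "T \<sigma>0 \<phi>' v'" unfolding t_def by (elim exE conjE)
    then show "T \<sigma>0 \<phi> v" using Tall[OF f0 o'(1) o] by simp
  qed
  then have P0: "P \<sigma>0" unfolding P_def by simp
  have all: "P \<sigma>" if "\<sigma> \<in> Inv k" "U_plus \<sigma> = S" for \<sigma>
  proof (rule fibre_induct[where P = P and k = k and S = S, OF \<sigma>0 P0 _ that])
    fix \<sigma> \<phi> v
    assume h: "\<sigma> \<in> Inv k" "U_plus \<sigma> = S" "P \<sigma>" "functional_killing S \<phi>" "\<exists>y. \<phi> y \<noteq> 0" "v \<in> S" "v \<noteq> 0"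
    then have s: "in_fib \<sigma>" and o: "ok \<phi> v" by (auto simp: in_fib_def ok_def)
    have Tt: "T \<sigma> \<phi> v = t" using h(3) o by (simp add: P_def)
    have "(if t then U_plus (F (transvect \<sigma> \<phi> v)) = U_plus (F \<sigma>0)
        else U_minus (F (transvect \<sigma> \<phi> v)) = U_minus (F \<sigma>0))"
    proof (cases t)
      case True
      then have "U_plus (F \<sigma>) = U_plus (F (transvect \<sigma> \<phi> v))" using Tt by (simp add: T_def)
      moreover have "U_plus (F \<sigma>) = U_plus (F \<sigma>0)" using h(3) True by (simp add: P_def)
      ultimately show ?thesis using True by simp
    next
      case False
      then have "U_plus (F \<sigma>) \<noteq> U_plus (F (transvect \<sigma> \<phi> v))" using Tt by (simp add: T_def)
      then have "U_minus (F \<sigma>) = U_minus (F (transvect \<sigma> \<phi> v))"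
        using adjacent_not_both[OF adjF[OF s o]] by blast
      moreover have "U_minus (F \<sigma>) = U_minus (F \<sigma>0)" using h(3) False by (simp add: P_def)
      ultimately show ?thesis using False by simp
    qed
    then show "P (transvect \<sigma> \<phi> v)" unfolding P_def using Tstep[OF s o] Tt by blast
  qed
  show ?thesis
  proof (cases t)
    case True then show ?thesis using all unfolding P_def by metis
  next
    case False then show ?thesis using all unfolding P_def by metis
  qed
qed

text \<open>Negation of the argument exchanges the eigenspaces and keeps adjacency, so this is the
  preceding case for \<open>dimension - k\<close>.\<close>

lemma minus_fibre_image:
  assumes pres: "\<And>\<sigma> \<sigma>'. \<sigma> \<in> Inv k \<Longrightarrow> \<sigma>' \<in> Inv k \<Longrightarrow> adjacent_involutions scale \<sigma> \<sigma>' \<Longrightarrow>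
      adjacent_involutions scale (F \<sigma>) (F \<sigma>')"
    and k: "k \<le> dimension"
  shows "(\<forall>\<sigma>\<in>Inv k. \<forall>\<sigma>'\<in>Inv k. U_minus \<sigma> = U \<longrightarrow> U_minus \<sigma>' = U \<longrightarrow> U_plus (F \<sigma>) = U_plus (F \<sigma>')) \<or>
    (\<forall>\<sigma>\<in>Inv k. \<forall>\<sigma>'\<in>Inv k. U_minus \<sigma> = U \<longrightarrow> U_minus \<sigma>' = U \<longrightarrow> U_minus (F \<sigma>) = U_minus (F \<sigma>'))"
proof -
  let ?F = "\<lambda>\<sigma>. F (neg \<sigma>)"
  have "adjacent_involutions scale (?F \<sigma>) (?F \<sigma>')"
    if "\<sigma> \<in> Inv (dimension - k)" "\<sigma>' \<in> Inv (dimension - k)" "adjacent_involutions scale \<sigma> \<sigma>'" for \<sigma> \<sigma>'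
    using that pres neg_Inv' k adjacent_neg by blast
  note d = plus_fibre_image[of "dimension - k" ?F U, OF this]
  have *: "Q (F \<sigma>) = Q (F \<sigma>')"
    if h: "\<forall>\<sigma>\<in>Inv (dimension - k). \<forall>\<sigma>'\<in>Inv (dimension - k).
        U_plus \<sigma> = U \<longrightarrow> U_plus \<sigma>' = U \<longrightarrow> Q (?F \<sigma>) = Q (?F \<sigma>')"
      and s: "\<sigma> \<in> Inv k" "\<sigma>' \<in> Inv k" "U_minus \<sigma> = U" "U_minus \<sigma>' = U"
    for Q :: "('v \<Rightarrow> 'v) \<Rightarrow> 'v set" and \<sigma> \<sigma>'
    using h[rule_format, OF neg_Inv[OF s(1)] neg_Inv[OF s(2)]] s(3,4) by simp
  from d show ?thesis
  proof
    assume h: "\<forall>\<sigma>\<in>Inv (dimension - k). \<forall>\<sigma>'\<in>Inv (dimension - k).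
        U_plus \<sigma> = U \<longrightarrow> U_plus \<sigma>' = U \<longrightarrow> U_plus (?F \<sigma>) = U_plus (?F \<sigma>')"
    show ?thesis by (rule disjI1) (intro ballI impI, rule *[OF h])
  next
    assume h: "\<forall>\<sigma>\<in>Inv (dimension - k). \<forall>\<sigma>'\<in>Inv (dimension - k).
        U_plus \<sigma> = U \<longrightarrow> U_plus \<sigma>' = U \<longrightarrow> U_minus (?F \<sigma>) = U_minus (?F \<sigma>')"
    show ?thesis by (rule disjI2) (intro ballI impI, rule *[OF h])
  qed
qed

end

text \<open>Here \<open>A x y\<close> and \<open>B x y\<close> stand for the eigenspaces of the
  image of the involution with \<open>x\<close> on the plus side and \<open>y\<close> on the minus
  side. Row \<open>p\<close> and column \<open>q\<close> are constant in \<open>A\<close>. Then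
  \<open>swap\<close> keeps row \<open>r\<close> and column \<open>s\<close> from being constant in
  \<open>A\<close>, so they are constant in \<open>B\<close>; the entries at \<open>(r, q)\<close>
  and \<open>(p, s)\<close> then agree in both respects.\<close>

lemma four_points_types:
  fixes A B :: "'i \<Rightarrow> 'i \<Rightarrow> 'c"
  assumes dist: "distinct [p, q, r, s]"
    and row: "\<And>x. x \<in> {p,q,r,s} \<Longrightarrow>
      (\<forall>y\<in>{p,q,r,s}-{x}. \<forall>z\<in>{p,q,r,s}-{x}. A x y = A x z) \<or>
      (\<forall>y\<in>{p,q,r,s}-{x}. \<forall>z\<in>{p,q,r,s}-{x}. B x y = B x z)"
    and col: "\<And>y. y \<in> {p,q,r,s} \<Longrightarrow>
      (\<forall>x\<in>{p,q,r,s}-{y}. \<forall>z\<in>{p,q,r,s}-{y}. A x y = A z y) \<or>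
      (\<forall>x\<in>{p,q,r,s}-{y}. \<forall>z\<in>{p,q,r,s}-{y}. B x y = B z y)"
    and inj: "\<lbrakk>A r q = A p s; B r q = B p s\<rbrakk> \<Longrightarrow> False"
    and swap: "\<And>x y. x \<in> {p,q,r,s} \<Longrightarrow> y \<in> {p,q,r,s} \<Longrightarrow> x \<noteq> y \<Longrightarrow> A x y \<noteq> A y x"
    and rowp: "\<forall>y\<in>{p,q,r,s}-{p}. \<forall>z\<in>{p,q,r,s}-{p}. A p y = A p z"
    and colq: "\<forall>x\<in>{p,q,r,s}-{q}. \<forall>z\<in>{p,q,r,s}-{q}. A x q = A z q"
  shows False
proof -
  let ?Q = "{p, q, r, s}"
  have ne: "p \<noteq> q" "p \<noteq> r" "p \<noteq> s" "q \<noteq> r" "q \<noteq> s" "r \<noteq> s" using dist by auto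
  have mem: "p \<in> ?Q" "q \<in> ?Q" "r \<in> ?Q" "s \<in> ?Q" by auto
  have 1: "A r q = A p q" "A p r = A p q" "A p s = A p q"
    using rowp[rule_format, of r q] rowp[rule_format, of s q] colq[rule_format, of r p] ne by auto
  \<comment> \<open>\<open>A p r = A p q = A r q\<close>, whereas
    \<open>A r p \<noteq> A p r\<close>.\<close>
  have r1: "A r p \<noteq> A r q" using swap[of r p] ne mem 1 by metis
  have "p \<in> ?Q - {r}" "q \<in> ?Q - {r}" "s \<in> ?Q - {r}" using ne by auto
  then have "B r q = B r s" using row[OF mem(3)] r1 by blast
  moreover have s1: "A q s \<noteq> A p s" using swap[of q s] rowp colq ne mem 1
    by (metis Diff_iff empty_iff insert_iff)
  have "p \<in> ?Q - {s}" "q \<in> ?Q - {s}" "r \<in> ?Q - {s}" using ne by auto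
  then have "B p s = B r s" using col[OF mem(4)] s1 by blast
  ultimately show False using inj 1 by simp
qed

section \<open>Types of fibres and duality\<close>

context involution_space
begin

section \<open>The kinds of the two fibres through an involution\<close>

text \<open>\<open>E\<close> says which eigenspace is fixed in the fibre, \<open>D\<close> which one
  is constant on its image; both range over \<open>U_plus\<close> and
  \<open>U_minus\<close>.\<close>

definition const_on :: "nat \<Rightarrow> (('v \<Rightarrow> 'v) \<Rightarrow> 'v set) \<Rightarrow> (('v \<Rightarrow> 'v) \<Rightarrow> 'v set) \<Rightarrow>
    (('v \<Rightarrow> 'v) \<Rightarrow> ('v \<Rightarrow> 'v)) \<Rightarrow> 'v set \<Rightarrow> bool" where
  "const_on k E D F X \<longleftrightarrow>
    (\<forall>\<sigma>\<in>Inv k. \<forall>\<sigma>'\<in>Inv k. E \<sigma> = X \<longrightarrow> E \<sigma>' = X \<longrightarrow> D (F \<sigma>) = D (F \<sigma>'))"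

lemma const_onD:
  assumes "const_on k E D F X" "\<sigma> \<in> Inv k" "\<sigma>' \<in> Inv k" "E \<sigma> = X" "E \<sigma>' = X"
  shows "D (F \<sigma>) = D (F \<sigma>')"
  by (rule assms(1)[unfolded const_on_def, rule_format, OF assms(2-5)])

lemma const_onI:
  assumes "\<And>\<sigma> \<sigma>'. \<sigma> \<in> Inv k \<Longrightarrow> \<sigma>' \<in> Inv k \<Longrightarrow> E \<sigma> = X \<Longrightarrow> E \<sigma>' = X \<Longrightarrow> D (F \<sigma>) = D (F \<sigma>')"
  shows "const_on k E D F X"
  unfolding const_on_def by (intro ballI impI) (rule assms)

lemma scale_two: "scale 2 x = x + x"
  by (metis one_add_one scale_left_distrib scale_one)

text \<open>The two spans have at most the stated dimensions, and together they span everything, so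
  the bounds are attained and the intersection is zero.\<close>

lemma span_pair_Gr:
  assumes S1: "S1 \<in> Gr a" and U1: "U1 \<in> Gr b" and ab: "Suc a + Suc b = dimension"
    and sp: "span (insert x (insert y (S1 \<union> U1))) = UNIV"
  shows "span (insert x S1) \<in> Gr (Suc a)" "span (insert y U1) \<in> Gr (Suc b)"
    "span (insert x S1) \<inter> span (insert y U1) = {0}"
proof -
  let ?S = "span (insert x S1)" and ?U = "span (insert y U1)"
  have dS: "dim ?S \<le> Suc a" and dU: "dim ?U \<le> Suc b"
    using S1 U1 by (auto simp: dim_insert Gr_iff)
  have "insert x (insert y (S1 \<union> U1)) \<subseteq> ?S \<union> ?U" by (auto intro: span_base)
  then have "span (?S \<union> ?U) = UNIV" using sp span_mono by blast
  then have "dim (?S \<union> ?U) = dimension" by (simp add: dim_eq_full)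
  then have e: "dimension + dim (?S \<inter> ?U) = dim ?S + dim ?U"
    using dim_Un_Int[of ?S ?U] by simp
  then have d: "dim ?S = Suc a" "dim ?U = Suc b" "dim (?S \<inter> ?U) = 0" using dS dU ab by linarith+
  then show "?S \<in> Gr (Suc a)" "?U \<in> Gr (Suc b)" unfolding Gr_iff by auto
  have "?S \<inter> ?U \<subseteq> {0}" using d(3) by simp
  then show "?S \<inter> ?U = {0}" by (auto simp: span_zero)
qed

lemma span_pair_change:
  assumes "span (insert p (insert q R)) = UNIV" "p \<in> span {x, y}" "q \<in> span {x, y}"
  shows "span (insert x (insert y R)) = UNIV"
proof -
  have "span {x, y} \<subseteq> span (insert x (insert y R))" by (rule span_mono) auto
  then have "insert p (insert q R) \<subseteq> span (insert x (insert y R))"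
    using assms(2,3) by (auto intro: span_base)
  then have "span (insert p (insert q R)) \<subseteq> span (insert x (insert y R))"
    by (rule span_minimal) simp
  then show ?thesis using assms(1) by blast
qed

text \<open>The involutions exchanging the roles of the lines \<open>x\<close> and \<open>y\<close> commute, so their images cannot
  share an eigenspace. Applied to the four points \<open>p\<close>, \<open>q\<close>, \<open>p + q\<close>, \<open>p - q\<close> of a projective line this
  separates the types of the two fibres through an involution.\<close>

lemma fibres_not_both_plus:
  assumes pres: "\<And>\<sigma> \<sigma>'. \<sigma> \<in> Inv k \<Longrightarrow> \<sigma>' \<in> Inv k \<Longrightarrow> adjacent_involutions scale \<sigma> \<sigma>' \<Longrightarrow>
      adjacent_involutions scale (F \<sigma>) (F \<sigma>')"
    and lin: "\<And>\<sigma>. \<sigma> \<in> Inv k \<Longrightarrow> linear_involution (F \<sigma>)" and inj: "inj_on F (Inv k)"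
    and comm: "\<And>\<sigma> \<sigma>'. \<sigma> \<in> Inv k \<Longrightarrow> \<sigma>' \<in> Inv k \<Longrightarrow> \<sigma> \<circ> \<sigma>' = \<sigma>' \<circ> \<sigma> \<Longrightarrow> F \<sigma> \<circ> F \<sigma>' = F \<sigma>' \<circ> F \<sigma>"
    and k: "1 \<le> k" "k < dimension"
    and S: "S \<in> Gr k" and U: "U \<in> Gr (dimension - k)" and SU: "S \<inter> U = {0}"
    and cS: "const_on k U_plus U_plus F S" and cU: "const_on k U_minus U_plus F U"
  shows False
proof -
  obtain a where a: "k = Suc a" using k by (cases k) auto
  obtain b where b: "dimension - k = Suc b" using k by (cases "dimension - k") auto
  have ab: "Suc a + Suc b = dimension" using a b k by simp
  obtain p where p: "p \<in> S" "p \<noteq> 0" using Gr_Suc_nonzero S a by blast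
  obtain S1 where S1: "S1 \<in> Gr a" "p \<notin> S1" "S = span (insert p S1)"
    by (rule Gr_Suc_decompose[OF _ p, of a]) (use S a in auto)
  obtain q where q: "q \<in> U" "q \<noteq> 0" using Gr_Suc_nonzero U b by metis
  obtain U1 where U1: "U1 \<in> Gr b" "q \<notin> U1" "U = span (insert q U1)"
    by (rule Gr_Suc_decompose[OF _ q, of b]) (use U b in auto)
  define R where "R = S1 \<union> U1"
  \<comment> \<open>\<open>S1\<close> and \<open>U1\<close> stay fixed on the two sides; a good pair
    distributes its two vectors over them to give complementary spaces.\<close>
  define good where "good x y \<longleftrightarrow> span (insert x (insert y R)) = UNIV" for x y
  have good_pq: "good p q"
  proof -
    have "S \<subseteq> span (insert p (insert q R))" unfolding S1(3) by (rule span_mono) (auto simp: R_def)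
    moreover have "U \<subseteq> span (insert p (insert q R))" unfolding U1(3) by (rule span_mono) (auto simp: R_def)
    ultimately have "span (S \<union> U) \<subseteq> span (insert p (insert q R))" by (intro span_minimal) auto
    then show ?thesis using complement_span[OF S U _ SU] k by (auto simp: good_def)
  qed
  have good_sym: "good x y \<Longrightarrow> good y x" for x y by (simp add: good_def insert_commute)
  have good_ch: "good x y" if "p \<in> span {x, y}" "q \<in> span {x, y}" for x y
    using span_pair_change[of p q R x y] good_pq that by (simp add: good_def)
  have gGr: "span (insert x S1) \<in> Gr k" "span (insert y U1) \<in> Gr (dimension - k)"
    "span (insert x S1) \<inter> span (insert y U1) = {0}" if "good x y" for x y
    using span_pair_Gr[OF S1(1) U1(1) ab, of x y] that a b by (auto simp: good_def R_def)
  have good_ne: "span (insert x S1) \<noteq> span (insert y S1)" if g: "good x y" for x y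
  proof
    assume e: "span (insert x S1) = span (insert y S1)"
    have "y \<in> span (insert y S1)" "y \<in> span (insert y U1)" by (auto intro: span_base)
    then have "y = 0" using gGr(3)[OF g] e by blast
    then have "span (insert y S1) = S1" using S1 by (simp add: Gr_iff span_eq_iff[THEN iffD2])
    then show False using gGr(1)[OF good_sym[OF g]] S1(1) a by (simp add: Gr_iff)
  qed
  define \<iota> where "\<iota> x y = (SOME \<sigma>. \<sigma> \<in> Inv k \<and> U_plus \<sigma> = span (insert x S1) \<and> U_minus \<sigma> = span (insert y U1))"
    for x y
  have \<iota>: "\<iota> x y \<in> Inv k" "U_plus (\<iota> x y) = span (insert x S1)" "U_minus (\<iota> x y) = span (insert y U1)"
    if g: "good x y" for x y
  proof -
    obtain \<sigma> where "\<sigma> \<in> Inv k" "U_plus \<sigma> = span (insert x S1)" "U_minus \<sigma> = span (insert y U1)"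
      using involution_exists[OF gGr(1,2)[OF g] _ gGr(3)[OF g]] k by auto
    then have "\<exists>\<sigma>. \<sigma> \<in> Inv k \<and> U_plus \<sigma> = span (insert x S1) \<and> U_minus \<sigma> = span (insert y U1)" by blast
    from someI_ex[OF this] show "\<iota> x y \<in> Inv k" "U_plus (\<iota> x y) = span (insert x S1)"
      "U_minus (\<iota> x y) = span (insert y U1)" by (simp_all add: \<iota>_def)
  qed
  have \<iota>_comm: "\<iota> x y \<circ> \<iota> y x = \<iota> y x \<circ> \<iota> x y" if g: "good x y" for x y
  proof -
    let ?s = "\<iota> x y" and ?t = "\<iota> y x"
    note gi = \<iota>[OF g] and gt = \<iota>[OF good_sym[OF g]]
    have l: "linear_involution ?s" "linear_involution ?t" using gi gt by (simp_all add: involutions_iff)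
    have mem: "v \<in> U_plus ?s" if "v \<in> insert x S1" for v using gi that by (simp add: span_base)
    have mem': "v \<in> U_minus ?s" if "v \<in> insert y U1" for v using gi that by (simp add: span_base)
    have memt: "v \<in> U_plus ?t" if "v \<in> insert y S1" for v using gt that by (simp add: span_base)
    have memt': "v \<in> U_minus ?t" if "v \<in> insert x U1" for v using gt that by (simp add: span_base)
    \<comment> \<open>It suffices to compare the products on \<open>x\<close>, \<open>y\<close>,
      \<open>S1\<close> and \<open>U1\<close>, where each of the two involutions acts by a
      sign.\<close>
    have sub: "subspace {v. ?s (?t v) = ?t (?s v)}"
      using l by (intro subspaceI) (auto simp: linear_involution_simps)
    have "insert x (insert y R) \<subseteq> {v. ?s (?t v) = ?t (?s v)}"
    proof
      fix v assume "v \<in> insert x (insert y R)"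
      then consider "v = x" | "v = y" | "v \<in> S1" | "v \<in> U1" by (auto simp: R_def)
      then have "(v \<in> U_plus ?s \<or> v \<in> U_minus ?s) \<and> (v \<in> U_plus ?t \<or> v \<in> U_minus ?t)"
        by cases (use mem mem' memt memt' in auto)
      then show "v \<in> {v. ?s (?t v) = ?t (?s v)}"
        using l by (auto simp: U_plus_def U_minus_def linear_involution_simps)
    qed
    from span_minimal[OF this sub] g show ?thesis
      by (auto simp: good_def fun_eq_iff)
  qed
  define Q where "Q = {p, q, p + q, p - q}"
  have good_Q: "good x y" if "x \<in> Q" "y \<in> Q" "x \<noteq> y" for x y
  proof -
    have s: "u \<in> span {u, v}" "v \<in> span {u, v}" for u v by (auto intro: span_base)
    have "(p + q) - p \<in> span {p, p + q}" by (rule span_diff[OF s(2) s(1)])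
    then have 1: "good p (p + q)" by (intro good_ch s) simp
    have "p - (p - q) \<in> span {p, p - q}" by (rule span_diff[OF s(1) s(2)])
    then have 2: "good p (p - q)" by (intro good_ch s) simp
    have "(p + q) - q \<in> span {q, p + q}" by (rule span_diff[OF s(2) s(1)])
    then have 3: "good q (p + q)" by (intro good_ch s) simp
    have "(p - q) + q \<in> span {q, p - q}" by (rule span_add[OF s(2) s(1)])
    then have 4: "good q (p - q)" by (intro good_ch s) simp
    \<comment> \<open>Sum and difference are \<open>2 p\<close> and \<open>2 q\<close>; division by
      two recovers \<open>p\<close> and \<open>q\<close>.\<close>
    have 5: "good (p + q) (p - q)"
    proof -
      let ?W = "span {p + q, p - q}"
      have "(p + q) + (p - q) \<in> ?W" by (rule span_add[OF s])
      moreover have "(p + q) + (p - q) = scale 2 p" by (simp add: scale_two)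
      ultimately have a: "scale 2 p \<in> ?W" by simp
      have "(p + q) - (p - q) \<in> ?W" by (rule span_diff[OF s])
      moreover have "(p + q) - (p - q) = scale 2 q" by (simp add: scale_two)
      ultimately have b: "scale 2 q \<in> ?W" by simp
      show ?thesis
        using span_scale[OF a, of "1/2"] span_scale[OF b, of "1/2"] two_nz by (intro good_ch) simp_all
    qed
    show ?thesis using that good_pq 1 2 3 4 5 good_sym unfolding Q_def by blast
  qed
  have goodne: "x \<noteq> y" if "good x y" for x y using good_ne[OF that] by blast
  have dist: "distinct [p, q, p + q, p - q]"
  proof -
    have "p \<noteq> q" using goodne[OF good_pq] .
    moreover have "p \<noteq> p + q" "q \<noteq> p + q" "p \<noteq> p - q" using p q by auto
    moreover have "q \<noteq> p - q"
    proof
      assume "q = p - q"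
      then have "p = scale 2 q" by (metis diff_eq_eq one_add_one scale_left_distrib scale_one)
      then have "p \<in> S \<inter> U" using p q U by (simp add: Gr_iff subspace_scale)
      then show False using SU p by blast
    qed
    moreover have "p + q \<noteq> p - q"
    proof
      assume "p + q = p - q"
      then have "q = - q" by (metis add_left_cancel diff_conv_add_uminus)
      then show False using eq_neg_zero q by blast
    qed
    ultimately show ?thesis by simp
  qed
  define A where "A x y = U_plus (F (\<iota> x y))" for x y
  define B where "B x y = U_minus (F (\<iota> x y))" for x y
  \<comment> \<open>The involutions have different plus spaces, so injectivity keeps their images
    apart.\<close>
  have Fneq: False if "x \<in> Q" "x' \<in> Q" "x \<noteq> x'" "good x y" "good x' y'" "F (\<iota> x y) = F (\<iota> x' y')" for x y x' y'
  proof -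
    have "\<iota> x y = \<iota> x' y'" using inj that \<iota>(1) by (meson inj_onD)
    then have "span (insert x S1) = span (insert x' S1)" using \<iota>(2) that by metis
    then show False using good_ne[OF good_Q[OF that(1-3)]] by blast
  qed
  show False
  proof (rule four_points_types[of p q "p + q" "p - q" A B, folded Q_def])
    show "distinct [p, q, p + q, p - q]" by (rule dist)
  next
    fix x assume x: "x \<in> Q"
    from plus_fibre_image[OF pres, where S = "span (insert x S1)"]
    have "const_on k U_plus U_plus F (span (insert x S1)) \<or> const_on k U_plus U_minus F (span (insert x S1))"
      by (simp add: const_on_def)
    then show "(\<forall>y\<in>Q - {x}. \<forall>z\<in>Q - {x}. A x y = A x z) \<or> (\<forall>y\<in>Q - {x}. \<forall>z\<in>Q - {x}. B x y = B x z)"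
    proof
      assume c: "const_on k U_plus U_plus F (span (insert x S1))"
      have "A x y = A x z" if "y \<in> Q - {x}" "z \<in> Q - {x}" for y z
        unfolding A_def by (rule const_onD[OF c]) (use \<iota> good_Q x that in auto)
      then show ?thesis by blast
    next
      assume c: "const_on k U_plus U_minus F (span (insert x S1))"
      have "B x y = B x z" if "y \<in> Q - {x}" "z \<in> Q - {x}" for y z
        unfolding B_def by (rule const_onD[OF c]) (use \<iota> good_Q x that in auto)
      then show ?thesis by blast
    qed
  next
    fix y assume y: "y \<in> Q"
    from minus_fibre_image[OF pres, where U = "span (insert y U1)"] k
    have "const_on k U_minus U_plus F (span (insert y U1)) \<or> const_on k U_minus U_minus F (span (insert y U1))"
      by (simp add: const_on_def)
    then show "(\<forall>x\<in>Q - {y}. \<forall>z\<in>Q - {y}. A x y = A z y) \<or> (\<forall>x\<in>Q - {y}. \<forall>z\<in>Q - {y}. B x y = B z y)"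
    proof
      assume c: "const_on k U_minus U_plus F (span (insert y U1))"
      have "A x y = A z y" if "x \<in> Q - {y}" "z \<in> Q - {y}" for x z
        unfolding A_def by (rule const_onD[OF c]) (use \<iota> good_Q y that in auto)
      then show ?thesis by blast
    next
      assume c: "const_on k U_minus U_minus F (span (insert y U1))"
      have "B x y = B z y" if "x \<in> Q - {y}" "z \<in> Q - {y}" for x z
        unfolding B_def by (rule const_onD[OF c]) (use \<iota> good_Q y that in auto)
      then show ?thesis by blast
    qed
  next
    assume e: "A (p + q) q = A p (p - q)" "B (p + q) q = B p (p - q)"
    have Q: "p \<in> Q" "q \<in> Q" "p + q \<in> Q" "p - q \<in> Q" by (auto simp: Q_def)
    have g: "good (p + q) q" "good p (p - q)" using good_Q Q dist by auto
    have "F (\<iota> (p + q) q) = F (\<iota> p (p - q))"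
      by (rule involution_eqI) (use e lin \<iota> g in \<open>auto simp: A_def B_def\<close>)
    then show False using Fneq[OF Q(3,1) _ g] dist by auto
  next
    fix x y assume xy: "x \<in> Q" "y \<in> Q" "x \<noteq> y"
    show "A x y \<noteq> A y x"
    proof
      assume e: "A x y = A y x"
      have g: "good x y" "good y x" using good_Q xy by auto
      have "F (\<iota> x y) = F (\<iota> y x)"
        by (rule commute_same_plus_eq[OF lin lin comm])
          (use \<iota> g \<iota>_comm e in \<open>auto simp: A_def\<close>)
      then show False using Fneq[OF xy g] by blast
    qed
  next
    have Q: "p \<in> Q" "q \<in> Q" by (auto simp: Q_def)
    show "\<forall>y\<in>Q - {p}. \<forall>z\<in>Q - {p}. A p y = A p z"
    proof (intro ballI)
      fix y z assume "y \<in> Q - {p}" "z \<in> Q - {p}"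
      then have "good p y" "good p z" using good_Q Q by auto
      then show "A p y = A p z" unfolding A_def
        using const_onD[OF cS] \<iota> S1(3) by simp
    qed
    show "\<forall>x\<in>Q - {q}. \<forall>z\<in>Q - {q}. A x q = A z q"
    proof (intro ballI)
      fix x z assume "x \<in> Q - {q}" "z \<in> Q - {q}"
      then have "good x q" "good z q" using good_Q Q by auto
      then show "A x q = A z q" unfolding A_def
        using const_onD[OF cU] \<iota> U1(3) by simp
    qed
  qed
qed

section \<open>Uniform behaviour on all fibres\<close>

definition fibre_preserving :: "nat \<Rightarrow> (('v \<Rightarrow> 'v) \<Rightarrow> ('v \<Rightarrow> 'v)) \<Rightarrow> bool" where
  "fibre_preserving k F \<longleftrightarrow> (\<forall>X. const_on k U_plus U_plus F X \<and> const_on k U_minus U_minus F X)"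

definition fibre_reversing :: "nat \<Rightarrow> (('v \<Rightarrow> 'v) \<Rightarrow> ('v \<Rightarrow> 'v)) \<Rightarrow> bool" where
  "fibre_reversing k F \<longleftrightarrow> (\<forall>X. const_on k U_plus U_minus F X \<and> const_on k U_minus U_plus F X)"

text \<open>The fibres of complementary \<open>S\<close> and \<open>U\<close> are of different
  kinds, the case of two minus kinds following from the other one for the negated map. Since any two
  \<open>k\<close>-dimensional spaces have a common complement, all plus fibres behave
  alike.\<close>

lemma fibre_dichotomy:
  assumes pres: "\<And>\<sigma> \<sigma>'. \<sigma> \<in> Inv k \<Longrightarrow> \<sigma>' \<in> Inv k \<Longrightarrow> adjacent_involutions scale \<sigma> \<sigma>' \<Longrightarrow>
      adjacent_involutions scale (F \<sigma>) (F \<sigma>')"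
    and lin: "\<And>\<sigma>. \<sigma> \<in> Inv k \<Longrightarrow> linear_involution (F \<sigma>)" and inj: "inj_on F (Inv k)"
    and comm: "\<And>\<sigma> \<sigma>'. \<sigma> \<in> Inv k \<Longrightarrow> \<sigma>' \<in> Inv k \<Longrightarrow> \<sigma> \<circ> \<sigma>' = \<sigma>' \<circ> \<sigma> \<Longrightarrow> F \<sigma> \<circ> F \<sigma>' = F \<sigma>' \<circ> F \<sigma>"
    and k: "1 \<le> k" "k < dimension"
  shows "fibre_preserving k F \<or> fibre_reversing k F"
proof -
  let ?N = "\<lambda>\<sigma>. neg (F \<sigma>)"
  have c_neg: "const_on k E U_plus ?N X \<longleftrightarrow> const_on k E U_minus F X" for E X
    by (simp add: const_on_def)
  have plus: "const_on k U_plus U_plus F X \<or> const_on k U_plus U_minus F X" for X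
    using plus_fibre_image[OF pres, where S = X] by (simp add: const_on_def)
  have minus: "const_on k U_minus U_plus F X \<or> const_on k U_minus U_minus F X" for X
    using minus_fibre_image[OF pres, where U = X] k by (simp add: const_on_def)
  have not_pp: "\<not> (const_on k U_plus U_plus F S \<and> const_on k U_minus U_plus F U)"
    if "S \<in> Gr k" "U \<in> Gr (dimension - k)" "S \<inter> U = {0}" for S U
    using fibres_not_both_plus[OF pres lin inj comm k that] by blast
  have injN: "inj_on ?N (Inv k)"
    by (rule inj_onI) (metis neg_neg inj inj_onD)
  have commN: "?N \<sigma> \<circ> ?N \<sigma>' = ?N \<sigma>' \<circ> ?N \<sigma>" if "\<sigma> \<in> Inv k" "\<sigma>' \<in> Inv k" "\<sigma> \<circ> \<sigma>' = \<sigma>' \<circ> \<sigma>" for \<sigma> \<sigma>'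
  proof -
    have "F \<sigma> (F \<sigma>' x) = F \<sigma>' (F \<sigma> x)" for x using comm[OF that] by (metis comp_apply)
    then show ?thesis using lin that by (auto simp: neg_def fun_eq_iff linear_involution_simps)
  qed
  have not_mm: "\<not> (const_on k U_plus U_minus F S \<and> const_on k U_minus U_minus F U)"
    if SU: "S \<in> Gr k" "U \<in> Gr (dimension - k)" "S \<inter> U = {0}" for S U
  proof
    assume h: "const_on k U_plus U_minus F S \<and> const_on k U_minus U_minus F U"
    show False
    proof (rule fibres_not_both_plus[of k ?N S U])
      show "adjacent_involutions scale (?N \<sigma>) (?N \<sigma>')"
        if "\<sigma> \<in> Inv k" "\<sigma>' \<in> Inv k" "adjacent_involutions scale \<sigma> \<sigma>'" for \<sigma> \<sigma>'
        using pres that by (simp add: adjacent_neg)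
      show "linear_involution (?N \<sigma>)" if "\<sigma> \<in> Inv k" for \<sigma> using lin linear_involution_neg that by blast
    qed (use injN commN k SU h c_neg in auto)
  qed
  \<comment> \<open>Fibres over sets of the wrong kind are empty, so the condition is vacuous
    there.\<close>
  have vac: "const_on k U_plus D F X" if "X \<notin> Gr k" for X D
    using that involution_Gr(1) by (auto simp: const_on_def)
  have vac': "const_on k U_minus D F X" if "X \<notin> Gr (dimension - k)" for X D
    using that involution_Gr(2) by (auto simp: const_on_def)
  have compl: "\<exists>S\<in>Gr k. S \<inter> U = {0}" if U: "U \<in> Gr (dimension - k)" for U
  proof -
    have "subspace U" "dim U = dimension - k" using U by (auto simp: Gr_iff)
    then show ?thesis using complement_exists[of U] k by (auto simp: Int_commute)
  qed
  show ?thesis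
  proof (cases "\<exists>S0\<in>Gr k. const_on k U_plus U_plus F S0")
    case True
    then obtain S0 where S0: "S0 \<in> Gr k" "const_on k U_plus U_plus F S0" by blast
    have 1: "const_on k U_plus U_plus F S" if S: "S \<in> Gr k" for S
    proof -
      obtain U where "U \<in> Gr (dimension - k)" "S0 \<inter> U = {0}" "S \<inter> U = {0}"
        using common_complement[OF S0(1) S] k by auto
      then show ?thesis using not_pp not_mm S0 S plus minus by blast
    qed
    have "const_on k U_minus U_minus F U" if U: "U \<in> Gr (dimension - k)" for U
      using compl[OF U] 1 not_pp U minus by blast
    then show ?thesis using 1 vac vac' unfolding fibre_preserving_def by blast
  next
    case False
    then have 1: "const_on k U_plus U_minus F S" if "S \<in> Gr k" for S using plus that by blast
    have "const_on k U_minus U_plus F U" if U: "U \<in> Gr (dimension - k)" for U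
      using compl[OF U] 1 not_mm U minus by blast
    then show ?thesis using 1 vac vac' unfolding fibre_reversing_def by blast
  qed
qed

lemma fibre_preservingD:
  assumes "fibre_preserving k F" "\<sigma> \<in> Inv k" "\<sigma>' \<in> Inv k"
  shows "U_plus \<sigma> = U_plus \<sigma>' \<Longrightarrow> U_plus (F \<sigma>) = U_plus (F \<sigma>')"
    and "U_minus \<sigma> = U_minus \<sigma>' \<Longrightarrow> U_minus (F \<sigma>) = U_minus (F \<sigma>')"
  using assms const_onD[OF _ assms(2,3)] unfolding fibre_preserving_def by blast+

lemma fibre_reversingD:
  assumes "fibre_reversing k F" "\<sigma> \<in> Inv k" "\<sigma>' \<in> Inv k"
  shows "U_plus \<sigma> = U_plus \<sigma>' \<Longrightarrow> U_minus (F \<sigma>) = U_minus (F \<sigma>')"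
    and "U_minus \<sigma> = U_minus \<sigma>' \<Longrightarrow> U_plus (F \<sigma>) = U_plus (F \<sigma>')"
  using assms const_onD[OF _ assms(2,3)] unfolding fibre_reversing_def by blast+

lemma fibre_preservingI:
  assumes "\<And>\<sigma> \<sigma>'. \<sigma> \<in> Inv k \<Longrightarrow> \<sigma>' \<in> Inv k \<Longrightarrow> U_plus \<sigma> = U_plus \<sigma>' \<Longrightarrow> U_plus (F \<sigma>) = U_plus (F \<sigma>')"
    and "\<And>\<sigma> \<sigma>'. \<sigma> \<in> Inv k \<Longrightarrow> \<sigma>' \<in> Inv k \<Longrightarrow> U_minus \<sigma> = U_minus \<sigma>' \<Longrightarrow> U_minus (F \<sigma>) = U_minus (F \<sigma>')"
  shows "fibre_preserving k F"
  unfolding fibre_preserving_def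
proof (intro allI conjI const_onI)
  fix X \<sigma> \<sigma>' assume s: "\<sigma> \<in> Inv k" "\<sigma>' \<in> Inv k"
  show "U_plus (F \<sigma>) = U_plus (F \<sigma>')" if "U_plus \<sigma> = X" "U_plus \<sigma>' = X"
    by (rule assms(1)[OF s]) (simp add: that)
  show "U_minus (F \<sigma>) = U_minus (F \<sigma>')" if "U_minus \<sigma> = X" "U_minus \<sigma>' = X"
    by (rule assms(2)[OF s]) (simp add: that)
qed

text \<open>Complementary pairs are exactly the pairs of eigenspaces. Bijectivity of
  \<open>F\<close> therefore lifts each complementary pair to one, and injectivity of
  \<open>g\<close> and \<open>h\<close> identifies the lifted pair.\<close>

lemma fibre_preserving_complement_auto:
  assumes F: "bij_betw F (Inv k) (Inv k)" and fp: "fibre_preserving k F" and k: "k \<le> dimension"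
  obtains g h where "complement_auto k g h"
    "\<And>\<sigma>. \<sigma> \<in> Inv k \<Longrightarrow> U_plus (F \<sigma>) = g (U_plus \<sigma>)"
    "\<And>\<sigma>. \<sigma> \<in> Inv k \<Longrightarrow> U_minus (F \<sigma>) = h (U_minus \<sigma>)"
proof -
  \<comment> \<open>The chosen involution is irrelevant, because \<open>F\<close> has a constant
    plus space on the fibre.\<close>
  define g where "g S = U_plus (F (SOME \<sigma>. \<sigma> \<in> Inv k \<and> U_plus \<sigma> = S))" for S
  define h where "h U = U_minus (F (SOME \<sigma>. \<sigma> \<in> Inv k \<and> U_minus \<sigma> = U))" for U
  have g: "U_plus (F \<sigma>) = g (U_plus \<sigma>)" if s: "\<sigma> \<in> Inv k" for \<sigma>
  proof -
    have "\<exists>\<sigma>'. \<sigma>' \<in> Inv k \<and> U_plus \<sigma>' = U_plus \<sigma>" using s by blast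
    from someI_ex[OF this] show ?thesis
      unfolding g_def by (intro fibre_preservingD(1)[OF fp s]) simp_all
  qed
  have h: "U_minus (F \<sigma>) = h (U_minus \<sigma>)" if s: "\<sigma> \<in> Inv k" for \<sigma>
  proof -
    have "\<exists>\<sigma>'. \<sigma>' \<in> Inv k \<and> U_minus \<sigma>' = U_minus \<sigma>" using s by blast
    from someI_ex[OF this] show ?thesis
      unfolding h_def by (intro fibre_preservingD(2)[OF fp s]) simp_all
  qed
  have FI: "F \<sigma> \<in> Inv k" if "\<sigma> \<in> Inv k" for \<sigma> using F that by (rule bij_betw_apply)
  have Finj: "\<sigma> = \<sigma>'" if "\<sigma> \<in> Inv k" "\<sigma>' \<in> Inv k" "F \<sigma> = F \<sigma>'" for \<sigma> \<sigma>'
    using F that by (meson bij_betw_imp_inj_on inj_onD)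
  have Fsurj: "\<exists>\<sigma>\<in>Inv k. \<sigma>' = F \<sigma>" if "\<sigma>' \<in> Inv k" for \<sigma>'
    using bij_betw_imp_surj_on[OF F] that by blast
  have lin: "linear_involution \<sigma>" if "\<sigma> \<in> Inv k" for \<sigma> using that by (simp add: involutions_iff)
  have ex: "\<exists>\<sigma>\<in>Inv k. U_plus \<sigma> = S \<and> U_minus \<sigma> = U"
    if "S \<in> Gr k" "U \<in> Gr (dimension - k)" "S \<inter> U = {0}" for S U
    using involution_exists[OF that(1,2) k that(3)] by blast
  have eqI: "\<sigma> = \<sigma>'" if "\<sigma> \<in> Inv k" "\<sigma>' \<in> Inv k" "g (U_plus \<sigma>) = g (U_plus \<sigma>')" "h (U_minus \<sigma>) = h (U_minus \<sigma>')"
    for \<sigma> \<sigma>'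
  proof (rule Finj[OF that(1,2)], rule involution_eqI)
    show "linear_involution (F \<sigma>)" "linear_involution (F \<sigma>')" using FI lin that by blast+
    show "U_plus (F \<sigma>) = U_plus (F \<sigma>')"
      unfolding g[OF that(1)] g[OF that(2)] by (rule that(3))
    show "U_minus (F \<sigma>) = U_minus (F \<sigma>')"
      unfolding h[OF that(1)] h[OF that(2)] by (rule that(4))
  qed
  have exS: "\<exists>U\<in>Gr (dimension - k). S \<inter> U = {0}" if S: "S \<in> Gr k" for S
  proof -
    have S': "subspace S" "dim S = k" using S by (auto simp: Gr_iff)
    obtain U where "U \<in> Gr (dimension - dim S)" "S \<inter> U = {0}" by (rule complement_exists[OF S'(1)])
    then show ?thesis using S'(2) by blast
  qed
  have exU: "\<exists>S\<in>Gr k. S \<inter> U = {0}" if U: "U \<in> Gr (dimension - k)" for U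
  proof -
    have "subspace U" "dim U = dimension - k" using U by (auto simp: Gr_iff)
    then show ?thesis using complement_exists[of U] k by (auto simp: Int_commute)
  qed
  have fwd: "g S \<in> Gr k \<and> h U \<in> Gr (dimension - k) \<and> g S \<inter> h U = {0}"
    if SU: "S \<in> Gr k" "U \<in> Gr (dimension - k)" "S \<inter> U = {0}" for S U
    using ex[OF SU] FI g h involution_Gr by metis
  have bwd: "\<exists>S0\<in>Gr k. \<exists>U0\<in>Gr (dimension - k). S0 \<inter> U0 = {0} \<and> g S0 = S \<and> h U0 = U"
    if SU: "S \<in> Gr k" "U \<in> Gr (dimension - k)" "S \<inter> U = {0}" for S U
  proof -
    obtain \<sigma>' where s': "\<sigma>' \<in> Inv k" "U_plus \<sigma>' = S" "U_minus \<sigma>' = U" using ex[OF SU] by blast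
    obtain \<sigma> where s: "\<sigma> \<in> Inv k" "\<sigma>' = F \<sigma>" using Fsurj[OF s'(1)] by blast
    have "g (U_plus \<sigma>) = S" "h (U_minus \<sigma>) = U" using s s' g h by simp_all
    then show ?thesis using involution_Gr(1-3)[OF s(1)] by blast
  qed
  have gm: "g S \<in> Gr k" if "S \<in> Gr k" for S using exS[OF that] fwd that by blast
  have hm: "h U \<in> Gr (dimension - k)" if "U \<in> Gr (dimension - k)" for U using exU[OF that] fwd that by blast
  \<comment> \<open>Paired with a common complement \<open>U\<close>, the spaces \<open>S\<close>
    and \<open>T\<close> give two involutions whose images agree in both eigenspaces.\<close>
  have ginj: "S = T" if S: "S \<in> Gr k" and T: "T \<in> Gr k" and e: "g S = g T" for S T
  proof -
    obtain U where U: "U \<in> Gr (dimension - k)" "S \<inter> U = {0}" "T \<inter> U = {0}"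
      using common_complement[OF S T k] by blast
    obtain \<sigma> \<sigma>' where "\<sigma> \<in> Inv k" "U_plus \<sigma> = S" "U_minus \<sigma> = U" "\<sigma>' \<in> Inv k" "U_plus \<sigma>' = T" "U_minus \<sigma>' = U"
      using ex U S T by metis
    then show ?thesis using eqI e by metis
  qed
  have hinj: "U = W" if U: "U \<in> Gr (dimension - k)" and W: "W \<in> Gr (dimension - k)" and e: "h U = h W" for U W
  proof -
    obtain S where "S \<in> Gr (dimension - (dimension - k))" "U \<inter> S = {0}" "W \<inter> S = {0}"
      using common_complement[OF U W] by auto
    then have S: "S \<in> Gr k" "S \<inter> U = {0}" "S \<inter> W = {0}" using k by (auto simp: Int_commute)
    obtain \<sigma> \<sigma>' where "\<sigma> \<in> Inv k" "U_plus \<sigma> = S" "U_minus \<sigma> = U" "\<sigma>' \<in> Inv k" "U_plus \<sigma>' = S" "U_minus \<sigma>' = W"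
      using ex U W S by metis
    then show ?thesis using eqI e by metis
  qed
  have "bij_betw g (Gr k) (Gr k)"
  proof (rule bij_betw_imageI)
    show "inj_on g (Gr k)" by (rule inj_onI) (rule ginj)
    show "g ` Gr k = Gr k"
    proof
      show "g ` Gr k \<subseteq> Gr k" using gm by blast
      show "Gr k \<subseteq> g ` Gr k" using exS bwd by (metis image_eqI subsetI)
    qed
  qed
  moreover have "bij_betw h (Gr (dimension - k)) (Gr (dimension - k))"
  proof (rule bij_betw_imageI)
    show "inj_on h (Gr (dimension - k))" by (rule inj_onI) (rule hinj)
    show "h ` Gr (dimension - k) = Gr (dimension - k)"
    proof
      show "h ` Gr (dimension - k) \<subseteq> Gr (dimension - k)" using hm by blast
      show "Gr (dimension - k) \<subseteq> h ` Gr (dimension - k)" using exU bwd by (metis image_eqI subsetI)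
    qed
  qed
  moreover have "S \<inter> U = {0} \<longleftrightarrow> g S \<inter> h U = {0}" if S: "S \<in> Gr k" and U: "U \<in> Gr (dimension - k)" for S U
  proof
    show "g S \<inter> h U = {0}" if "S \<inter> U = {0}" using fwd S U that by blast
    assume "g S \<inter> h U = {0}"
    then obtain S0 U0 where "S0 \<in> Gr k" "U0 \<in> Gr (dimension - k)" "S0 \<inter> U0 = {0}" "g S0 = g S" "h U0 = h U"
      using bwd[OF gm[OF S] hm[OF U]] by blast
    then show "S \<inter> U = {0}" using ginj hinj S U by metis
  qed
  ultimately have "complement_auto k g h" by (simp add: complement_auto_def)
  then show ?thesis using that g h by blast
qed

section \<open>A symmetric form and orthogonal complements\<close>

text \<open>The dot product in the coordinates of \<open>Basis\<close>. Isotropic vectors may exist,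
  so \<open>perp X\<close> can meet \<open>X\<close>; the later arguments rest on dimensions and
  nondegeneracy only.\<close>

definition bform :: "'v \<Rightarrow> 'v \<Rightarrow> 'a" where
  "bform x y = (\<Sum>b\<in>Basis. representation Basis x b * representation Basis y b)"

lemma in_span_Basis [simp]: "x \<in> span Basis"
  by (simp add: span_Basis)

lemma bform_simps:
  "bform (x + y) z = bform x z + bform y z" "bform x (y + z) = bform x y + bform x z"
  "bform (scale c x) z = c * bform x z" "bform x (scale c z) = c * bform x z"
  "bform (- x) z = - bform x z" "bform x (- z) = - bform x z"
  "bform (x - y) z = bform x z - bform y z" "bform x (y - z) = bform x y - bform x z"
  "bform 0 z = 0" "bform x 0 = 0"
  by (simp_all add: bform_def representation_add representation_scale representation_neg
      representation_diff representation_zero independent_Basis algebra_simps sum.distrib sum_distrib_left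
      sum_negf sum_subtractf)

lemma bform_sym: "bform x y = bform y x"
  by (simp add: bform_def mult.commute)

text \<open>The vector whose coordinates are the values of \<open>\<phi>\<close> on
  \<open>Basis\<close> represents \<open>\<phi>\<close>.\<close>

lemma bform_functional:
  assumes "Vector_Spaces.linear scale (*) \<phi>"
  shows "\<exists>w. \<forall>x. \<phi> x = bform w x"
proof -
  have add: "\<phi> (x + y) = \<phi> x + \<phi> y" and sc: "\<phi> (scale c x) = c * \<phi> x" for x y c
    using assms by (auto simp: functional_iff)
  have z: "\<phi> 0 = 0" using sc[of 0 0] by simp
  have s: "\<phi> (sum f A) = (\<Sum>a\<in>A. \<phi> (f a))" if "finite A" for f :: "'v \<Rightarrow> 'v" and A
    using that by (induction A rule: finite_induct) (simp_all add: z add)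
  define w where "w = (\<Sum>b\<in>Basis. scale (\<phi> b) b)"
  have "representation Basis w = (\<lambda>c. \<Sum>b\<in>Basis. representation Basis (scale (\<phi> b) b) c)"
    unfolding w_def by (rule representation_sum[OF independent_Basis]) simp
  then have rw: "representation Basis w c = \<phi> c" if "c \<in> Basis" for c
  proof -
    have "representation Basis w c = (\<Sum>b\<in>Basis. \<phi> b * (if c = b then 1 else 0))"
      using \<open>representation Basis w = _\<close>
      by (simp add: representation_scale[OF independent_Basis] representation_basis[OF independent_Basis] eq_commute)
    also have "\<dots> = \<phi> c" using that finite_Basis by (simp add: if_distrib cong: if_cong)
    finally show ?thesis .
  qed
  have "\<phi> x = bform w x" for x
  proof -
    have "x = (\<Sum>b\<in>Basis. scale (representation Basis x b) b)"
      using sum_representation_eq[OF independent_Basis _ finite_Basis order_refl, of x] by simp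
    then have "\<phi> x = \<phi> (\<Sum>b\<in>Basis. scale (representation Basis x b) b)" by simp
    also have "\<dots> = (\<Sum>b\<in>Basis. representation Basis x b * \<phi> b)" by (simp add: s[OF finite_Basis] sc)
    also have "\<dots> = bform w x" unfolding bform_def by (rule sum.cong) (simp_all add: rw)
    finally show ?thesis .
  qed
  then show ?thesis by blast
qed

lemma bform_nondegenerate:
  assumes "\<And>y. bform x y = 0"
  shows "x = 0"
proof -
  have "representation Basis x b = 0" for b
  proof (cases "b \<in> Basis")
    case True
    have "bform x b = (\<Sum>c\<in>Basis. representation Basis x c * (if c = b then 1 else 0))"
      unfolding bform_def by (simp add: representation_basis[OF independent_Basis True])
    also have "\<dots> = representation Basis x b" using True finite_Basis by (simp add: if_distrib cong: if_cong)
    finally show ?thesis using assms by simp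
  next
    case False then show ?thesis using representation_ne_zero by blast
  qed
  then show ?thesis
    using sum_representation_eq[OF independent_Basis _ finite_Basis order_refl, of x] by simp
qed

definition perp :: "'v set \<Rightarrow> 'v set" where
  "perp X = {x. \<forall>y\<in>X. bform x y = 0}"

lemma perp_antimono: "X \<subseteq> Y \<Longrightarrow> perp Y \<subseteq> perp X"
  by (auto simp: perp_def)

lemma perp_subspace: "subspace (perp X)"
  by (rule subspaceI) (auto simp: perp_def bform_simps)

text \<open>A basis of \<open>T\<close> is extended by \<open>x\<close> and then to all of
  \<open>V\<close>; the coordinate at \<open>x\<close> kills \<open>T\<close>, and the form
  represents it by a vector.\<close>

lemma separating_functional:
  assumes T: "subspace T" and x: "x \<notin> T"
  obtains w where "w \<in> perp T" "bform w x \<noteq> 0"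
proof -
  obtain C where C: "C \<subseteq> T" "independent C" "T \<subseteq> span C" using basis_exists[of T] by metis
  have spC: "span C = T" using C T by (metis span_subspace)
  have i: "independent (insert x C)" using x spC C by (simp add: independent_insertI)
  define D where "D = extend_basis (insert x C)"
  have D: "insert x C \<subseteq> D" "independent D" "span D = UNIV"
    unfolding D_def using extend_basis_superset[OF i] independent_extend_basis[OF i] span_extend_basis[OF i] by auto
  define \<phi> where "\<phi> v = representation D v x" for v
  have "Vector_Spaces.linear scale (*) \<phi>"
    using D by (simp add: functional_iff \<phi>_def representation_add representation_scale)
  then obtain w where w: "\<forall>v. \<phi> v = bform w v" using bform_functional by blast
  have "\<phi> t = 0" if "t \<in> T" for t
  proof -
    have "representation D t = representation C t"
      using that spC D by (intro representation_extend) auto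
    moreover have "x \<notin> C" using C x by blast
    ultimately show ?thesis using representation_ne_zero[of C t x] by (auto simp: \<phi>_def)
  qed
  then have "w \<in> perp T" using w by (simp add: perp_def)
  moreover have "\<phi> x = 1" using D by (simp add: \<phi>_def representation_basis)
  ultimately show ?thesis using that w by (metis one_neq_zero)
qed

text \<open>Adjoining \<open>x\<close> to \<open>T\<close> cuts \<open>perp T\<close> down to the
  kernel of pairing with \<open>x\<close>, which is nonzero on \<open>perp T\<close>; so each new
  vector costs one dimension.\<close>

lemma perp_Gr: "X \<in> Gr m \<Longrightarrow> perp X \<in> Gr (dimension - m)"
proof (induction m arbitrary: X)
  case 0
  then have "X = {0}" by (auto simp: Gr_iff subspace_0)
  then have "perp X = UNIV" by (auto simp: perp_def bform_simps)
  then show ?case using dim_UNIV_dimension by (simp add: Gr_iff)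
next
  case (Suc m)
  obtain x where x: "x \<in> X" "x \<noteq> 0" using Gr_Suc_nonzero[OF Suc.prems] by blast
  obtain T where T: "T \<in> Gr m" "x \<notin> T" "X = span (insert x T)"
    by (rule Gr_Suc_decompose[OF Suc.prems x])
  have sT: "subspace T" using T by (simp add: Gr_iff)
  obtain w where w: "w \<in> perp T" "bform w x \<noteq> 0" by (rule separating_functional[OF sT T(2)])
  have "perp X = {y\<in>perp T. bform y x = 0}"
    unfolding T(3) perp_def
    by (auto simp: mem_span_insert_subspace[OF sT] bform_simps)
      (metis T(3) insertCI span_base, metis insertCI span_base)
  moreover have "Vector_Spaces.linear scale (*) (\<lambda>y. bform y x)"
    by (simp add: functional_iff bform_simps)
  then have "Suc (dim {y\<in>perp T. bform y x = 0}) = dim (perp T)"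
    by (rule dim_functional_kernel[where \<phi> = "\<lambda>y. bform y x", OF perp_subspace _ w])
  ultimately show ?case using Suc.IH[OF T(1)] perp_subspace[of X] by (simp add: Gr_iff)
qed

lemma perp_perp:
  assumes "subspace X"
  shows "perp (perp X) = X"
proof -
  have X: "X \<in> Gr (dim X)" using assms by (simp add: Gr_iff)
  have "X \<subseteq> perp (perp X)" by (auto simp: perp_def) (metis bform_sym)
  moreover have "perp (perp X) \<in> Gr (dim X)"
    using perp_Gr[OF perp_Gr[OF X]] dim_le_dimension[of X] by simp
  ultimately show ?thesis using Gr_subset_eq X by blast
qed

lemma perp_disjoint:
  assumes "X \<in> Gr k" "Y \<in> Gr (dimension - k)" "k \<le> dimension" "X \<inter> Y = {0}"
  shows "perp X \<inter> perp Y = {0}"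
proof -
  have "x = 0" if x: "x \<in> perp X" "x \<in> perp Y" for x
  proof (rule bform_nondegenerate)
    fix y
    have "y \<in> span (X \<union> Y)" using complement_span[OF assms] by simp
    then obtain u v where "u \<in> X" "v \<in> Y" "y = u + v"
      using span_subspace_Un[of X Y] assms by (auto simp: Gr_iff)
    then show "bform x y = 0" using x by (simp add: perp_def bform_simps)
  qed
  then show ?thesis using perp_subspace by (auto simp: subspace_0)
qed

text \<open>The adjoint of \<open>\<sigma>\<close> with respect to \<open>bform\<close>, described
  by its eigenspaces; under the identification of \<open>V\<close> with its dual this is the
  contragredient.\<close>

definition perp_involution :: "('v \<Rightarrow> 'v) \<Rightarrow> 'v \<Rightarrow> 'v" where
  "perp_involution \<sigma> = (SOME \<rho>. linear_involution \<rho> \<and>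
    U_plus \<rho> = perp (U_minus \<sigma>) \<and> U_minus \<rho> = perp (U_plus \<sigma>))"

lemma perp_involution:
  assumes s: "\<sigma> \<in> Inv k"
  shows "perp_involution \<sigma> \<in> Inv k" "U_plus (perp_involution \<sigma>) = perp (U_minus \<sigma>)"
    "U_minus (perp_involution \<sigma>) = perp (U_plus \<sigma>)"
proof -
  note G = involution_Gr[OF s]
  have P: "perp (U_minus \<sigma>) \<in> Gr k" using perp_Gr[OF G(2)] G(4) by simp
  have d: "perp (U_minus \<sigma>) \<inter> perp (U_plus \<sigma>) = {0}"
    using perp_disjoint[OF G(1,2,4,3)] by (simp add: Int_commute)
  obtain \<rho> where r: "\<rho> \<in> Inv k" "U_plus \<rho> = perp (U_minus \<sigma>)" "U_minus \<rho> = perp (U_plus \<sigma>)"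
    by (rule involution_exists[OF P perp_Gr[OF G(1)] G(4) d])
  then have "\<exists>\<rho>. linear_involution \<rho> \<and> U_plus \<rho> = perp (U_minus \<sigma>) \<and> U_minus \<rho> = perp (U_plus \<sigma>)"
    by (auto simp: involutions_iff)
  from someI_ex[OF this] P
  show "perp_involution \<sigma> \<in> Inv k" "U_plus (perp_involution \<sigma>) = perp (U_minus \<sigma>)"
    "U_minus (perp_involution \<sigma>) = perp (U_plus \<sigma>)"
    unfolding perp_involution_def[symmetric] involutions_iff Gr_iff by auto
qed

lemma perp_involution_twice:
  assumes s: "\<sigma> \<in> Inv k"
  shows "perp_involution (perp_involution \<sigma>) = \<sigma>"
proof (rule involution_eqI)
  note P = perp_involution[OF s] and PP = perp_involution[OF perp_involution(1)[OF s]]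
  show "linear_involution (perp_involution (perp_involution \<sigma>))" "linear_involution \<sigma>"
    using PP s by (auto simp: involutions_iff)
  have "subspace (U_plus \<sigma>)" "subspace (U_minus \<sigma>)" using involution_Gr[OF s] by (auto simp: Gr_iff)
  then show "U_plus (perp_involution (perp_involution \<sigma>)) = U_plus \<sigma>"
    "U_minus (perp_involution (perp_involution \<sigma>)) = U_minus \<sigma>"
    using PP P by (simp_all add: perp_perp)
qed

lemma bij_perp_involution: "bij_betw perp_involution (Inv k) (Inv k)"
  by (rule bij_betw_byWitness[where f' = perp_involution])
    (auto simp: perp_involution_twice perp_involution)

section \<open>Collineations and correlations from maps of eigenspaces\<close>

definition geometric :: "nat \<Rightarrow> (('v \<Rightarrow> 'v) \<Rightarrow> ('v \<Rightarrow> 'v)) \<Rightarrow> bool" where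
  "geometric k F \<longleftrightarrow> (\<exists>l. collineation scale l \<and>
    (\<forall>\<sigma>\<in>Inv k. U_plus (F \<sigma>) = l ` U_plus \<sigma> \<and> U_minus (F \<sigma>) = l ` U_minus \<sigma>))"

text \<open>The conjugate of \<open>\<sigma>\<close> by \<open>l\<close> and the image
  \<open>F \<sigma>\<close> act by the same signs on the images of the eigenspaces, and these span
  \<open>V\<close>.\<close>

lemma geometric_collineation:
  assumes F: "\<And>\<sigma>. \<sigma> \<in> Inv k \<Longrightarrow> F \<sigma> \<in> Inv k" and g: "geometric k F"
  shows "defined_by_collineation scale (Inv k) F"
proof -
  obtain l where l: "collineation scale l"
    "\<And>\<sigma>. \<sigma> \<in> Inv k \<Longrightarrow> U_plus (F \<sigma>) = l ` U_plus \<sigma> \<and> U_minus (F \<sigma>) = l ` U_minus \<sigma>"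
    using g by (auto simp: geometric_def)
  have bij: "bij l" and add: "\<And>x y. l (x + y) = l x + l y"
    using l(1) unfolding collineation_def semilinear_def by auto
  have diff: "l (x - y) = l x - l y" for x y using add[of "x - y" y] by (simp add: algebra_simps)
  have "F \<sigma> = l \<circ> \<sigma> \<circ> inv l" if s: "\<sigma> \<in> Inv k" for \<sigma>
  proof
    fix y
    have lin: "linear_involution \<sigma>" "linear_involution (F \<sigma>)" using F s by (auto simp: involutions_iff)
    obtain a b where ab: "a \<in> U_plus (F \<sigma>)" "b \<in> U_minus (F \<sigma>)" "y = a + b"
      by (rule involution_decompose[OF lin(2)])
    obtain u v where uv: "u \<in> U_plus \<sigma>" "a = l u" "v \<in> U_minus \<sigma>" "b = l v" using ab l(2)[OF s] by auto
    have "inv l y = u + v" using ab uv bij by (metis add bij_is_inj inv_f_f)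
    then have "(l \<circ> \<sigma> \<circ> inv l) y = l (u - v)"
      using uv lin by (simp add: linear_involution_simps U_plus_def U_minus_def)
    also have "\<dots> = F \<sigma> y"
      using ab uv lin by (simp add: linear_involution_simps U_plus_def U_minus_def diff)
    finally show "F \<sigma> y = (l \<circ> \<sigma> \<circ> inv l) y" by simp
  qed
  then show ?thesis using l(1) unfolding defined_by_collineation_def by blast
qed

lemma field_automorphism_inv:
  assumes "field_automorphism \<tau>"
  shows "field_automorphism (inv \<tau>)"
proof -
  have b: "bij \<tau>" and t: "\<tau> 1 = 1" "\<And>a b. \<tau> (a + b) = \<tau> a + \<tau> b" "\<And>a b. \<tau> (a * b) = \<tau> a * \<tau> b"
    using assms by (auto simp: field_automorphism_def)
  have i: "inv \<tau> (\<tau> x) = x" "\<tau> (inv \<tau> x) = x" for x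
    using b by (simp_all add: bij_is_inj bij_is_surj surj_f_inv_f)
  show ?thesis unfolding field_automorphism_def
    using b t i by (metis bij_imp_bij_inv)
qed

text \<open>The collineation \<open>l\<close> is followed by the identification of \<open>V\<close>
  with its dual. On eigenspaces the pairing of \<open>x\<close> with \<open>l y\<close> has no mixed
  terms, so \<open>\<sigma>\<close> on one side can be replaced by \<open>F \<sigma>\<close> on the
  other.\<close>

lemma geometric_correlation:
  assumes F: "\<And>\<sigma>. \<sigma> \<in> Inv k \<Longrightarrow> F \<sigma> \<in> Inv k" and g: "geometric k (\<lambda>\<sigma>. perp_involution (F \<sigma>))"
  shows "defined_by_correlation scale (Inv k) F"
proof -
  obtain l where l: "collineation scale l"
    "\<And>\<sigma>. \<sigma> \<in> Inv k \<Longrightarrow> U_plus (perp_involution (F \<sigma>)) = l ` U_plus \<sigma> \<and>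
      U_minus (perp_involution (F \<sigma>)) = l ` U_minus \<sigma>"
    using g by (auto simp: geometric_def)
  obtain \<tau> where \<tau>: "field_automorphism \<tau>" and ladd: "\<forall>x y. l (x + y) = l x + l y"
    and lsc: "\<forall>c x. l (scale c x) = scale (\<tau> c) (l x)" and bij: "bij l"
    using l(1) unfolding collineation_def semilinear_def by blast
  have linv: "inv l (l x) = x" "l (inv l x) = x" for x
    using bij by (simp_all add: bij_is_inj bij_is_surj surj_f_inv_f)
  have ldiff: "l (x - y) = l x - l y" for x y using ladd[rule_format, of "x - y" y] by (simp add: algebra_simps)
  have tb: "bij \<tau>" and tadd: "\<tau> (a + b) = \<tau> a + \<tau> b" and tmul: "\<tau> (a * b) = \<tau> a * \<tau> b" for a b
    using \<tau> by (auto simp: field_automorphism_def)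
  define t where "t = inv \<tau>"
  have t: "field_automorphism t" unfolding t_def by (rule field_automorphism_inv[OF \<tau>])
  have taddi: "t (a + b) = t a + t b" and tmuli: "t (a * b) = t a * t b" for a b
    using t by (auto simp: field_automorphism_def)
  have tinv: "t (\<tau> x) = x" "\<tau> (t x) = x" for x
    using tb by (simp_all add: t_def bij_is_inj bij_is_surj surj_f_inv_f)
  \<comment> \<open>The inverse automorphism \<open>t\<close> undoes the twist by
    \<open>\<tau>\<close> in \<open>l\<close>, which makes \<open>h x\<close> linear;
    \<open>h\<close> itself is then semilinear with respect to \<open>t\<close>.\<close>
  define h where "h x = (\<lambda>y. t (bform x (l y)))" for x
  have hdual: "h x \<in> dual_space scale" for x
    by (simp add: dual_space_def functional_iff h_def ladd lsc bform_simps taddi tmuli tinv)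
  have hsemi: "semilinear scale (\<lambda>c \<phi> x. c * \<phi> x) h"
    unfolding semilinear_def using t
    by (intro exI[of _ t]) (auto simp: h_def fun_eq_iff bform_simps taddi tmuli)
  have hinj: "inj h"
  proof (rule injI)
    fix x x' assume "h x = h x'"
    then have "t (bform x (l y)) = t (bform x' (l y))" for y by (metis h_def)
    then have "bform x (l y) = bform x' (l y)" for y by (metis tinv(2))
    then have "bform (x - x') w = 0" for w
      using linv(2)[of w] by (metis bform_simps(7) eq_iff_diff_eq_0)
    then have "x - x' = 0" by (rule bform_nondegenerate)
    then show "x = x'" by simp
  qed
  have hsurj: "dual_space scale \<subseteq> range h"
  proof
    fix \<phi> assume "\<phi> \<in> dual_space scale"
    then have \<phi>: "\<And>x y. \<phi> (x + y) = \<phi> x + \<phi> y" "\<And>c x. \<phi> (scale c x) = c * \<phi> x"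
      by (auto simp: dual_space_def functional_iff)
    \<comment> \<open>Conversely, transporting \<open>\<phi>\<close> through \<open>l\<close> and
      \<open>\<tau>\<close> gives a linear functional, and the form represents it.\<close>
    define \<psi> where "\<psi> w = \<tau> (\<phi> (inv l w))" for w
    have ia: "inv l (x + y) = inv l x + inv l y" for x y by (metis ladd linv)
    have isc: "inv l (scale c x) = scale (t c) (inv l x)" for c x by (metis lsc linv tinv(2))
    have "Vector_Spaces.linear scale (*) \<psi>"
      by (simp add: functional_iff \<psi>_def ia isc \<phi> tadd tmul tinv)
    then obtain z where z: "\<forall>w. \<psi> w = bform z w" using bform_functional by blast
    have "h z y = t (\<psi> (l y))" for y by (simp add: h_def z)
    then have "h z y = \<phi> y" for y by (simp add: \<psi>_def linv tinv)
    then have "\<phi> = h z" by (simp add: fun_eq_iff)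
    then show "\<phi> \<in> range h" by blast
  qed
  have corr: "correlation scale h"
    unfolding correlation_def bij_betw_def using hsemi hinj hdual hsurj by blast
  have "F \<sigma> = inv h \<circ> contragredient scale \<sigma> \<circ> h" if s: "\<sigma> \<in> Inv k" for \<sigma>
  proof
    fix x
    have lin: "linear_involution \<sigma>" "linear_involution (F \<sigma>)" using F s by (auto simp: involutions_iff)
    have dual_comp: "\<phi> \<circ> \<sigma> \<in> dual_space scale" if "\<phi> \<in> dual_space scale" for \<phi>
      using that lin by (simp add: dual_space_def functional_iff linear_involution_simps)
    have twice: "\<phi> \<circ> \<sigma> \<circ> \<sigma> = \<phi>" for \<phi> :: "'v \<Rightarrow> 'a"
      using lin by (simp add: fun_eq_iff linear_involution_simps)
    have inja: "inj_on (adjoint_map \<sigma>) (dual_space scale :: ('v \<Rightarrow> 'a) set)"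
      by (rule inj_onI) (metis adjoint_map_def twice)
    \<comment> \<open>For an involution the adjoint map is its own inverse.\<close>
    have "contragredient scale \<sigma> (h x) = h x \<circ> \<sigma>"
      unfolding contragredient_def
      by (rule inv_into_f_eq[OF inja dual_comp[OF hdual]]) (simp add: adjoint_map_def twice)
    also have "\<dots> = h (F \<sigma> x)"
    proof
      fix y
      obtain a b where ab: "a \<in> U_plus (F \<sigma>)" "b \<in> U_minus (F \<sigma>)" "x = a + b"
        by (rule involution_decompose[OF lin(2)])
      obtain u v where uv: "u \<in> U_plus \<sigma>" "v \<in> U_minus \<sigma>" "y = u + v"
        by (rule involution_decompose[OF lin(1)])
      \<comment> \<open>So the mixed pairings vanish, and the sign change on \<open>y\<close> and
        the one on \<open>x\<close> have the same effect.\<close>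
      have "l u \<in> perp (U_minus (F \<sigma>))" "l v \<in> perp (U_plus (F \<sigma>))"
        using l(2)[OF s] perp_involution[OF F[OF s]] uv by auto
      then have "bform b (l u) = 0" "bform a (l v) = 0"
        using ab by (simp_all add: perp_def bform_sym)
      moreover have "\<sigma> y = u - v" "F \<sigma> x = a - b"
        using ab uv lin by (simp_all add: linear_involution_simps U_plus_def U_minus_def)
      ultimately show "(h x \<circ> \<sigma>) y = h (F \<sigma> x) y"
        using ab uv by (simp add: h_def bform_simps ladd ldiff)
    qed
    finally show "F \<sigma> x = (inv h \<circ> contragredient scale \<sigma> \<circ> h) x"
      using hinj by simp
  qed
  then show ?thesis using corr unfolding defined_by_correlation_def by blast
qed

section \<open>Combination of the cases\<close>

text \<open>Tops can go to stars only when \<open>dimension = 2 * k\<close>. Orthogonal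
  complementation reverses inclusion, so composing with it sends tops to tops again.\<close>

lemma fibre_preserving_geometric:
  assumes F: "bij_betw F (Inv k) (Inv k)" and fp: "fibre_preserving k F"
    and k: "1 \<le> k" "k < dimension" and n: "3 \<le> dimension"
  shows "geometric k F \<or> (dimension = 2 * k \<and> geometric k (\<lambda>\<sigma>. perp_involution (neg (F \<sigma>))))"
proof -
  obtain g h where gh: "complement_auto k g h"
    "\<And>\<sigma>. \<sigma> \<in> Inv k \<Longrightarrow> U_plus (F \<sigma>) = g (U_plus \<sigma>)"
    "\<And>\<sigma>. \<sigma> \<in> Inv k \<Longrightarrow> U_minus (F \<sigma>) = h (U_minus \<sigma>)"
    using fibre_preserving_complement_auto[OF F fp] k by (metis less_imp_le)
  have ind: "geometric k F" if gh: "complement_auto k g h"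
    "\<And>\<sigma>. \<sigma> \<in> Inv k \<Longrightarrow> U_plus (F \<sigma>) = g (U_plus \<sigma>)"
    "\<And>\<sigma>. \<sigma> \<in> Inv k \<Longrightarrow> U_minus (F \<sigma>) = h (U_minus \<sigma>)"
    "2 * k = dimension \<Longrightarrow> tops_to_tops k g" for F g h
  proof -
    obtain l where "collineation scale l" "\<forall>S\<in>Gr k. g S = l ` S" "\<forall>U\<in>Gr (dimension - k). h U = l ` U"
      using complement_auto_induced[OF gh(1) k n gh(4)] by blast
    then show ?thesis unfolding geometric_def
      using gh(2,3) involution_Gr(1,2) by (intro exI[of _ l]) auto
  qed
  show ?thesis
  proof (cases "2 * k = dimension \<longrightarrow> tops_to_tops k g")
    case True then show ?thesis using ind[OF gh] by blast
  next
    case False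
    then have k2: "2 * k = dimension" "\<not> tops_to_tops k g" by auto
    obtain m where m: "k = Suc m" "1 \<le> m" using k2 n by (cases k) auto
    have "tops_to_stars k g" using tops_dichotomy[of m g h] gh(1) k2 m by auto
    \<comment> \<open>\<open>perp_involution\<close> exchanges the two kinds of fibres and so does
      \<open>neg\<close>; together they keep plus on plus.\<close>
    let ?G = "\<lambda>\<sigma>. perp_involution (neg (F \<sigma>))"
    have nk: "dimension - k = k" using k2 by simp
    have FI: "F \<sigma> \<in> Inv k" if "\<sigma> \<in> Inv k" for \<sigma> using F that by (rule bij_betw_apply)
    have negI: "neg \<sigma> \<in> Inv k" if "\<sigma> \<in> Inv k" for \<sigma> using neg_Inv[OF that] nk by simp
    have "bij_betw neg (Inv k) (Inv k)"
      by (rule bij_betw_byWitness[where f' = neg]) (use negI in auto)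
    then have "bij_betw (perp_involution \<circ> (neg \<circ> F)) (Inv k) (Inv k)"
      using F bij_perp_involution by (intro bij_betw_trans)
    then have G: "bij_betw ?G (Inv k) (Inv k)" by (simp add: comp_def)
    have Gp: "U_plus (?G \<sigma>) = perp (U_plus (F \<sigma>))" "U_minus (?G \<sigma>) = perp (U_minus (F \<sigma>))"
      if "\<sigma> \<in> Inv k" for \<sigma>
      using perp_involution(2,3)[OF negI[OF FI[OF that]]] by simp_all
    have "fibre_preserving k ?G"
    proof (rule fibre_preservingI)
      fix \<sigma> \<sigma>' assume s: "\<sigma> \<in> Inv k" "\<sigma>' \<in> Inv k"
      show "U_plus (?G \<sigma>) = U_plus (?G \<sigma>')" if "U_plus \<sigma> = U_plus \<sigma>'"
        unfolding Gp(1)[OF s(1)] Gp(1)[OF s(2)] fibre_preservingD(1)[OF fp s that] by (rule refl)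
      show "U_minus (?G \<sigma>) = U_minus (?G \<sigma>')" if "U_minus \<sigma> = U_minus \<sigma>'"
        unfolding Gp(2)[OF s(1)] Gp(2)[OF s(2)] fibre_preservingD(2)[OF fp s that] by (rule refl)
    qed
    then obtain g2 h2 where gh2: "complement_auto k g2 h2"
      "\<And>\<sigma>. \<sigma> \<in> Inv k \<Longrightarrow> U_plus (?G \<sigma>) = g2 (U_plus \<sigma>)"
      "\<And>\<sigma>. \<sigma> \<in> Inv k \<Longrightarrow> U_minus (?G \<sigma>) = h2 (U_minus \<sigma>)"
      using fibre_preserving_complement_auto[OF G] k by (metis less_imp_le)
    have g2: "g2 S = perp (g S)" if S: "S \<in> Gr k" for S
    proof -
      have "subspace S" "dim S = k" using S by (auto simp: Gr_iff)
      then obtain U where "U \<in> Gr (dimension - k)" "S \<inter> U = {0}" using complement_exists by metis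
      then obtain \<sigma> where "\<sigma> \<in> Inv k" "U_plus \<sigma> = S"
        using involution_exists[OF S] k by (metis less_imp_le)
      then show ?thesis using gh2(2) gh(2) Gp(1) by metis
    qed
    have "tops_to_tops k g2"
      unfolding tops_to_tops_def
    proof
      fix L assume L: "L \<in> Gr (Suc k)"
      obtain M where M: "M \<in> Gr (k - 1)" "\<forall>S\<in>Gr k. S \<subseteq> L \<longrightarrow> M \<subseteq> g S"
        using \<open>tops_to_stars k g\<close> L by (auto simp: tops_to_stars_def)
      \<comment> \<open>\<open>2 * k - (k - 1) = k + 1\<close>: the complement of the centre of a
        star is the space of a top.\<close>
      have "perp M \<in> Gr (Suc k)" using perp_Gr[OF M(1)] k2 m by (simp add: mult_2 Suc_diff_le flip: k2(1))
      moreover have "g2 S \<subseteq> perp M" if "S \<in> Gr k" "S \<subseteq> L" for S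
        using M that g2 perp_antimono by simp
      ultimately show "\<exists>L'\<in>Gr (Suc k). \<forall>S\<in>Gr k. S \<subseteq> L \<longrightarrow> g2 S \<subseteq> L'" by blast
    qed
    then have "geometric k ?G" using ind[OF gh2] by blast
    then show ?thesis using k2 by simp
  qed
qed

lemma fibre_reversing_perp:
  assumes F: "bij_betw F (Inv k) (Inv k)" and r: "fibre_reversing k F"
  shows "bij_betw (\<lambda>\<sigma>. perp_involution (F \<sigma>)) (Inv k) (Inv k)"
    "fibre_preserving k (\<lambda>\<sigma>. perp_involution (F \<sigma>))"
proof -
  have "bij_betw (perp_involution \<circ> F) (Inv k) (Inv k)"
    using F bij_perp_involution by (rule bij_betw_trans)
  then show "bij_betw (\<lambda>\<sigma>. perp_involution (F \<sigma>)) (Inv k) (Inv k)" by (simp add: comp_def)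
  have FI: "F \<sigma> \<in> Inv k" if "\<sigma> \<in> Inv k" for \<sigma> using F that by (rule bij_betw_apply)
  show "fibre_preserving k (\<lambda>\<sigma>. perp_involution (F \<sigma>))"
  proof (rule fibre_preservingI)
    fix \<sigma> \<sigma>' assume s: "\<sigma> \<in> Inv k" "\<sigma>' \<in> Inv k"
    note p = perp_involution(2,3)[OF FI[OF s(1)]] perp_involution(2,3)[OF FI[OF s(2)]]
    show "U_plus (perp_involution (F \<sigma>)) = U_plus (perp_involution (F \<sigma>'))" if "U_plus \<sigma> = U_plus \<sigma>'"
      unfolding p fibre_reversingD(1)[OF r s that] by (rule refl)
    show "U_minus (perp_involution (F \<sigma>)) = U_minus (perp_involution (F \<sigma>'))" if "U_minus \<sigma> = U_minus \<sigma>'"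
      unfolding p fibre_reversingD(2)[OF r s that] by (rule refl)
  qed
qed

lemma fibre_reversing_neg:
  assumes "fibre_reversing k F"
  shows "fibre_preserving k (\<lambda>\<sigma>. neg (F \<sigma>))"
  by (rule fibre_preservingI; unfold U_plus_neg U_minus_neg)
    (rule fibre_reversingD[OF assms], assumption+)+

text \<open>If \<open>F\<close> preserves the fibres, either \<open>F\<close> is given by a
  collineation or, in the middle dimension, its negative by a correlation. If \<open>F\<close>
  reverses them, composing with \<open>perp_involution\<close>, or with \<open>neg\<close> in the
  middle dimension, reduces to that case.\<close>

theorem transformation_defined:
  assumes F: "bij_betw F (Inv k) (Inv k)" and comm: "preserves_commutativity (Inv k) F"
    and adj: "preserves_adjacency scale (Inv k) F"
    and k: "1 \<le> k" "k < dimension" and n: "3 \<le> dimension"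
  shows "(defined_by_collineation scale (Inv k) F \<or> defined_by_correlation scale (Inv k) F) \<or>
    (dimension = 2 * k \<and> (defined_by_collineation scale (Inv k) (\<lambda>\<sigma>. neg (F \<sigma>)) \<or>
      defined_by_correlation scale (Inv k) (\<lambda>\<sigma>. neg (F \<sigma>))))"
proof -
  have FI: "F \<sigma> \<in> Inv k" if "\<sigma> \<in> Inv k" for \<sigma> using F that by (rule bij_betw_apply)
  have "fibre_preserving k F \<or> fibre_reversing k F"
  proof (rule fibre_dichotomy[OF _ _ _ _ k])
    show "adjacent_involutions scale (F \<sigma>) (F \<sigma>')"
      if "\<sigma> \<in> Inv k" "\<sigma>' \<in> Inv k" "adjacent_involutions scale \<sigma> \<sigma>'" for \<sigma> \<sigma>'
      using adj that by (simp add: preserves_adjacency_def)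
    show "linear_involution (F \<sigma>)" if "\<sigma> \<in> Inv k" for \<sigma> using FI[OF that] by (simp add: involutions_iff)
    show "inj_on F (Inv k)" using F by (rule bij_betw_imp_inj_on)
    show "F \<sigma> \<circ> F \<sigma>' = F \<sigma>' \<circ> F \<sigma>" if "\<sigma> \<in> Inv k" "\<sigma>' \<in> Inv k" "\<sigma> \<circ> \<sigma>' = \<sigma>' \<circ> \<sigma>" for \<sigma> \<sigma>'
      using comm that by (simp add: preserves_commutativity_def)
  qed
  then show ?thesis
  proof
    assume "fibre_preserving k F"
    from fibre_preserving_geometric[OF F this k n] show ?thesis
    proof
      assume "geometric k F"
      then show ?thesis using geometric_collineation[of k F, OF FI] by blast
    next
      assume g: "dimension = 2 * k \<and> geometric k (\<lambda>\<sigma>. perp_involution (neg (F \<sigma>)))"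
      have "neg (F \<sigma>) \<in> Inv k" if "\<sigma> \<in> Inv k" for \<sigma> using neg_Inv[OF FI[OF that]] g by simp
      then show ?thesis using g geometric_correlation[of k "\<lambda>\<sigma>. neg (F \<sigma>)"] by blast
    qed
  next
    assume r: "fibre_reversing k F"
    show ?thesis
    proof (cases "dimension = 2 * k")
      case False
      then have "geometric k (\<lambda>\<sigma>. perp_involution (F \<sigma>))"
        using fibre_preserving_geometric[OF fibre_reversing_perp[OF F r] k n] by blast
      then show ?thesis using geometric_correlation[of k F, OF FI] by blast
    next
      case True
      \<comment> \<open>Only in the middle dimension does negation keep the set of involutions;
        there it turns the reversing map into a preserving one.\<close>
      have negI: "neg \<sigma> \<in> Inv k" if "\<sigma> \<in> Inv k" for \<sigma> using neg_Inv[OF that] True by simp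
      have "bij_betw neg (Inv k) (Inv k)"
        by (rule bij_betw_byWitness[where f' = neg]) (use negI in auto)
      then have "bij_betw (neg \<circ> F) (Inv k) (Inv k)" using F by (intro bij_betw_trans)
      then have N: "bij_betw (\<lambda>\<sigma>. neg (F \<sigma>)) (Inv k) (Inv k)" by (simp add: comp_def)
      from fibre_preserving_geometric[OF N fibre_reversing_neg[OF r] k n] show ?thesis
      proof
        assume "geometric k (\<lambda>\<sigma>. neg (F \<sigma>))"
        then show ?thesis using geometric_collineation[of k "\<lambda>\<sigma>. neg (F \<sigma>)"] negI FI True by blast
      next
        assume "dimension = 2 * k \<and> geometric k (\<lambda>\<sigma>. perp_involution (neg (neg (F \<sigma>))))"
        then show ?thesis using geometric_correlation[of k F, OF FI] by simp
      qed
    qed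
  qed
qed

end

theorem theorem3p1:
  fixes scale :: "'a::field \<Rightarrow> 'v::ab_group_add \<Rightarrow> 'v" and n k :: nat
  assumes "vector_space scale"
    and "vector_space.dim scale (UNIV :: 'v set) = n"
    and "CHAR('a) \<noteq> 2"
    and "n \<ge> 3" and "1 \<le> k" and "k \<le> n - 1"
  shows "(n \<noteq> 2 * k \<longrightarrow>
        (\<forall>f. bij_betw f (involutions scale k (n - k)) (involutions scale k (n - k)) \<and>
            preserves_commutativity (involutions scale k (n - k)) f \<and>
            preserves_adjacency scale (involutions scale k (n - k)) f \<longrightarrow>
          defined_by_collineation scale (involutions scale k (n - k)) f \<or>
          defined_by_correlation scale (involutions scale k (n - k)) f)) \<and>
    (n = 2 * k \<longrightarrow>
       (\<forall>f. bij_betw f (involutions scale k k) (involutions scale k k) \<and>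
           preserves_commutativity (involutions scale k k) f \<and>
           preserves_adjacency scale (involutions scale k k) f \<longrightarrow>
         (\<exists>f' \<in> {f, \<lambda>\<sigma> x. - (f \<sigma> x)}.
           defined_by_collineation scale (involutions scale k k) f' \<or>
           defined_by_correlation scale (involutions scale k k) f')))"
proof -
  interpret V: vector_space scale by fact
  obtain B where B: "V.independent B" "UNIV \<subseteq> V.span B" "card B = n"
    using V.basis_exists[of UNIV] assms(2) by metis
  \<comment> \<open>An infinite set has cardinality \<open>0\<close>, whereas \<open>n\<close> is at
    least three.\<close>
  have "finite B" using B assms(4) card.infinite by fastforce
  have two: "(2::'a) \<noteq> 0"
  proof
    assume "(2::'a) = 0"
    then have "of_nat 2 = (0::'a)" by simp
    then have "CHAR('a) dvd 2" by (simp only: of_nat_eq_0_iff_char_dvd)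
    \<comment> \<open>A vanishing \<open>2\<close> makes the characteristic a divisor of two; the
      value \<open>1\<close> cannot occur in a field.\<close>
    then have "CHAR('a) = 1 \<or> CHAR('a) = 2" using two_is_prime_nat unfolding prime_nat_iff by blast
    then show False using assms(3) CHAR_not_1'[where ?'a = 'a] by simp
  qed
  interpret W: involution_space scale B
    by unfold_locales (use B \<open>finite B\<close> two in auto)
  have d: "W.dimension = n" using B by (simp add: W.dimension_def)
  have k: "k < W.dimension" "3 \<le> W.dimension" using assms d by auto
  note main = W.transformation_defined[OF _ _ _ assms(5) k]
  show ?thesis
  proof (intro conjI impI allI)
    fix f
    assume "n \<noteq> 2 * k"
      "bij_betw f (involutions scale k (n - k)) (involutions scale k (n - k)) \<and>
       preserves_commutativity (involutions scale k (n - k)) f \<and>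
       preserves_adjacency scale (involutions scale k (n - k)) f"
    then show "defined_by_collineation scale (involutions scale k (n - k)) f \<or>
        defined_by_correlation scale (involutions scale k (n - k)) f"
      using main[of f] d by auto
  next
    fix f
    assume n: "n = 2 * k"
      and "bij_betw f (involutions scale k k) (involutions scale k k) \<and>
       preserves_commutativity (involutions scale k k) f \<and>
       preserves_adjacency scale (involutions scale k k) f"
    moreover have "W.dimension - k = k" using n d by simp
    ultimately show "\<exists>f'\<in>{f, \<lambda>\<sigma> x. - f \<sigma> x}.
        defined_by_collineation scale (involutions scale k k) f' \<or>
        defined_by_correlation scale (involutions scale k k) f'"
      using main[of f] by (auto simp: W.neg_def)
  qed
qed

end
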